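(* Let $V,W,U$ be finite-dimensional real vector spaces, $\mathbf X\in\mathscr C^p_\omega([0,T],V)$, $F\in C^\infty(W,\mathcal L(V,W))$, and let $\mathbf Y\in\mathscr C^p_\omega([0,T],W)$ be the rough path solution on $[0,T]$ of $\mathrm d\mathbf Y=F(Y)\,\mathrm d\mathbf X$, $Y_0=y_0$. Let $g\in C^\infty(W,U)$. Then $(\mathbf Y,g_*\mathbf Y)$ jointly solve the RDE $$\mathrm d\begin{pmatrix}\mathbf Y\\ \mathbf Z\end{pmatrix}=\begin{pmatrix}F(Y)\\ Dg(Y)F(Y)\end{pmatrix}\mathrm d\mathbf X.$$ In particular, if $g$ is invertible, defining $C^\infty(U,\mathcal L(V,U))\ni F_g(z):=Dg(g^{-1}(z))F(g^{-1}(z))$, the rough path $g_*\mathbf Y$ coincides with the rough path solution to $$\mathrm d\mathbf Z=F_g(Z)\,\mathrm d\mathbf X.$$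
   Context: All vector spaces are finite-dimensional and real; $T^N(V)=\bigoplus_{n=0}^N V^{\otimes n}$, with $a^n$ the component of $a$ in $V^{\otimes n}$. $T>0$, $p\ge1$, $\Delta_T=\{(s,t):0\le s\le t\le T\}$. A control is a continuous $\omega:\Delta_T\to[0,\infty)$ with $\omega(t,t)=0$ and $\omega(s,u)+\omega(u,t)\le\omega(s,t)$ for $s\le u\le t$. For a path $Y$, $Y_{st}:=Y_t-Y_s$; $\mathcal C^p_\omega([0,T],E)$ is the set of continuous $E$-valued paths with $|Y_{st}|\le C\omega(s,t)^{1/p}$ for some $C$. We write $a_{st}\approx_m b_{st}$ if $a_{st}-b_{st}=O(\omega(s,t)^{m/p})$, i.e. $|a_{st}-b_{st}|\le C\omega(s,t)^{m/p}$ for a constant $C$; $\approx$ means $\approx_{\lfloor p\rfloor+1}$. Shuffles: $\mathrm{Sh}(n_1,\ldots,n_m)$ is the set of permutations $\sigma$ of $\{1,\ldots,n_1+\cdots+n_m\}$ increasing on each of the consecutive blocks of sizes $n_1,\ldots,n_m$; $\overline{\mathrm{Sh}}(n_1,\ldots,n_m)$ (for $n_i\ge1$) is the subset of those with also $\sigma(n_1)<\sigma(n_1+n_2)<\cdots<\sigma(n_1+\cdots+n_m)$. For $n=n_1+\cdots+n_m$ define on $V^{\otimes n}$ $$\widetilde\Delta^{n_1,\ldots,n_m}_{\mathrm{osh}}(v_1\otimes\cdots\otimes v_n)=\sum_{\sigma\in\overline{\mathrm{Sh}}(n_1,\ldots,n_m)}(v_{\sigma(1)}\otimes\cdots\otimes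 v_{\sigma(n_1)})\boxtimes\cdots\boxtimes(v_{\sigma(n-n_m+1)}\otimes\cdots\otimes v_{\sigma(n)}),$$ and $\Delta^{a,b}_{\mathrm{sh}}$ on $V^{\otimes(a+b)}$ by the same formula with $\mathrm{Sh}(a,b)$ ($a,b\ge0$); $\boxtimes$ is the external tensor product. Rough paths: $\mathbf X\in\mathscr C^p_\omega([0,T],V)$ is a continuous map $\mathbf X:\Delta_T\to T^{\lfloor p\rfloor}(V)$ with $\mathbf X^0=1$ and: $|\mathbf X^n_{st}|\le C\omega(s,t)^{n/p}$ for $1\le n\le\lfloor p\rfloor$; $\mathbf X_{st}=\mathbf X_{su}\otimes\mathbf X_{ut}$ truncated at degree $\lfloor p\rfloor$, $s\le u\le t$; $\mathbf X^a_{st}\boxtimes\mathbf X^b_{st}=\Delta^{a,b}_{\mathrm{sh}}\mathbf X^{a+b}_{st}$ for $a+b\le\lfloor p\rfloor$. Its trace is the path $X$ with increments $\mathbf X^1$ and a given initial value $X_0$. Controlled paths: $\overline H\in\mathscr D_{\mathbf X}(U)$ is an element of $\mathcal C^p_\omega([0,T],\mathcal L(T^{\lfloor p\rfloor-1}(V),U))$ such that, with $\overline H_n:=\overline H|_{V^{\otimes n}}$, for $n=0,\ldots,\lfloor p\rfloor-2$ and $a\in V^{\otimes n}$: $\langle\overline H_{n;t},a\rangle\approx_{\lfloor p\rfloor-n}\sum_{k=0}^{\lfloor p\rfloor-1-n}\langle\overline H_{n+k;s},\mathbf X^k_{st}\otimes a\rangle$. Its trace is $H:=\overline H_0$. Lift: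 for $\overline H\in\mathscr D_{\mathbf X}(U)$, $\uparrow_{\mathbf X}\overline H$ is the unique element of $\mathscr C^p_\omega([0,T],U)$ (it exists), with trace $H$, such that $(\uparrow_{\mathbf X}\overline H)^m_{st}\approx\sum_{n_1,\ldots,n_m\ge1,\ n_1+\cdots+n_m\le\lfloor p\rfloor}\langle\overline H_{n_1;s}\boxtimes\cdots\boxtimes\overline H_{n_m;s},\widetilde\Delta^{n_1,\ldots,n_m}_{\mathrm{osh}}\mathbf X^{n_1+\cdots+n_m}_{st}\rangle$ for $2\le m\le\lfloor p\rfloor$. Smooth functions: for a smooth map $f\in C^\infty(V,U)$, $\overline f(X):=(f(X),Df(X),\ldots,D^{\lfloor p\rfloor-1}f(X))\in\mathscr D_{\mathbf X}(U)$, and the pushforward is $f_*\mathbf X:=\uparrow_{\mathbf X}\overline f(X)$, a rough path with trace $f(X)$. RDEs: for $F\in C^\infty(W,\mathcal L(V,W))$ and $h\in C^\infty(W,E)$ let $Fh(y):=Dh(y)\circ F(y)\in\mathcal L(V,E)$ and inductively $F^nh:=F(F^{n-1}h)$, with values in $\mathcal L(V,\mathcal L(V^{\otimes(n-1)},E))=\mathcal L(V^{\otimes n},E)$ (first tensor slot = outermost derivative). A solution of $\mathrm dY=F(Y)\,\mathrm d\mathbf X$, $Y_0=y_0$, is a continuous path $Y:[0,T]\to W$ with $Y_0=y_0$ and, for all $h\in C^\infty(W,\mathbb R)$, $h(Y)_{st}\approx\sum_{n=1}^{\lfloor p\rfloor}\langle F^nh(Y_s),\mathbf X^n_{st}\rangle$.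 For a solution, $\overline Y:=(Y,F\mathbb 1(Y),\ldots,F^{\lfloor p\rfloor-1}\mathbb 1(Y))\in\mathscr D_{\mathbf X}(W)$, where $\mathbb 1$ is the identity of $W$ (so $F\mathbb 1=F$), and the rough path solution, the solution of $\mathrm d\mathbf Y=F(Y)\,\mathrm d\mathbf X$, is $\mathbf Y:=\uparrow_{\mathbf X}\overline Y$. Solutions are unique. Initial conditions only involve the trace; in the two RDEs of the claim written without one, they are $(Y_0,Z_0)=(y_0,g(y_0))$ and $Z_0=g(y_0)$ respectively. The pair of rough paths $(\mathbf Y,\mathbf Z)$ jointly solving a system means that the rough path solution, with values in $W\oplus U$, of the RDE with coefficient $(y,z)\mapsto(F(y),Dg(y)\circ F(y))\in\mathcal L(V,W\oplus U)$ has $W$- and $U$-components (images under the coordinate projections) $\mathbf Y$ and $\mathbf Z$. *)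

theory Defs
  imports "HOL-Analysis.Analysis" "HOL-Combinatorics.Permutations"
begin

section \<open>Tensors in coordinates\<close>

text \<open>
  A finite-dimensional real vector space is a type \<open>'v :: euclidean_space\<close>.  The basis vectors
  of its \<open>n\<close>-th tensor power are indexed by the words of length \<open>n\<close> over \<open>Basis\<close>, and a tensor is
  the function sending a word \<open>[b\<^sub>1, \<dots>, b\<^sub>n]\<close> to the coefficient of \<open>b\<^sub>1 \<otimes> \<dots> \<otimes> b\<^sub>n\<close>.
  A linear map on (sums of) tensor powers is given by its values on these basis tensors, hence is a
  function \<open>'v list \<Rightarrow> 'u\<close>.  An element of an external product of tensor powers (with factors of
  degrees \<open>ns\<close>) is a function of lists of words.
\<close>

type_synonym 'v tensor = "'v list \<Rightarrow> real"

definition words :: "nat \<Rightarrow> 'v::euclidean_space list set" where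
  "words n = {w. set w \<subseteq> Basis \<and> length w = n}"

definition words_upto :: "nat \<Rightarrow> 'v::euclidean_space list set" where
  "words_upto N = (\<Union>n\<le>N. words n)"

definition homogeneous :: "nat \<Rightarrow> 'v::euclidean_space tensor set" where
  "homogeneous n = {a. \<forall>w. w \<notin> words n \<longrightarrow> a w = 0}"

definition tcomp :: "nat \<Rightarrow> 'v::euclidean_space tensor \<Rightarrow> 'v tensor" where
  "tcomp n a = (\<lambda>w. if w \<in> words n then a w else 0)"

definition tnorm :: "nat \<Rightarrow> 'v::euclidean_space tensor \<Rightarrow> real" where
  "tnorm n a = L2_set a (words n)"

definition tmult :: "'v tensor \<Rightarrow> 'v tensor \<Rightarrow> 'v tensor" where
  "tmult a b = (\<lambda>w. \<Sum>k\<le>length w. a (take k w) * b (drop k w))"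

definition pairing :: "nat \<Rightarrow> ('v::euclidean_space list \<Rightarrow> 'u::real_vector) \<Rightarrow> 'v tensor \<Rightarrow> 'u" where
  "pairing n h a = (\<Sum>w\<in>words n. a w *\<^sub>R h w)"

text \<open>The map induced on tensors by a linear map \<open>L\<close>, i.e. \<open>L \<otimes> \<dots> \<otimes> L\<close> in each degree.\<close>

definition tensor_map ::
    "('v::euclidean_space \<Rightarrow> 'w::euclidean_space) \<Rightarrow> 'v tensor \<Rightarrow> 'w tensor" where
  "tensor_map L a = (\<lambda>w. if set w \<subseteq> Basis
     then \<Sum>v\<in>words (length w). a v * (\<Prod>i<length w. L (v ! i) \<bullet> w ! i) else 0)"


section \<open>Shuffles\<close>

text \<open>Positions are numbered from \<open>0\<close>, so block \<open>i\<close> of \<open>ns = [n\<^sub>1, \<dots>, n\<^sub>m]\<close> starts at the sum of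
  the first \<open>i\<close> entries.\<close>

definition Sh :: "nat list \<Rightarrow> (nat \<Rightarrow> nat) set" where
  "Sh ns = {\<sigma>. \<sigma> permutes {..<sum_list ns} \<and>
     (\<forall>i<length ns. strict_mono_on {sum_list (take i ns)..<sum_list (take (Suc i) ns)} \<sigma>)}"

definition ordered_Sh :: "nat list \<Rightarrow> (nat \<Rightarrow> nat) set" where
  "ordered_Sh ns = {\<sigma> \<in> Sh ns. \<forall>i j. i < j \<and> j < length ns \<longrightarrow>
     \<sigma> (sum_list (take (Suc i) ns) - 1) < \<sigma> (sum_list (take (Suc j) ns) - 1)}"

primrec blocks :: "nat list \<Rightarrow> 'a list \<Rightarrow> 'a list list" where
  "blocks [] w = []"
| "blocks (n # ns) w = take n w # blocks ns (drop n w)"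

text \<open>
  The linear extension of
  \<open>v\<^sub>1 \<otimes> \<dots> \<otimes> v\<^sub>n \<mapsto> \<Sum>\<sigma>\<in>S. (v\<^bsub>\<sigma>(1)\<^esub> \<otimes> \<dots>) \<boxtimes> \<dots> \<boxtimes> (\<dots> \<otimes> v\<^bsub>\<sigma>(n)\<^esub>)\<close>, with blocks of sizes
  \<open>ns\<close>, as coefficients with respect to the basis of the target indexed by lists of words \<open>ws\<close>.
\<close>

definition coproduct ::
    "(nat \<Rightarrow> nat) set \<Rightarrow> nat list \<Rightarrow> 'v::euclidean_space tensor \<Rightarrow> 'v list list \<Rightarrow> real" where
  "coproduct S ns a = (\<lambda>ws. \<Sum>v\<in>words (sum_list ns).
     a v * (\<Sum>\<sigma>\<in>S. if blocks ns (permute_list \<sigma> v) = ws then 1 else 0))"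

definition Delta_sh ::
    "nat \<Rightarrow> nat \<Rightarrow> 'v::euclidean_space tensor \<Rightarrow> 'v list list \<Rightarrow> real" where
  "Delta_sh m n = coproduct (Sh [m, n]) [m, n]"

definition Delta_osh ::
    "nat list \<Rightarrow> 'v::euclidean_space tensor \<Rightarrow> 'v list list \<Rightarrow> real" where
  "Delta_osh ns = coproduct (ordered_Sh ns) ns"

text \<open>Applying \<open>h\<close> in every factor of an external product of degrees \<open>ns = [n\<^sub>1, \<dots>, n\<^sub>m]\<close>;
  the result lies in the \<open>m\<close>-th tensor power of the target.\<close>

definition box_pairing ::
    "nat list \<Rightarrow> ('v::euclidean_space list \<Rightarrow> 'u::euclidean_space) \<Rightarrow> ('v list list \<Rightarrow> real) \<Rightarrow> 'u tensor"
  where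
  "box_pairing ns h c = (\<lambda>u. \<Sum>ws\<in>listset (map words ns).
     c ws * (\<Prod>i<length ns. h (ws ! i) \<bullet> u ! i))"

definition degree_lists :: "nat \<Rightarrow> nat \<Rightarrow> nat list set" where
  "degree_lists m N = {ns. length ns = m \<and> (\<forall>n\<in>set ns. 1 \<le> n) \<and> sum_list ns \<le> N}"


section \<open>Controls and rough paths\<close>

definition simplex2 :: "real \<Rightarrow> (real \<times> real) set" where
  "simplex2 T = {(s, t). 0 \<le> s \<and> s \<le> t \<and> t \<le> T}"

definition control :: "real \<Rightarrow> (real \<Rightarrow> real \<Rightarrow> real) \<Rightarrow> bool" where
  "control T \<omega> \<longleftrightarrow>
     continuous_on (simplex2 T) (\<lambda>(s, t). \<omega> s t) \<and>
     (\<forall>(s, t)\<in>simplex2 T. 0 \<le> \<omega> s t) \<and>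
     (\<forall>t\<in>{0..T}. \<omega> t t = 0) \<and>
     (\<forall>s u t. 0 \<le> s \<and> s \<le> u \<and> u \<le> t \<and> t \<le> T \<longrightarrow> \<omega> s u + \<omega> u t \<le> \<omega> s t)"

definition approx ::
    "(real \<Rightarrow> real \<Rightarrow> real) \<Rightarrow> real \<Rightarrow> real \<Rightarrow> nat \<Rightarrow>
     (real \<Rightarrow> real \<Rightarrow> 'e::real_normed_vector) \<Rightarrow> (real \<Rightarrow> real \<Rightarrow> 'e) \<Rightarrow> bool" where
  "approx \<omega> p T m a b \<longleftrightarrow>
     (\<exists>C. \<forall>(s, t)\<in>simplex2 T. norm (a s t - b s t) \<le> C * \<omega> s t powr (real m / p))"

definition Cp_paths ::
    "(real \<Rightarrow> real \<Rightarrow> real) \<Rightarrow> real \<Rightarrow> real \<Rightarrow> (real \<Rightarrow> 'e::real_normed_vector) set" where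
  "Cp_paths \<omega> p T = {Y. continuous_on {0..T} Y \<and>
     (\<exists>C. \<forall>(s, t)\<in>simplex2 T. norm (Y t - Y s) \<le> C * \<omega> s t powr (1 / p))}"

abbreviation level :: "real \<Rightarrow> nat" where
  "level p \<equiv> nat \<lfloor>p\<rfloor>"

text \<open>
  Rough paths are functions on all of \<open>real \<times> real\<close> and on all lists; the first condition fixes the
  values off the simplex and off the truncated tensor space, so that equality of functions is
  equality of rough paths.
\<close>

definition rough_paths ::
    "(real \<Rightarrow> real \<Rightarrow> real) \<Rightarrow> real \<Rightarrow> real \<Rightarrow> (real \<Rightarrow> real \<Rightarrow> 'v::euclidean_space tensor) set" where
  "rough_paths \<omega> p T = {X.
     (\<forall>s t w. (s, t) \<notin> simplex2 T \<or> w \<notin> words_upto (level p) \<longrightarrow> X s t w = 0) \<and>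
     (\<forall>w\<in>words_upto (level p). continuous_on (simplex2 T) (\<lambda>(s, t). X s t w)) \<and>
     (\<forall>(s, t)\<in>simplex2 T. X s t [] = 1) \<and>
     (\<forall>n\<in>{1..level p}. \<exists>C. \<forall>(s, t)\<in>simplex2 T. tnorm n (X s t) \<le> C * \<omega> s t powr (real n / p)) \<and>
     (\<forall>s u t. 0 \<le> s \<and> s \<le> u \<and> u \<le> t \<and> t \<le> T \<longrightarrow>
        (\<forall>w\<in>words_upto (level p). X s t w = tmult (X s u) (X u t) w)) \<and>
     (\<forall>(s, t)\<in>simplex2 T. \<forall>m n. m + n \<le> level p \<longrightarrow>
        (\<forall>v\<in>words m. \<forall>w\<in>words n. X s t v * X s t w = Delta_sh m n (X s t) [v, w]))}"

definition trace_path ::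
    "'v::euclidean_space \<Rightarrow> (real \<Rightarrow> real \<Rightarrow> 'v tensor) \<Rightarrow> real \<Rightarrow> 'v" where
  "trace_path x0 X t = x0 + (\<Sum>b\<in>Basis. X 0 t [b] *\<^sub>R b)"

definition map_rough ::
    "('v::euclidean_space \<Rightarrow> 'w::euclidean_space) \<Rightarrow>
     (real \<Rightarrow> real \<Rightarrow> 'v tensor) \<Rightarrow> real \<Rightarrow> real \<Rightarrow> 'w tensor" where
  "map_rough L X = (\<lambda>s t. tensor_map L (X s t))"


section \<open>Controlled paths and their lifts\<close>

text \<open>The component \<open>H\<^bsub>n;t\<^esub>\<close> of a controlled path is the restriction of \<open>H t\<close> to words of length
  \<open>n\<close>; only words of length at most \<open>level p - 1\<close> are relevant.\<close>

definition controlled_paths ::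
    "(real \<Rightarrow> real \<Rightarrow> real) \<Rightarrow> real \<Rightarrow> real \<Rightarrow> (real \<Rightarrow> real \<Rightarrow> 'v::euclidean_space tensor) \<Rightarrow>
     (real \<Rightarrow> 'v list \<Rightarrow> 'u::euclidean_space) set" where
  "controlled_paths \<omega> p T X = {H.
     (\<forall>w\<in>words_upto (level p - 1). (\<lambda>t. H t w) \<in> Cp_paths \<omega> p T) \<and>
     (\<forall>n. n + 2 \<le> level p \<longrightarrow> (\<forall>a\<in>homogeneous n.
        approx \<omega> p T (level p - n)
          (\<lambda>s t. pairing n (H t) a)
          (\<lambda>s t. \<Sum>k\<le>level p - 1 - n. pairing (n + k) (H s) (tmult (tcomp k (X s t)) a))))}"

definition is_lift ::
    "(real \<Rightarrow> real \<Rightarrow> real) \<Rightarrow> real \<Rightarrow> real \<Rightarrow> (real \<Rightarrow> real \<Rightarrow> 'v::euclidean_space tensor) \<Rightarrow>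
     (real \<Rightarrow> 'v list \<Rightarrow> 'u::euclidean_space) \<Rightarrow> (real \<Rightarrow> real \<Rightarrow> 'u tensor) \<Rightarrow> bool" where
  "is_lift \<omega> p T X H Z \<longleftrightarrow>
     H \<in> controlled_paths \<omega> p T X \<and>
     Z \<in> rough_paths \<omega> p T \<and>
     (\<forall>t\<in>{0..T}. trace_path (H 0 []) Z t = H t []) \<and>
     (\<forall>m. 2 \<le> m \<and> m \<le> level p \<longrightarrow> (\<forall>u\<in>words m.
        approx \<omega> p T (level p + 1)
          (\<lambda>s t. Z s t u)
          (\<lambda>s t. \<Sum>ns\<in>degree_lists m (level p). box_pairing ns (H s) (Delta_osh ns (X s t)) u)))"

definition lift ::
    "(real \<Rightarrow> real \<Rightarrow> real) \<Rightarrow> real \<Rightarrow> real \<Rightarrow> (real \<Rightarrow> real \<Rightarrow> 'v::euclidean_space tensor) \<Rightarrow>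
     (real \<Rightarrow> 'v list \<Rightarrow> 'u::euclidean_space) \<Rightarrow> (real \<Rightarrow> real \<Rightarrow> 'u tensor)" where
  "lift \<omega> p T X H = (THE Z. is_lift \<omega> p T X H Z)"


section \<open>Smooth functions and pushforwards\<close>

primrec Ck :: "nat \<Rightarrow> ('v::euclidean_space \<Rightarrow> 'e::real_normed_vector) \<Rightarrow> bool" where
  "Ck 0 f \<longleftrightarrow> continuous_on UNIV f"
| "Ck (Suc k) f \<longleftrightarrow>
     (\<forall>x. f differentiable (at x)) \<and> (\<forall>v. Ck k (\<lambda>x. frechet_derivative f (at x) v))"

definition smooth :: "('v::euclidean_space \<Rightarrow> 'e::real_normed_vector) \<Rightarrow> bool" where
  "smooth f \<longleftrightarrow> (\<forall>k. Ck k f)"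

text \<open>\<open>iter_deriv [v\<^sub>1, \<dots>, v\<^sub>n] f x\<close> is \<open>D\<^sup>nf(x)\<close> evaluated at \<open>v\<^sub>1 \<otimes> \<dots> \<otimes> v\<^sub>n\<close>.\<close>

primrec iter_deriv ::
    "'v::euclidean_space list \<Rightarrow> ('v \<Rightarrow> 'e::real_normed_vector) \<Rightarrow> 'v \<Rightarrow> 'e" where
  "iter_deriv [] f = f"
| "iter_deriv (v # vs) f = (\<lambda>x. frechet_derivative (iter_deriv vs f) (at x) v)"

text \<open>A rough path does not determine the initial value \<open>x0\<close> of its trace, on which the pushforward
  depends.\<close>

definition pushforward ::
    "(real \<Rightarrow> real \<Rightarrow> real) \<Rightarrow> real \<Rightarrow> real \<Rightarrow> ('v::euclidean_space \<Rightarrow> 'u::euclidean_space) \<Rightarrow>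
     'v \<Rightarrow> (real \<Rightarrow> real \<Rightarrow> 'v tensor) \<Rightarrow> (real \<Rightarrow> real \<Rightarrow> 'u tensor)" where
  "pushforward \<omega> p T f x0 X = lift \<omega> p T X (\<lambda>t w. iter_deriv w f (trace_path x0 X t))"


section \<open>Rough differential equations\<close>

abbreviation Dblinfun ::
    "('w::euclidean_space \<Rightarrow> 'u::real_normed_vector) \<Rightarrow> 'w \<Rightarrow> 'w \<Rightarrow>\<^sub>L 'u" where
  "Dblinfun g y \<equiv> Blinfun (frechet_derivative g (at y))"

text \<open>\<open>vf_iter F [v\<^sub>1, \<dots>, v\<^sub>n] h y\<close> is \<open>F\<^sup>nh(y)\<close> evaluated at \<open>v\<^sub>1 \<otimes> \<dots> \<otimes> v\<^sub>n\<close>, the first slot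
  belonging to the outermost derivative.\<close>

primrec vf_iter ::
    "('w::euclidean_space \<Rightarrow> 'v::euclidean_space \<Rightarrow>\<^sub>L 'w) \<Rightarrow> 'v list \<Rightarrow>
     ('w \<Rightarrow> 'e::real_normed_vector) \<Rightarrow> 'w \<Rightarrow> 'e" where
  "vf_iter F [] h = h"
| "vf_iter F (v # vs) h = (\<lambda>y. frechet_derivative (vf_iter F vs h) (at y) (blinfun_apply (F y) v))"

definition rde_solution ::
    "(real \<Rightarrow> real \<Rightarrow> real) \<Rightarrow> real \<Rightarrow> real \<Rightarrow> (real \<Rightarrow> real \<Rightarrow> 'v::euclidean_space tensor) \<Rightarrow>
     ('w::euclidean_space \<Rightarrow> 'v \<Rightarrow>\<^sub>L 'w) \<Rightarrow> 'w \<Rightarrow> (real \<Rightarrow> 'w) \<Rightarrow> bool" where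
  "rde_solution \<omega> p T X F y0 Y \<longleftrightarrow>
     continuous_on {0..T} Y \<and> Y 0 = y0 \<and>
     (\<forall>h::'w \<Rightarrow> real. smooth h \<longrightarrow>
        approx \<omega> p T (level p + 1)
          (\<lambda>s t. h (Y t) - h (Y s))
          (\<lambda>s t. \<Sum>n=1..level p. pairing n (\<lambda>w. vf_iter F w h (Y s)) (X s t)))"

definition rough_solution ::
    "(real \<Rightarrow> real \<Rightarrow> real) \<Rightarrow> real \<Rightarrow> real \<Rightarrow> (real \<Rightarrow> real \<Rightarrow> 'v::euclidean_space tensor) \<Rightarrow>
     ('w::euclidean_space \<Rightarrow> 'v \<Rightarrow>\<^sub>L 'w) \<Rightarrow> 'w \<Rightarrow> (real \<Rightarrow> real \<Rightarrow> 'w tensor) \<Rightarrow> bool" where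
  "rough_solution \<omega> p T X F y0 RY \<longleftrightarrow>
     (\<exists>Y. rde_solution \<omega> p T X F y0 Y \<and>
          RY = lift \<omega> p T X (\<lambda>t w. vf_iter F w (\<lambda>y. y) (Y t)))"

definition jointly_solve ::
    "(real \<Rightarrow> real \<Rightarrow> real) \<Rightarrow> real \<Rightarrow> real \<Rightarrow> (real \<Rightarrow> real \<Rightarrow> 'v::euclidean_space tensor) \<Rightarrow>
     ('w::euclidean_space \<times> 'u::euclidean_space \<Rightarrow> 'v \<Rightarrow>\<^sub>L ('w \<times> 'u)) \<Rightarrow> 'w \<times> 'u \<Rightarrow>
     (real \<Rightarrow> real \<Rightarrow> 'w tensor) \<Rightarrow> (real \<Rightarrow> real \<Rightarrow> 'u tensor) \<Rightarrow> bool" where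
  "jointly_solve \<omega> p T X G q0 RY RZ \<longleftrightarrow>
     (\<exists>RQ. rough_solution \<omega> p T X G q0 RQ \<and> map_rough fst RQ = RY \<and> map_rough snd RQ = RZ)"

definition joint_coefficient ::
    "('w::euclidean_space \<Rightarrow> 'v::euclidean_space \<Rightarrow>\<^sub>L 'w) \<Rightarrow> ('w \<Rightarrow> 'u::euclidean_space) \<Rightarrow>
     'w \<times> 'u \<Rightarrow> 'v \<Rightarrow>\<^sub>L ('w \<times> 'u)" where
  "joint_coefficient F g = (\<lambda>(y, z).
     Blinfun (\<lambda>v. (blinfun_apply (F y) v, blinfun_apply (Dblinfun g y o\<^sub>L F y) v)))"

definition transported_coefficient ::
    "('w::euclidean_space \<Rightarrow> 'v::euclidean_space \<Rightarrow>\<^sub>L 'w) \<Rightarrow> ('w \<Rightarrow> 'u::euclidean_space) \<Rightarrow>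
     'u \<Rightarrow> 'v \<Rightarrow>\<^sub>L 'u" where
  "transported_coefficient F g = (\<lambda>z. Dblinfun g (inv g z) o\<^sub>L F (inv g z))"

end

theory Submission
  imports Defs
begin

text \<open>
  Both claims reduce to one fact about lifts.  For a solution \<open>Y\<close> of \<open>dY = F(Y) dX\<close> and a smooth \<open>f\<close>, the
  lift of \<open>(F^n f(Y))\<close> is characterised by
  \<open>Z s t u \<approx> \<Sum>v. X s t v * c v u (Y s)\<close>, where the coefficients \<open>c\<close> (\<open>lift_coeff\<close>) satisfy a
  first-letter recursion which is Leibniz' rule for the vector fields \<open>F\<close> extended to the tensor algebra.
  The recursion makes the right-hand side multiplicative and a shuffle character up to \<open>O(\<omega>^((\<lfloor>p\<rfloor>+1)/p))\<close>, so
  that the lift exists by sewing and is unique.  The same recursion gives the chain rule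
  \<open>\<Sum>w. c(F, id) v w * c(\<partial>, g) w u = c(F, g) v u\<close>; hence \<open>g\<^sub>*\<close> of the lift of \<open>Y\<close> is the lift over \<open>X\<close> of
  \<open>(F^n g(Y))\<close>.  If \<open>\<gamma>\<close> intertwines \<open>F\<close> and \<open>G\<close> then \<open>G^n h \<circ> \<gamma> = F^n (h \<circ> \<gamma>)\<close>, and this is used
  for \<open>\<gamma> = (id, g)\<close> and for \<open>\<gamma> = g\<close>.
\<close>

section \<open>Sewing along a control\<close>

text \<open>\<open>lift\<close> is a definite description, so every identity between lifts needs
  existence and uniqueness of the lift concerned. Both are proved for the family
  \<open>F^n f(Y)\<close> of a smooth \<open>f\<close> along a solution \<open>Y\<close>. This
  family is large enough because iterated derivatives are derivatives along the constant field
  \<open>identity_field\<close>, and the trace of the lift of \<open>Y\<close> solves the equation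
  with that field driven by the lift itself; hence a pushforward is a lift of the same kind, only
  over another driver. All comparisons are made modulo \<open>\<omega> powr ((N + 1) / p)\<close>,
  whose exponent exceeds 1. At this order an additive function of two times vanishes and an almost
  additive one can be corrected to an additive one, so that approximate Chen and shuffle relations
  become exact, degree by degree from the lowest. The obstacle is that the ordered shuffles in the
  definition of the lift are awkward to multiply or to split. Reading them by the first position,
  which either heads an existing block or opens a new first block, replaces them by a differential
  recursion.\<close>

locale control_on =
  fixes T :: real and \<omega> :: "real \<Rightarrow> real \<Rightarrow> real"
  assumes T_pos: "T > 0" and control: "control T \<omega>"
begin

lemma control_nonneg: "0 \<le> s \<Longrightarrow> s \<le> t \<Longrightarrow> t \<le> T \<Longrightarrow> 0 \<le> \<omega> s t"
  using control unfolding control_def simplex2_def by auto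

lemma control_diag: "0 \<le> t \<Longrightarrow> t \<le> T \<Longrightarrow> \<omega> t t = 0"
  using control unfolding control_def by auto

lemma control_superadditive:
  "0 \<le> s \<Longrightarrow> s \<le> u \<Longrightarrow> u \<le> t \<Longrightarrow> t \<le> T \<Longrightarrow> \<omega> s u + \<omega> u t \<le> \<omega> s t"
  using control unfolding control_def by blast

lemma control_mono:
  assumes "0 \<le> s" "s \<le> s'" "s' \<le> t'" "t' \<le> t" "t \<le> T"
  shows "\<omega> s' t' \<le> \<omega> s t"
  using control_superadditive[of s s' t] control_superadditive[of s' t' t]
    control_nonneg[of s s'] control_nonneg[of t' t] assms by linarith

text \<open>Superadditivity, summed over a partition by induction on its last interval. The order of
  the end points is carried along because the induction step applies superadditivity at
  \<open>x 0\<close>, \<open>x n\<close>, \<open>x (Suc n)\<close>.\<close>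

lemma control_sum_le:
  assumes "\<And>i. i < n \<Longrightarrow> x i \<le> x (Suc i)" and "0 \<le> x 0" "x n \<le> T"
  shows "(\<Sum>i<n. \<omega> (x i) (x (Suc i))) \<le> \<omega> (x 0) (x n) \<and> x 0 \<le> x n"
  using assms
proof (induction n)
  case 0
  then show ?case using control_diag[of "x 0"] by simp
next
  case (Suc n)
  have le: "x n \<le> x (Suc n)" using Suc.prems(1) by blast
  have "(\<Sum>i<n. \<omega> (x i) (x (Suc i))) \<le> \<omega> (x 0) (x n) \<and> x 0 \<le> x n"
    using Suc le by force
  then show ?case
    using control_superadditive[of "x 0" "x n" "x (Suc n)"] le Suc.prems by force
qed

text \<open>Split off one full power: each summand is at most
  \<open>\<eta> powr (\<theta> - 1)\<close> times \<open>\<omega>\<close> of its interval, and the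
  first powers add up by superadditivity. The gain is a factor that vanishes with the size of the
  intervals.\<close>

lemma control_sum_powr_le:
  assumes "\<And>i. i < n \<Longrightarrow> x i \<le> x (Suc i)" and "0 \<le> x 0" "x n \<le> T"
    and small: "\<And>i. i < n \<Longrightarrow> \<omega> (x i) (x (Suc i)) \<le> \<eta>" and "\<theta> > 1" "\<eta> \<ge> 0"
    and range: "\<And>i. i < n \<Longrightarrow> 0 \<le> x i \<and> x (Suc i) \<le> T"
  shows "(\<Sum>i<n. \<omega> (x i) (x (Suc i)) powr \<theta>) \<le> \<eta> powr (\<theta> - 1) * \<omega> (x 0) (x n)"
proof -
  have "\<omega> (x i) (x (Suc i)) powr \<theta> \<le> \<eta> powr (\<theta> - 1) * \<omega> (x i) (x (Suc i))" if "i < n" for i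
  proof -
    have nn: "0 \<le> \<omega> (x i) (x (Suc i))"
      using that range assms(1) by (intro control_nonneg) auto
    have "\<omega> (x i) (x (Suc i)) powr \<theta>
        = \<omega> (x i) (x (Suc i)) powr (\<theta> - 1) * \<omega> (x i) (x (Suc i)) powr 1"
      by (subst powr_add[symmetric]) simp
    also have "\<dots> \<le> \<eta> powr (\<theta> - 1) * \<omega> (x i) (x (Suc i))"
      using nn small[OF that] \<open>\<theta> > 1\<close> by (auto intro!: mult_mono powr_mono2)
    finally show ?thesis .
  qed
  then have "(\<Sum>i<n. \<omega> (x i) (x (Suc i)) powr \<theta>)
      \<le> \<eta> powr (\<theta> - 1) * (\<Sum>i<n. \<omega> (x i) (x (Suc i)))"
    unfolding sum_distrib_left by (intro sum_mono) auto
  also have "\<dots> \<le> \<eta> powr (\<theta> - 1) * \<omega> (x 0) (x n)"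
    using control_sum_le[OF assms(1-3)] by (intro mult_left_mono) auto
  finally show ?thesis .
qed

lemma simplex2_compact: "compact (simplex2 T)"
proof -
  have "simplex2 T = ({0..T} \<times> {0..T}) \<inter> {x. fst x \<le> snd x}"
    unfolding simplex2_def by auto
  moreover have "closed {x :: real \<times> real. fst x \<le> snd x}"
    by (intro closed_Collect_le continuous_intros)
  ultimately show ?thesis
    by (auto intro!: compact_Int_closed compact_Times)
qed

text \<open>Uniform continuity of \<open>\<omega>\<close> on the compact simplex, applied to
  \<open>(s, t)\<close> and the diagonal point \<open>(s, s)\<close>, where \<open>\<omega>\<close>
  vanishes.\<close>

lemma control_mesh:
  assumes "\<epsilon> > 0"
  shows "\<exists>\<delta>>0. \<forall>s t. 0 \<le> s \<longrightarrow> s \<le> t \<longrightarrow> t \<le> T \<longrightarrow> t - s < \<delta> \<longrightarrow> \<omega> s t < \<epsilon>"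
proof -
  have "uniformly_continuous_on (simplex2 T) (\<lambda>(s, t). \<omega> s t)"
    using control simplex2_compact unfolding control_def
    by (intro compact_uniformly_continuous) auto
  then obtain \<delta> where "\<delta> > 0" and \<delta>: "\<And>x y. x \<in> simplex2 T \<Longrightarrow> y \<in> simplex2 T \<Longrightarrow> dist y x < \<delta>
      \<Longrightarrow> dist (case y of (s, t) \<Rightarrow> \<omega> s t) (case x of (s, t) \<Rightarrow> \<omega> s t) < \<epsilon>"
    unfolding uniformly_continuous_on_def using assms by metis
  have "\<omega> s t < \<epsilon>" if "0 \<le> s" "s \<le> t" "t \<le> T" "t - s < \<delta>" for s t
    using \<delta>[of "(s, s)" "(s, t)"] that control_diag[of s]
    by (auto simp: simplex2_def dist_prod_def dist_real_def abs_if split: if_splits)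
  then show ?thesis using \<open>\<delta> > 0\<close> by blast
qed

text \<open>The number of pieces \<open>q n\<close> is left open because the uniqueness argument
  takes \<open>Suc\<close> and the sewing construction \<open>2 ^ n\<close>.\<close>

lemma grid_sum_tendsto_0:
  assumes "\<theta> > 1" and st: "0 \<le> s" "s \<le> t" "t \<le> T" and "filterlim q at_top sequentially"
  shows "(\<lambda>n. \<Sum>i<q n. \<omega> (s + real i * (t - s) / real (q n)) (s + real (Suc i) * (t - s) / real (q n)) powr \<theta>)
    \<longlonglongrightarrow> 0"
proof (rule LIMSEQ_I)
  fix r :: real assume "r > 0"
  \<comment> \<open>Chosen so that \<open>\<eta> powr (\<theta> - 1) * \<omega> s t < r\<close>: the
    \<open>+ 1\<close> covers a vanishing control, the division by 2 makes the inequality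
    strict.\<close>
  define \<eta> where "\<eta> = (r / (\<omega> s t + 1)) powr (1 / (\<theta> - 1)) / 2"
  have w: "\<omega> s t \<ge> 0" using st control_nonneg by blast
  have \<eta>: "\<eta> > 0" unfolding \<eta>_def using \<open>r > 0\<close> w by simp
  have "\<eta> powr (\<theta> - 1) < ((r / (\<omega> s t + 1)) powr (1 / (\<theta> - 1))) powr (\<theta> - 1)"
    using \<open>r > 0\<close> w \<open>\<theta> > 1\<close> unfolding \<eta>_def by (intro powr_less_mono2) auto
  also have "\<dots> = r / (\<omega> s t + 1)" using \<open>\<theta> > 1\<close> \<open>r > 0\<close> w by (simp add: powr_powr)
  finally have "\<eta> powr (\<theta> - 1) * (\<omega> s t + 1) < r" using w by (simp add: field_simps)
  moreover have "\<eta> powr (\<theta> - 1) * \<omega> s t \<le> \<eta> powr (\<theta> - 1) * (\<omega> s t + 1)"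
    by (intro mult_left_mono) auto
  ultimately have bound: "\<eta> powr (\<theta> - 1) * \<omega> s t < r" by linarith
  obtain \<delta> where "\<delta> > 0" and \<delta>: "\<And>s t. 0 \<le> s \<Longrightarrow> s \<le> t \<Longrightarrow> t \<le> T \<Longrightarrow> t - s < \<delta> \<Longrightarrow> \<omega> s t < \<eta>"
    using control_mesh[OF \<eta>] by blast
  obtain n0 where n0: "\<And>n. n \<ge> n0 \<Longrightarrow> q n \<ge> Suc (nat \<lceil>(t - s) / \<delta>\<rceil>)"
    using assms(5) unfolding filterlim_at_top eventually_sequentially by meson
  have "norm ((\<Sum>i<q n. \<omega> (s + real i * (t - s) / real (q n)) (s + real (Suc i) * (t - s) / real (q n)) powr \<theta>) - 0) < r"
    if "n \<ge> n0" for n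
  proof -
    define x where "x i = s + real i * (t - s) / real (q n)" for i
    have q: "q n > 0" using n0[OF that] by simp
    have mono: "x i \<le> x (Suc i)" for i
      unfolding x_def using st q by (simp add: divide_right_mono mult_right_mono)
    have diff: "x (Suc i) - x i < \<delta>" for i
    proof -
      have "(t - s) / \<delta> \<le> real (nat \<lceil>(t - s) / \<delta>\<rceil>)" by linarith
      also have "\<dots> < real (q n)" using n0[OF that] by linarith
      finally have "(t - s) / real (q n) < \<delta>" using q \<open>\<delta> > 0\<close> by (simp add: field_simps)
      moreover have "x (Suc i) - x i = (t - s) / real (q n)"
        unfolding x_def using q by (simp add: field_simps)
      ultimately show ?thesis by simp
    qed
    have x0: "x 0 = s" and xq: "x (q n) = t" unfolding x_def using q by auto
    have range: "0 \<le> x i \<and> x (Suc i) \<le> T" if "i < q n" for i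
    proof -
      have "real (Suc i) * (t - s) \<le> real (q n) * (t - s)"
        using that st by (intro mult_right_mono) auto
      then have "real (Suc i) * (t - s) / real (q n) \<le> t - s"
        using q by (simp add: field_simps)
      then show ?thesis unfolding x_def using st by auto
    qed
    have "(\<Sum>i<q n. \<omega> (x i) (x (Suc i)) powr \<theta>) \<le> \<eta> powr (\<theta> - 1) * \<omega> (x 0) (x (q n))"
      using mono range diff \<delta> \<eta> x0 xq st \<open>\<theta> > 1\<close>
      by (intro control_sum_powr_le) (auto intro: less_imp_le)
    then have "(\<Sum>i<q n. \<omega> (x i) (x (Suc i)) powr \<theta>) < r" using bound x0 xq by simp
    moreover have "(\<Sum>i<q n. \<omega> (x i) (x (Suc i)) powr \<theta>) \<ge> 0" by (intro sum_nonneg) auto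
    ultimately show ?thesis unfolding x_def by simp
  qed
  then show "\<exists>n0. \<forall>n\<ge>n0. norm ((\<Sum>i<q n. \<omega> (s + real i * (t - s) / real (q n)) (s + real (Suc i) * (t - s) / real (q n)) powr \<theta>) - 0) < r"
    by blast
qed

text \<open>Additivity telescopes \<open>\<psi> s t\<close> over every grid, so it is bounded by
  multiples of the sums in \<open>grid_sum_tendsto_0\<close>. This is the uniqueness half of
  sewing.\<close>

lemma additive_small_eq_0:
  fixes \<psi> :: "real \<Rightarrow> real \<Rightarrow> real"
  assumes "\<theta> > 1"
    and add: "\<And>s u t. 0 \<le> s \<Longrightarrow> s \<le> u \<Longrightarrow> u \<le> t \<Longrightarrow> t \<le> T \<Longrightarrow> \<psi> s t = \<psi> s u + \<psi> u t"
    and bound: "\<And>s t. 0 \<le> s \<Longrightarrow> s \<le> t \<Longrightarrow> t \<le> T \<Longrightarrow> \<bar>\<psi> s t\<bar> \<le> C * \<omega> s t powr \<theta>"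
    and st: "0 \<le> s" "s \<le> t" "t \<le> T"
  shows "\<psi> s t = 0"
proof -
  define x where "x n i = s + real i * (t - s) / real (Suc n)" for n i
  have mono: "x n i \<le> x n j" if "i \<le> j" for n i j
    unfolding x_def using st that by (auto intro!: divide_right_mono mult_right_mono)
  have x0: "x n 0 = s" and xn: "x n (Suc n) = t" for n unfolding x_def by auto
  have range: "0 \<le> x n i" "i \<le> Suc n \<Longrightarrow> x n i \<le> T" for n i
    using mono[of 0 i n] mono[of i "Suc n" n] x0[of n] xn[of n] st by auto
  have tel: "k \<le> Suc n \<Longrightarrow> (\<Sum>i<k. \<psi> (x n i) (x n (Suc i))) = \<psi> s (x n k)" for k n
  proof (induction k)
    case 0 then show ?case using add[of s s s] st x0 by simp
  next
    case (Suc k)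
    then show ?case
      using add[of s "x n k" "x n (Suc k)"] mono[of 0 k n] mono[of k "Suc k" n] range(2)[of "Suc k" n]
        st x0[of n] by simp
  qed
  have le: "\<bar>\<psi> s t\<bar> \<le> C * (\<Sum>i<Suc n. \<omega> (x n i) (x n (Suc i)) powr \<theta>)" for n
  proof -
    have "\<bar>\<psi> s t\<bar> \<le> (\<Sum>i<Suc n. \<bar>\<psi> (x n i) (x n (Suc i))\<bar>)"
      using tel[of "Suc n" n] xn by (metis sum_abs order_refl)
    also have "\<dots> \<le> (\<Sum>i<Suc n. C * \<omega> (x n i) (x n (Suc i)) powr \<theta>)"
      using mono range by (intro sum_mono bound) auto
    finally show ?thesis by (simp only: sum_distrib_left)
  qed
  have "(\<lambda>n. C * (\<Sum>i<Suc n. \<omega> (x n i) (x n (Suc i)) powr \<theta>)) \<longlonglongrightarrow> C * 0"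
    unfolding x_def by (intro tendsto_mult_left grid_sum_tendsto_0[where q = Suc])
      (use \<open>\<theta> > 1\<close> st filterlim_Suc in auto)
  then have "\<bar>\<psi> s t\<bar> \<le> C * 0"
    by (rule tendsto_lowerbound) (use le in auto)
  then show ?thesis by simp
qed

text \<open>The partition is split where the control from the left reaches half of its total
  \<open>w\<close>. Each side then carries at most \<open>w / 2\<close> and is handled by induction;
  inserting the two points next to the split costs two defects. \<open>K\<close> is the fixed point
  of the resulting recursion, \<open>K = K * 2 powr (1 - \<theta>) + 2 * C\<close>.\<close>

lemma sewing_max_inequality:
  fixes a :: "real \<Rightarrow> real \<Rightarrow> real"
  assumes "\<theta> > 1" "C \<ge> 0"
    and delta: "\<And>s u t. 0 \<le> s \<Longrightarrow> s \<le> u \<Longrightarrow> u \<le> t \<Longrightarrow> t \<le> T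
      \<Longrightarrow> \<bar>a s t - a s u - a u t\<bar> \<le> C * \<omega> s t powr \<theta>"
    and K: "K = 2 * C / (1 - 2 powr (1 - \<theta>))"
  shows "(\<And>i j. i \<le> j \<Longrightarrow> j \<le> r \<Longrightarrow> x i \<le> x j) \<Longrightarrow> 0 \<le> x 0 \<Longrightarrow> x r \<le> T
    \<Longrightarrow> \<bar>(\<Sum>i<r. a (x i) (x (Suc i))) - a (x 0) (x r)\<bar> \<le> K * \<omega> (x 0) (x r) powr \<theta>"
proof (induction r arbitrary: x rule: less_induct)
  case (less r)
  have "2 powr (1 - \<theta>) < 2 powr (0 :: real)" using \<open>\<theta> > 1\<close> by (intro powr_less_mono) auto
  then have den: "1 - 2 powr (1 - \<theta>) > 0" by simp
  then have "K \<ge> 0" using K \<open>C \<ge> 0\<close> by simp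
  have "K * (1 - 2 powr (1 - \<theta>)) = 2 * C"
    unfolding K by (rule nonzero_eq_divide_eq[THEN iffD1]) (use den in auto)
  then have K_eq: "K * 2 powr (1 - \<theta>) + 2 * C = K" by (simp add: algebra_simps)
  have range: "0 \<le> x i" "x i \<le> T" if "i \<le> r" for i
    using less.prems(1)[of 0 i] less.prems(1)[of i r] less.prems(2,3) that by auto
  have diag: "a s s = 0" if "0 \<le> s" "s \<le> T" for s
    using delta[of s s s] control_diag[of s] that by simp
  show ?case
  proof (cases "r = 0")
    case True
    then show ?thesis using diag[of "x 0"] less.prems \<open>K \<ge> 0\<close> by auto
  next
    case False
    define w where "w = \<omega> (x 0) (x r)"
    \<comment> \<open>The maximum \<open>j\<close> of this set is the left split point. Since the
      next point is already beyond \<open>w / 2\<close>, superadditivity leaves at most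
      \<open>w / 2\<close> to the right of it.\<close>
    define J where "J = {j. j < r \<and> \<omega> (x 0) (x j) \<le> w / 2}"
    have "w \<ge> 0" unfolding w_def using less.prems(1)[of 0 r] less.prems by (intro control_nonneg) auto
    have "0 \<in> J" unfolding J_def using False control_diag[of "x 0"] range[of 0] \<open>w \<ge> 0\<close> by auto
    have "finite J" unfolding J_def by simp
    define j where "j = Max J"
    have "j \<in> J" unfolding j_def using \<open>0 \<in> J\<close> \<open>finite J\<close> by (intro Max_in) auto
    then have "j < r" and left: "\<omega> (x 0) (x j) \<le> w / 2" unfolding J_def by auto
    have right: "\<omega> (x (Suc j)) (x r) \<le> w / 2"
    proof (cases "Suc j = r")
      case True
      then show ?thesis using control_diag[of "x r"] range[of r] \<open>w \<ge> 0\<close> by simp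
    next
      case False
      have "Suc j \<notin> J" unfolding j_def using \<open>finite J\<close> by (metis Max_ge Suc_n_not_le_n)
      then have "\<omega> (x 0) (x (Suc j)) > w / 2" using False \<open>j < r\<close> unfolding J_def by auto
      then show ?thesis
        using control_superadditive[of "x 0" "x (Suc j)" "x r"] range[of 0] range[of r]
          less.prems(1)[of 0 "Suc j"] less.prems(1)[of "Suc j" r] \<open>j < r\<close> unfolding w_def by auto
    qed
    have half: "K * v powr \<theta> \<le> K * (w / 2) powr \<theta>" if "0 \<le> v" "v \<le> w / 2" for v
      using that \<open>\<theta> > 1\<close> \<open>K \<ge> 0\<close> by (intro mult_left_mono powr_mono2) auto
    have 1: "\<bar>(\<Sum>i<j. a (x i) (x (Suc i))) - a (x 0) (x j)\<bar> \<le> K * (w / 2) powr \<theta>"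
    proof -
      have "\<bar>(\<Sum>i<j. a (x i) (x (Suc i))) - a (x 0) (x j)\<bar> \<le> K * \<omega> (x 0) (x j) powr \<theta>"
        using \<open>j < r\<close> less.prems range by (intro less.IH) auto
      also have "\<dots> \<le> K * (w / 2) powr \<theta>"
        using left \<open>j < r\<close> range less.prems(1)[of 0 j] by (intro half control_nonneg) auto
      finally show ?thesis .
    qed
    have 2: "\<bar>(\<Sum>i<r - Suc j. a (x (i + Suc j)) (x (Suc i + Suc j))) - a (x (Suc j)) (x r)\<bar>
        \<le> K * (w / 2) powr \<theta>"
    proof -
      have "\<bar>(\<Sum>i<r - Suc j. a (x (i + Suc j)) (x (Suc i + Suc j))) - a (x (0 + Suc j)) (x (r - Suc j + Suc j))\<bar>
          \<le> K * \<omega> (x (0 + Suc j)) (x (r - Suc j + Suc j)) powr \<theta>"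
        using \<open>j < r\<close> less.prems range by (intro less.IH[of _ "\<lambda>i. x (i + Suc j)"]) auto
      also have "\<dots> \<le> K * (w / 2) powr \<theta>"
        using right \<open>j < r\<close> range less.prems(1)[of "Suc j" r] by (intro half control_nonneg) auto
      finally show ?thesis using \<open>j < r\<close> by simp
    qed
    have "(\<Sum>i<r. a (x i) (x (Suc i))) = (\<Sum>i<j. a (x i) (x (Suc i))) + a (x j) (x (Suc j))
        + (\<Sum>i=Suc j..<r. a (x i) (x (Suc i)))"
      using sum.atLeastLessThan_concat[of 0 "Suc j" r "\<lambda>i. a (x i) (x (Suc i))"] \<open>j < r\<close>
      by (simp add: lessThan_atLeast0)
    moreover have "(\<Sum>i=Suc j..<r. a (x i) (x (Suc i)))
        = (\<Sum>i<r - Suc j. a (x (i + Suc j)) (x (Suc i + Suc j)))"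
      using sum.shift_bounds_nat_ivl[of "\<lambda>i. a (x i) (x (Suc i))" 0 "Suc j" "r - Suc j"] \<open>j < r\<close>
      by (simp add: lessThan_atLeast0)
    moreover have 3: "\<bar>a (x 0) (x r) - a (x 0) (x j) - a (x j) (x r)\<bar> \<le> C * w powr \<theta>"
      unfolding w_def using less.prems \<open>j < r\<close> by (intro delta) auto
    moreover have 4: "\<bar>a (x j) (x r) - a (x j) (x (Suc j)) - a (x (Suc j)) (x r)\<bar> \<le> C * w powr \<theta>"
    proof -
      have "\<bar>a (x j) (x r) - a (x j) (x (Suc j)) - a (x (Suc j)) (x r)\<bar> \<le> C * \<omega> (x j) (x r) powr \<theta>"
        using less.prems \<open>j < r\<close> range by (intro delta) auto
      also have "\<dots> \<le> C * w powr \<theta>"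
        unfolding w_def using less.prems \<open>j < r\<close> range \<open>C \<ge> 0\<close> \<open>\<theta> > 1\<close>
        by (intro mult_left_mono powr_mono2 control_mono control_nonneg) auto
      finally show ?thesis .
    qed
    ultimately have "\<bar>(\<Sum>i<r. a (x i) (x (Suc i))) - a (x 0) (x r)\<bar>
        \<le> 2 * (K * (w / 2) powr \<theta>) + 2 * (C * w powr \<theta>)"
      using 1 2 by linarith
    also have "2 * (K * (w / 2) powr \<theta>) = K * 2 powr (1 - \<theta>) * w powr \<theta>"
      using \<open>w \<ge> 0\<close> by (simp add: powr_divide powr_diff)
    also have "K * 2 powr (1 - \<theta>) * w powr \<theta> + 2 * (C * w powr \<theta>) = (K * 2 powr (1 - \<theta>) + 2 * C) * w powr \<theta>"
      by (simp add: algebra_simps)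
    finally show ?thesis unfolding K_eq w_def .
  qed
qed

text \<open>\<open>\<phi> t\<close> is the limit of the sums of \<open>a\<close> along dyadic grids
  stopped at \<open>t\<close>. The grids are those of \<open>[0, T]\<close> for every
  \<open>t\<close>, which makes the sums for \<open>s\<close> and \<open>t\<close> comparable cell
  by cell.\<close>

lemma sewing:
  fixes a :: "real \<Rightarrow> real \<Rightarrow> real"
  assumes "\<theta> > 1"
    and delta: "\<And>s u t. 0 \<le> s \<Longrightarrow> s \<le> u \<Longrightarrow> u \<le> t \<Longrightarrow> t \<le> T
      \<Longrightarrow> \<bar>a s t - a s u - a u t\<bar> \<le> C * \<omega> s t powr \<theta>"
  obtains \<phi> K where "\<And>s t. 0 \<le> s \<Longrightarrow> s \<le> t \<Longrightarrow> t \<le> T \<Longrightarrow> \<bar>\<phi> t - \<phi> s - a s t\<bar> \<le> K * \<omega> s t powr \<theta>"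
proof -
  define C' where "C' = max C 0"
  have "C' \<ge> 0" unfolding C'_def by simp
  have delta': "\<bar>a s t - a s u - a u t\<bar> \<le> C' * \<omega> s t powr \<theta>"
    if "0 \<le> s" "s \<le> u" "u \<le> t" "t \<le> T" for s u t
    using delta[OF that] unfolding C'_def by (smt (verit) mult_right_mono powr_ge_zero)
  define K where "K = 2 * C' / (1 - 2 powr (1 - \<theta>))"
  have "2 powr (1 - \<theta>) < 2 powr (0 :: real)" using \<open>\<theta> > 1\<close> by (intro powr_less_mono) auto
  then have "K \<ge> 0" unfolding K_def using \<open>C' \<ge> 0\<close> by simp
  note max = sewing_max_inequality[OF \<open>\<theta> > 1\<close> \<open>C' \<ge> 0\<close> delta' K_def]
  have diag: "a s s = 0" if "0 \<le> s" "s \<le> T" for s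
    using delta[of s s s] control_diag[of s] that by simp
  define G where "G n i = real i * T / 2 ^ n" for n i :: nat
  define \<phi>' where "\<phi>' n t = (\<Sum>i<2 ^ n. a (min t (G n i)) (min t (G n (Suc i))))" for n t
  define e where "e n = (\<Sum>i<2 ^ n. \<omega> (G n i) (G n (Suc i)) powr \<theta>)" for n
  have "filterlim (\<lambda>n. 2 ^ n :: nat) at_top sequentially"
    by (rule filterlim_subseq) (auto intro!: strict_monoI power_strict_increasing)
  from grid_sum_tendsto_0[OF \<open>\<theta> > 1\<close> _ _ _ this, of 0 T]
  have e_lim: "e \<longlonglongrightarrow> 0" unfolding e_def G_def using T_pos by simp
  have G_mono: "G n i \<le> G n j" if "i \<le> j" for n i j
    unfolding G_def using T_pos that by (auto intro!: divide_right_mono mult_right_mono)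
  have G0: "G n 0 = 0" and G1: "G n (2 ^ n) = T" for n unfolding G_def by auto
  have G_range: "0 \<le> G n i" "i \<le> 2 ^ n \<Longrightarrow> G n i \<le> T" for n i
    using G_mono[of 0 i n] G_mono[of i "2 ^ n" n] G0 G1 by auto
  \<comment> \<open>Inside one cell of the coarser grid the finer points form a partition, so the
    maximal inequality bounds the change by the control of the cell. \<open>e n\<close> collects
    these bounds and tends to 0, which makes the sums Cauchy.\<close>
  have refine: "\<bar>\<phi>' m t - \<phi>' n t\<bar> \<le> K * e n" if "n \<le> m" "0 \<le> t" "t \<le> T" for m n t
  proof -
    define q where "q = (2 :: nat) ^ (m - n)"
    have pow: "2 ^ m = (2 :: nat) ^ n * q"
      unfolding q_def using that(1) by (simp flip: power_add)
    have G_m: "G m (i * q) = G n i" for i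
    proof -
      have "(2 :: real) ^ m = 2 ^ n * real q" using pow by (metis of_nat_mult of_nat_numeral of_nat_power)
      then show ?thesis unfolding G_def q_def by simp
    qed
    define y where "y i = (\<lambda>j. min t (G m (i * q + j)))" for i
    have bij: "\<phi>' m t = (\<Sum>i<2 ^ n. \<Sum>j<q. a (y i j) (y i (Suc j)))"
      unfolding \<phi>'_def pow y_def
      using sum.nat_group[of "\<lambda>k. a (min t (G m k)) (min t (G m (Suc k)))" q "2 ^ n"]
      by (simp add: sum.shift_bounds_nat_ivl[of _ 0, simplified, folded lessThan_atLeast0]
          add.commute atLeast0LessThan[symmetric] flip: sum.shift_bounds_nat_ivl)
    have "\<bar>(\<Sum>j<q. a (y i j) (y i (Suc j))) - a (min t (G n i)) (min t (G n (Suc i)))\<bar>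
        \<le> K * \<omega> (G n i) (G n (Suc i)) powr \<theta>" if "i < 2 ^ n" for i
    proof -
      have ends: "y i 0 = min t (G n i)" "y i q = min t (G n (Suc i))"
        unfolding y_def using G_m[of i] G_m[of "Suc i"] by (auto simp: add.commute)
      have y_mono: "y i j \<le> y i j'" if "j \<le> j'" for j j'
        unfolding y_def using that by (intro min.mono order_refl G_mono) simp
      have "0 \<le> y i 0" "y i q \<le> T" unfolding y_def using \<open>0 \<le> t\<close> \<open>t \<le> T\<close> G_range by auto
      then have "\<bar>(\<Sum>j<q. a (y i j) (y i (Suc j))) - a (y i 0) (y i q)\<bar> \<le> K * \<omega> (y i 0) (y i q) powr \<theta>"
        by (intro max y_mono)
      moreover have "\<omega> (y i 0) (y i q) \<le> \<omega> (G n i) (G n (Suc i))"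
      proof (cases "t \<le> G n i")
        case True
        then show ?thesis using ends G_mono[of i "Suc i" n] control_diag[of t] \<open>0 \<le> t\<close> \<open>t \<le> T\<close>
          G_range[where n = n] \<open>i < 2 ^ n\<close>
          by (auto simp: min_def intro!: control_nonneg)
      next
        case False
        then show ?thesis unfolding ends
          using G_mono[of i "Suc i" n] G_range[where n = n] \<open>i < 2 ^ n\<close>
          by (intro control_mono) auto
      qed
      then have "K * \<omega> (y i 0) (y i q) powr \<theta> \<le> K * \<omega> (G n i) (G n (Suc i)) powr \<theta>"
        using \<open>K \<ge> 0\<close> \<open>\<theta> > 1\<close> ends \<open>0 \<le> t\<close> \<open>t \<le> T\<close> G_range[where n = n] G_mono[of i "Suc i" n]
        by (intro mult_left_mono powr_mono2 control_nonneg) auto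
      ultimately show ?thesis unfolding ends by linarith
    qed
    then have "(\<Sum>i<2 ^ n. \<bar>(\<Sum>j<q. a (y i j) (y i (Suc j))) - a (min t (G n i)) (min t (G n (Suc i)))\<bar>)
        \<le> (\<Sum>i<2 ^ n. K * \<omega> (G n i) (G n (Suc i)) powr \<theta>)"
      by (intro sum_mono) auto
    then show ?thesis
      unfolding bij \<phi>'_def[of n] e_def sum_distrib_left sum_subtractf[symmetric]
      by (rule order_trans[OF sum_abs])
  qed
  have "Cauchy (\<lambda>n. \<phi>' n t)" if "0 \<le> t" "t \<le> T" for t
  proof (rule metric_CauchyI)
    fix r :: real assume "r > 0"
    have "(\<lambda>n. K * e n) \<longlonglongrightarrow> K * 0" by (intro tendsto_mult_left e_lim)
    then have "\<forall>\<^sub>F n in sequentially. K * e n < r / 2"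
      by (rule order_tendstoD) (use \<open>r > 0\<close> in auto)
    then obtain n0 where n0: "K * e n0 < r / 2" unfolding eventually_sequentially by blast
    have "dist (\<phi>' m t) (\<phi>' n t) < r" if "m \<ge> n0" "n \<ge> n0" for m n
      using refine[of n0 m t] refine[of n0 n t] that n0 \<open>0 \<le> t\<close> \<open>t \<le> T\<close> unfolding dist_real_def by linarith
    then show "\<exists>M. \<forall>m\<ge>M. \<forall>n\<ge>M. dist (\<phi>' m t) (\<phi>' n t) < r" by blast
  qed
  then have conv: "(\<lambda>n. \<phi>' n t) \<longlonglongrightarrow> lim (\<lambda>n. \<phi>' n t)" if "0 \<le> t" "t \<le> T" for t
    using that by (simp add: Cauchy_convergent_iff convergent_LIMSEQ_iff)
  have "\<bar>lim (\<lambda>n. \<phi>' n t) - lim (\<lambda>n. \<phi>' n s) - a s t\<bar> \<le> K * \<omega> s t powr \<theta>"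
    if st: "0 \<le> s" "s \<le> t" "t \<le> T" for s t
  proof -
    have bound: "\<bar>\<phi>' n t - \<phi>' n s - a s t\<bar> \<le> C' * e n + K * \<omega> s t powr \<theta>" for n
    proof -
      \<comment> \<open>The grid clipped to \<open>[s, t]\<close>. In each cell the difference of
        the increments stopped at \<open>t\<close> and at \<open>s\<close> is the increment along
        \<open>c\<close>, except in the cell with \<open>s\<close> in its interior, where one defect
        appears.\<close>
      define c where "c i = max s (min t (G n i))" for i
      have ends: "c 0 = s" "c (2 ^ n) = t" unfolding c_def G0 G1 using st by auto
      have c_mono: "c i \<le> c j" if "i \<le> j" for i j
        unfolding c_def using that by (intro max.mono min.mono order_refl G_mono)
      have "\<bar>(\<Sum>i<2 ^ n. a (c i) (c (Suc i))) - a (c 0) (c (2 ^ n))\<bar> \<le> K * \<omega> (c 0) (c (2 ^ n)) powr \<theta>"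
        using st ends c_mono by (intro max) auto
      then have 1: "\<bar>(\<Sum>i<2 ^ n. a (c i) (c (Suc i))) - a s t\<bar> \<le> K * \<omega> s t powr \<theta>"
        unfolding ends .
      have "\<bar>a (min t (G n i)) (min t (G n (Suc i))) - a (min s (G n i)) (min s (G n (Suc i)))
          - a (c i) (c (Suc i))\<bar> \<le> C' * \<omega> (G n i) (G n (Suc i)) powr \<theta>" if "i < 2 ^ n" for i
      proof -
        have ord: "0 \<le> G n i" "G n i \<le> G n (Suc i)" "G n (Suc i) \<le> T"
          using that G_range[where n = n] G_mono[of i "Suc i" n] by auto
        have nn: "0 \<le> C' * \<omega> (G n i) (G n (Suc i)) powr \<theta>" using \<open>C' \<ge> 0\<close> by simp
        consider "G n (Suc i) \<le> s" | "s \<le> G n i" | "G n i < s" "s < G n (Suc i)" by linarith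
        then show ?thesis
        proof cases
          case 1
          have "c i = s" "c (Suc i) = s" "min t (G n i) = G n i" "min t (G n (Suc i)) = G n (Suc i)"
            "min s (G n i) = G n i" "min s (G n (Suc i)) = G n (Suc i)"
            unfolding c_def using 1 ord st by auto
          then show ?thesis using nn diag[of s] st by simp
        next
          case 2
          have "c i = min t (G n i)" "c (Suc i) = min t (G n (Suc i))" "min s (G n i) = s" "min s (G n (Suc i)) = s"
            unfolding c_def using 2 ord st by auto
          then show ?thesis using nn diag[of s] st by simp
        next
          case 3
          have eq: "c i = s" "c (Suc i) = min t (G n (Suc i))" "min s (G n i) = G n i"
            "min s (G n (Suc i)) = s" "min t (G n i) = G n i"
            unfolding c_def using 3 ord st by auto
          have "\<bar>a (G n i) (min t (G n (Suc i))) - a (G n i) s - a s (min t (G n (Suc i)))\<bar>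
              \<le> C' * \<omega> (G n i) (min t (G n (Suc i))) powr \<theta>"
            using 3 ord st by (intro delta') auto
          also have "\<dots> \<le> C' * \<omega> (G n i) (G n (Suc i)) powr \<theta>"
            using 3 ord st \<open>C' \<ge> 0\<close> \<open>\<theta> > 1\<close>
            by (intro mult_left_mono powr_mono2 control_mono control_nonneg) auto
          finally show ?thesis unfolding eq .
        qed
      qed
      then have "(\<Sum>i<2 ^ n. \<bar>a (min t (G n i)) (min t (G n (Suc i))) - a (min s (G n i)) (min s (G n (Suc i)))
          - a (c i) (c (Suc i))\<bar>) \<le> C' * e n"
        unfolding e_def sum_distrib_left by (intro sum_mono) auto
      then have "\<bar>\<phi>' n t - \<phi>' n s - (\<Sum>i<2 ^ n. a (c i) (c (Suc i)))\<bar> \<le> C' * e n"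
        unfolding \<phi>'_def sum_subtractf[symmetric] by (rule order_trans[OF sum_abs])
      then show ?thesis using 1 by linarith
    qed
    have "(\<lambda>n. \<bar>\<phi>' n t - \<phi>' n s - a s t\<bar>) \<longlonglongrightarrow> \<bar>lim (\<lambda>n. \<phi>' n t) - lim (\<lambda>n. \<phi>' n s) - a s t\<bar>"
      using st by (intro tendsto_intros conv) auto
    moreover have "(\<lambda>n. C' * e n + K * \<omega> s t powr \<theta>) \<longlonglongrightarrow> C' * 0 + K * \<omega> s t powr \<theta>"
      by (intro tendsto_intros e_lim)
    ultimately show ?thesis
      using bound by (auto intro: LIMSEQ_le)
  qed
  then show thesis by (rule that)
qed

end

section \<open>Calculus of remainders of order \<open>\<omega> powr (k / p)\<close>\<close>

locale rough_setting = control_on +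
  fixes p :: real
  assumes p_ge_1: "p \<ge> 1"
begin

abbreviation N :: nat where "N \<equiv> level p"

text \<open>For \<open>k = 0\<close> the weight is \<open>1\<close> and not \<open>\<omega> s t powr 0\<close>, because \<open>0 powr 0 = 0\<close>.\<close>

definition weight :: "nat \<Rightarrow> real \<Rightarrow> real \<Rightarrow> real" where
  "weight k s t = (if k = 0 then 1 else \<omega> s t powr (real k / p))"

text \<open>The middle time \<open>u\<close> is an argument although the bound involves
  \<open>s\<close> and \<open>t\<close> alone: defects of Chen's relation depend on all three times,
  and functions of two times fit in as constant in one of them.\<close>

definition bigO :: "nat \<Rightarrow> (real \<Rightarrow> real \<Rightarrow> real \<Rightarrow> real) \<Rightarrow> bool" where
  "bigO k a \<longleftrightarrow> (\<exists>C. \<forall>s u t. 0 \<le> s \<longrightarrow> s \<le> u \<longrightarrow> u \<le> t \<longrightarrow> t \<le> T \<longrightarrow> \<bar>a s u t\<bar> \<le> C * weight k s t)"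

text \<open>\<open>N + 1 > p\<close>, so a remainder of order \<open>Suc N\<close> has an exponent
  above 1, the threshold both for sewing and for the vanishing of additive functions.\<close>

lemma N_pos: "N \<ge> 1" and N_exponent: "real (Suc N) / p > 1"
proof -
  have "\<lfloor>p\<rfloor> \<ge> 1" using p_ge_1 by simp
  then show "N \<ge> 1" by linarith
  have "p < real (Suc N)" using \<open>\<lfloor>p\<rfloor> \<ge> 1\<close> by (simp add: nat_0_le) linarith
  then show "real (Suc N) / p > 1" using p_ge_1 by simp
qed

lemma weight_nonneg: "weight k s t \<ge> 0" unfolding weight_def by simp

lemma weight_mono:
  assumes "0 \<le> s" "s \<le> s'" "s' \<le> t'" "t' \<le> t" "t \<le> T"
  shows "weight k s' t' \<le> weight k s t"
  unfolding weight_def using assms p_ge_1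
  by (auto intro!: powr_mono2 control_mono control_nonneg)

lemma weight_mult: "weight j s t * weight k s t = weight (j + k) s t"
  unfolding weight_def by (auto simp flip: powr_add simp: add_divide_distrib)

lemma weight_le:
  assumes "0 \<le> s" "s \<le> t" "t \<le> T"
  shows "weight k s t \<le> weight k 0 T"
  using assms by (intro weight_mono) auto

lemma bigOI:
  assumes "\<And>s u t. 0 \<le> s \<Longrightarrow> s \<le> u \<Longrightarrow> u \<le> t \<Longrightarrow> t \<le> T \<Longrightarrow> \<bar>a s u t\<bar> \<le> C * weight k s t"
  shows "bigO k a"
  using assms unfolding bigO_def by blast

lemma bigOE:
  assumes "bigO k a"
  obtains C where "C \<ge> 0"
    "\<And>s u t. 0 \<le> s \<Longrightarrow> s \<le> u \<Longrightarrow> u \<le> t \<Longrightarrow> t \<le> T \<Longrightarrow> \<bar>a s u t\<bar> \<le> C * weight k s t"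
proof -
  obtain C where C: "\<And>s u t. 0 \<le> s \<Longrightarrow> s \<le> u \<Longrightarrow> u \<le> t \<Longrightarrow> t \<le> T \<Longrightarrow> \<bar>a s u t\<bar> \<le> C * weight k s t"
    using assms unfolding bigO_def by blast
  have "\<bar>a s u t\<bar> \<le> max C 0 * weight k s t" if "0 \<le> s" "s \<le> u" "u \<le> t" "t \<le> T" for s u t
    using C[OF that] weight_nonneg by (smt (verit) mult_right_mono)
  then show ?thesis using that[of "max C 0"] by simp
qed

lemma bigO_cong:
  assumes "\<And>s u t. 0 \<le> s \<Longrightarrow> s \<le> u \<Longrightarrow> u \<le> t \<Longrightarrow> t \<le> T \<Longrightarrow> a s u t = b s u t"
  shows "bigO k a \<longleftrightarrow> bigO k b"
  unfolding bigO_def using assms by simp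

lemma bigO_zero: "bigO k (\<lambda>s u t. 0)"
  by (rule bigOI[where C = 0]) simp

lemma bigO_add:
  assumes "bigO k a" "bigO k b"
  shows "bigO k (\<lambda>s u t. a s u t + b s u t)"
proof -
  obtain C where C: "C \<ge> 0" "\<And>s u t. 0 \<le> s \<Longrightarrow> s \<le> u \<Longrightarrow> u \<le> t \<Longrightarrow> t \<le> T \<Longrightarrow> \<bar>a s u t\<bar> \<le> C * weight k s t"
    by (rule bigOE[OF assms(1)]) blast
  obtain D where D: "D \<ge> 0" "\<And>s u t. 0 \<le> s \<Longrightarrow> s \<le> u \<Longrightarrow> u \<le> t \<Longrightarrow> t \<le> T \<Longrightarrow> \<bar>b s u t\<bar> \<le> D * weight k s t"
    by (rule bigOE[OF assms(2)]) blast
  show ?thesis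
  proof (rule bigOI[where C = "C + D"])
    fix s u t :: real assume "0 \<le> s" "s \<le> u" "u \<le> t" "t \<le> T"
    from C(2)[OF this] D(2)[OF this] show "\<bar>a s u t + b s u t\<bar> \<le> (C + D) * weight k s t"
      by (simp add: distrib_right)
  qed
qed

lemma bigO_mult:
  assumes "bigO j a" "bigO k b"
  shows "bigO (j + k) (\<lambda>s u t. a s u t * b s u t)"
proof -
  obtain C where C: "C \<ge> 0" "\<And>s u t. 0 \<le> s \<Longrightarrow> s \<le> u \<Longrightarrow> u \<le> t \<Longrightarrow> t \<le> T \<Longrightarrow> \<bar>a s u t\<bar> \<le> C * weight j s t"
    by (rule bigOE[OF assms(1)]) blast
  obtain D where D: "D \<ge> 0" "\<And>s u t. 0 \<le> s \<Longrightarrow> s \<le> u \<Longrightarrow> u \<le> t \<Longrightarrow> t \<le> T \<Longrightarrow> \<bar>b s u t\<bar> \<le> D * weight k s t"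
    by (rule bigOE[OF assms(2)]) blast
  show ?thesis
  proof (rule bigOI[where C = "C * D"])
    fix s u t :: real assume st: "0 \<le> s" "s \<le> u" "u \<le> t" "t \<le> T"
    have "\<bar>a s u t * b s u t\<bar> \<le> (C * weight j s t) * (D * weight k s t)"
      unfolding abs_mult using C(2)[OF st] D(2)[OF st] C(1) weight_nonneg
      by (intro mult_mono) auto
    also have "\<dots> = C * D * weight (j + k) s t" by (simp flip: weight_mult)
    finally show "\<bar>a s u t * b s u t\<bar> \<le> C * D * weight (j + k) s t" .
  qed
qed

text \<open>On the bounded interval the surplus factor \<open>weight (j - k) s t\<close> is at most
  its value on \<open>[0, T]\<close> and is absorbed into the constant.\<close>

lemma bigO_mono:
  assumes "bigO j a" "k \<le> j"
  shows "bigO k a"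
proof -
  obtain C where C: "C \<ge> 0" "\<And>s u t. 0 \<le> s \<Longrightarrow> s \<le> u \<Longrightarrow> u \<le> t \<Longrightarrow> t \<le> T \<Longrightarrow> \<bar>a s u t\<bar> \<le> C * weight j s t"
    by (rule bigOE[OF assms(1)]) blast
  show ?thesis
  proof (rule bigOI[where C = "C * weight (j - k) 0 T"])
    fix s u t :: real assume st: "0 \<le> s" "s \<le> u" "u \<le> t" "t \<le> T"
    have "\<bar>a s u t\<bar> \<le> C * (weight (j - k) s t * weight k s t)"
      using C(2)[OF st] \<open>k \<le> j\<close> by (simp add: weight_mult)
    also have "\<dots> \<le> C * (weight (j - k) 0 T * weight k s t)"
      using st C(1) weight_nonneg by (intro mult_left_mono mult_right_mono weight_le) auto
    finally show "\<bar>a s u t\<bar> \<le> C * weight (j - k) 0 T * weight k s t" by simp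
  qed
qed

lemma bigO_times:
  assumes "bigO j a" "bigO l b" "k \<le> j + l"
  shows "bigO k (\<lambda>s u t. a s u t * b s u t)"
  using bigO_mono[OF bigO_mult[OF assms(1,2)] assms(3)] .

lemma bigO_const: "bigO 0 (\<lambda>s u t. c)"
  by (rule bigOI[where C = "\<bar>c\<bar>"]) (simp add: weight_def)

lemma bigO_uminus: "bigO k a \<Longrightarrow> bigO k (\<lambda>s u t. - a s u t)"
  unfolding bigO_def by simp

lemma bigO_sum:
  "(\<And>i. i \<in> I \<Longrightarrow> bigO k (a i)) \<Longrightarrow> bigO k (\<lambda>s u t. \<Sum>i\<in>I. a i s u t)"
  by (induction I rule: infinite_finite_induct) (auto intro: bigO_zero bigO_add)

lemma bigO_swap:
  assumes "bigO k (\<lambda>s u t. a s u t - b s u t)"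
  shows "bigO k (\<lambda>s u t. b s u t - a s u t)"
  using bigO_uminus[OF assms] by simp

lemma bigO_trans:
  assumes "bigO k (\<lambda>s u t. a s u t - b s u t)" "bigO k (\<lambda>s u t. b s u t - c s u t)"
  shows "bigO k (\<lambda>s u t. a s u t - c s u t)"
  using bigO_add[OF assms] by simp

lemma bigO_diff_bounded:
  assumes "bigO k (\<lambda>s u t. a s u t - b s u t)" "bigO j b" "j \<le> k"
  shows "bigO j a"
  using bigO_add[OF bigO_mono[OF assms(1,3)] assms(2)] by simp

lemma bigO_sum_diff:
  assumes "\<And>i. i \<in> I \<Longrightarrow> bigO k (\<lambda>s u t. a i s u t - b i s u t)"
  shows "bigO k (\<lambda>s u t. (\<Sum>i\<in>I. a i s u t) - (\<Sum>i\<in>I. b i s u t))"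
  using bigO_sum[of I k "\<lambda>i s u t. a i s u t - b i s u t"] assms by (simp add: sum_subtractf)

text \<open>The identity \<open>a b - a' b' = (a - a') b + a' (b - b')\<close> explains which two
  factors are bounded in the hypotheses.\<close>

lemma bigO_mult_diff:
  assumes "bigO k (\<lambda>s u t. a s u t - a' s u t)" "bigO k (\<lambda>s u t. b s u t - b' s u t)"
    and "bigO 0 a'" "bigO 0 b"
  shows "bigO k (\<lambda>s u t. a s u t * b s u t - a' s u t * b' s u t)"
proof -
  have "bigO k (\<lambda>s u t. (a s u t - a' s u t) * b s u t + a' s u t * (b s u t - b' s u t))"
    using bigO_mult[OF assms(1,4)] bigO_mult[OF assms(3,2)] by (intro bigO_add) auto
  then show ?thesis by (simp add: algebra_simps)
qed

lemma bigO_left: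
  assumes "bigO k (\<lambda>s u t. a s t)"
  shows "bigO k (\<lambda>s u t. a s u)"
proof -
  obtain C where C: "C \<ge> 0" "\<And>s u t. 0 \<le> s \<Longrightarrow> s \<le> u \<Longrightarrow> u \<le> t \<Longrightarrow> t \<le> T \<Longrightarrow> \<bar>a s t\<bar> \<le> C * weight k s t"
    by (rule bigOE[OF assms]) blast
  show ?thesis
  proof (rule bigOI[where C = C])
    fix s u t :: real assume st: "0 \<le> s" "s \<le> u" "u \<le> t" "t \<le> T"
    have "\<bar>a s u\<bar> \<le> C * weight k s u" using st C(2)[of s s u] by simp
    also have "\<dots> \<le> C * weight k s t" using st C(1) by (intro mult_left_mono weight_mono) auto
    finally show "\<bar>a s u\<bar> \<le> C * weight k s t" .
  qed
qed

lemma bigO_right: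
  assumes "bigO k (\<lambda>s u t. a s t)"
  shows "bigO k (\<lambda>s u t. a u t)"
proof -
  obtain C where C: "C \<ge> 0" "\<And>s u t. 0 \<le> s \<Longrightarrow> s \<le> u \<Longrightarrow> u \<le> t \<Longrightarrow> t \<le> T \<Longrightarrow> \<bar>a s t\<bar> \<le> C * weight k s t"
    by (rule bigOE[OF assms]) blast
  show ?thesis
  proof (rule bigOI[where C = C])
    fix s u t :: real assume st: "0 \<le> s" "s \<le> u" "u \<le> t" "t \<le> T"
    have "\<bar>a u t\<bar> \<le> C * weight k u t" using st C(2)[of u u t] by simp
    also have "\<dots> \<le> C * weight k s t" using st C(1) by (intro mult_left_mono weight_mono) auto
    finally show "\<bar>a u t\<bar> \<le> C * weight k s t" .
  qed
qed

lemma bigO_continuous: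
  assumes "continuous_on {0..T} f"
  shows "bigO 0 (\<lambda>s u t. f s)" "bigO 0 (\<lambda>s u t. f u)" "bigO 0 (\<lambda>s u t. f t)"
proof -
  have "bounded (f ` {0..T})"
    by (intro compact_imp_bounded compact_continuous_image assms) auto
  then obtain C where "\<forall>t\<in>{0..T}. \<bar>f t\<bar> \<le> C" unfolding bounded_iff by force
  then show "bigO 0 (\<lambda>s u t. f s)" "bigO 0 (\<lambda>s u t. f u)" "bigO 0 (\<lambda>s u t. f t)"
    by (auto intro!: bigOI[where C = C] simp: weight_def)
qed

lemma approx_iff_bigO:
  fixes a b :: "real \<Rightarrow> real \<Rightarrow> real"
  assumes "m > 0"
  shows "approx \<omega> p T m a b \<longleftrightarrow> bigO m (\<lambda>s u t. a s t - b s t)"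
proof
  assume "approx \<omega> p T m a b"
  then obtain C where "\<And>s t. (s, t) \<in> simplex2 T \<Longrightarrow> \<bar>a s t - b s t\<bar> \<le> C * \<omega> s t powr (real m / p)"
    unfolding approx_def by auto
  then show "bigO m (\<lambda>s u t. a s t - b s t)"
    using assms by (intro bigOI[where C = C]) (auto simp: weight_def simplex2_def)
next
  assume "bigO m (\<lambda>s u t. a s t - b s t)"
  then obtain C where C: "C \<ge> 0" "\<And>s u t. 0 \<le> s \<Longrightarrow> s \<le> u \<Longrightarrow> u \<le> t \<Longrightarrow> t \<le> T \<Longrightarrow> \<bar>a s t - b s t\<bar> \<le> C * weight m s t"
    by (rule bigOE) blast
  from C(2)[of s s t for s t] show "approx \<omega> p T m a b"
    using assms unfolding approx_def by (intro exI[of _ C]) (auto simp: weight_def simplex2_def)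
qed

lemma continuous_on_if_bigO:
  assumes "bigO 1 (\<lambda>s u t. f t - f s)"
  shows "continuous_on {0..T} f"
proof (rule continuous_onI)
  fix x e :: real assume x: "x \<in> {0..T}" and "e > 0"
  obtain C where C: "C \<ge> 0" "\<And>s u t. 0 \<le> s \<Longrightarrow> s \<le> u \<Longrightarrow> u \<le> t \<Longrightarrow> t \<le> T \<Longrightarrow> \<bar>f t - f s\<bar> \<le> C * weight 1 s t"
    by (rule bigOE[OF assms]) blast
  \<comment> \<open>Solves \<open>\<eta> powr (1 / p) = e / (C + 1)\<close>; \<open>C + 1\<close>
    instead of \<open>C\<close> covers \<open>C = 0\<close>.\<close>
  define \<eta> where "\<eta> = (e / (C + 1)) powr p"
  have "\<eta> > 0" unfolding \<eta>_def using \<open>e > 0\<close> C(1) by simp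
  have \<eta>: "\<eta> powr (1 / p) = e / (C + 1)" unfolding \<eta>_def using \<open>e > 0\<close> C(1) p_ge_1 by (simp add: powr_powr)
  obtain \<delta> where "\<delta> > 0" and \<delta>: "\<And>s t. 0 \<le> s \<Longrightarrow> s \<le> t \<Longrightarrow> t \<le> T \<Longrightarrow> t - s < \<delta> \<Longrightarrow> \<omega> s t < \<eta>"
    using control_mesh[OF \<open>\<eta> > 0\<close>] by blast
  have key: "\<bar>f t - f s\<bar> \<le> e" if st: "0 \<le> s" "s \<le> t" "t \<le> T" "t - s < \<delta>" for s t
  proof -
    have "\<bar>f t - f s\<bar> \<le> C * weight 1 s t" using C(2)[of s s t] st by simp
    also have "weight 1 s t \<le> \<eta> powr (1 / p)"
      unfolding weight_def using \<delta>[OF st] control_nonneg[OF st(1-3)] p_ge_1 by (auto intro!: powr_mono2)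
    also have "C * (\<eta> powr (1 / p)) \<le> e" unfolding \<eta> using C(1) \<open>e > 0\<close> by (simp add: field_simps)
    finally show ?thesis using C(1) by (simp add: mult_left_mono)
  qed
  have "dist (f x') (f x) \<le> e" if "x' \<in> {0..T}" "dist x' x < \<delta>" for x'
    using key[of x x'] key[of x' x] that x unfolding dist_real_def by (cases "x \<le> x'") auto
  then show "\<exists>d>0. \<forall>x'\<in>{0..T}. dist x' x < d \<longrightarrow> dist (f x') (f x) \<le> e"
    using \<open>\<delta> > 0\<close> by blast
qed

lemma additive_bigO_eq_0:
  assumes "bigO (Suc N) (\<lambda>s u t. \<psi> s t)"
    and "\<And>s u t. 0 \<le> s \<Longrightarrow> s \<le> u \<Longrightarrow> u \<le> t \<Longrightarrow> t \<le> T \<Longrightarrow> \<psi> s t = \<psi> s u + \<psi> u t"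
    and "0 \<le> s" "s \<le> t" "t \<le> T"
  shows "\<psi> s t = 0"
proof -
  obtain C where C: "C \<ge> 0" "\<And>s u t. 0 \<le> s \<Longrightarrow> s \<le> u \<Longrightarrow> u \<le> t \<Longrightarrow> t \<le> T \<Longrightarrow> \<bar>\<psi> s t\<bar> \<le> C * weight (Suc N) s t"
    by (rule bigOE[OF assms(1)]) blast
  have "\<bar>\<psi> s t\<bar> \<le> C * \<omega> s t powr (real (Suc N) / p)" if "0 \<le> s" "s \<le> t" "t \<le> T" for s t
    using C(2)[of s s t] that unfolding weight_def by simp
  from additive_small_eq_0[OF N_exponent assms(2) this assms(3-5)] show ?thesis .
qed

lemma sewing_bigO:
  assumes "bigO (Suc N) (\<lambda>s u t. a s t - a s u - a u t)"
  obtains \<phi> where "bigO (Suc N) (\<lambda>s u t. \<phi> t - \<phi> s - a s t)"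
proof -
  obtain C where C: "C \<ge> 0" "\<And>s u t. 0 \<le> s \<Longrightarrow> s \<le> u \<Longrightarrow> u \<le> t \<Longrightarrow> t \<le> T \<Longrightarrow> \<bar>a s t - a s u - a u t\<bar> \<le> C * weight (Suc N) s t"
    by (rule bigOE[OF assms]) blast
  obtain \<phi> K where "\<And>s t. 0 \<le> s \<Longrightarrow> s \<le> t \<Longrightarrow> t \<le> T \<Longrightarrow> \<bar>\<phi> t - \<phi> s - a s t\<bar> \<le> K * \<omega> s t powr (real (Suc N) / p)"
    using sewing[OF N_exponent, of a C] C unfolding weight_def by auto
  then show thesis
    by (intro that[of \<phi>] bigOI[where C = K]) (auto simp: weight_def)
qed

end

section \<open>Multiplicative functionals\<close>

lemma words_upto_iff: "w \<in> words_upto n \<longleftrightarrow> set w \<subseteq> Basis \<and> length w \<le> n"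
  unfolding words_upto_def words_def by auto

lemma words_upto_take: "w \<in> words_upto n \<Longrightarrow> take k w \<in> words_upto n"
  by (auto simp: words_upto_iff dest: in_set_takeD)

lemma words_upto_drop: "w \<in> words_upto n \<Longrightarrow> drop k w \<in> words_upto n"
  by (auto simp: words_upto_iff dest: in_set_dropD)

text \<open>The two extreme cuts carry the top degree, in which Chen's relation is therefore
  additive up to products of lower degrees.\<close>

lemma tmult_eq_inner:
  assumes "a [] = 1" "b [] = 1" "length w = Suc n"
  shows "tmult a b w = a w + b w + (\<Sum>k=1..n. a (take k w) * b (drop k w))"
proof -
  have "tmult a b w = (\<Sum>k\<in>{0..Suc n}. a (take k w) * b (drop k w))"
    unfolding tmult_def using assms by (simp add: atMost_atLeast0)
  also have "\<dots> = (\<Sum>k=1..Suc n. a (take k w) * b (drop k w)) + b w"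
    using assms by (simp add: sum.atLeast_Suc_atMost)
  also have "(\<Sum>k=1..Suc n. a (take k w) * b (drop k w)) = (\<Sum>k=1..n. a (take k w) * b (drop k w)) + a w"
    using assms by simp
  finally show ?thesis by simp
qed

lemma tmult_drop:
  assumes "k \<le> length w"
  shows "tmult a b (drop k w) = (\<Sum>j=k..length w. a (drop k (take j w)) * b (drop j w))"
proof -
  have "(\<Sum>j=k..length w. a (drop k (take j w)) * b (drop j w))
      = (\<Sum>i=0..length w - k. a (drop k (take (i + k) w)) * b (drop (i + k) w))"
    using sum.shift_bounds_cl_nat_ivl[of "\<lambda>j. a (drop k (take j w)) * b (drop j w)" 0 k "length w - k"] assms
    by simp
  then show ?thesis
    unfolding tmult_def by (simp add: atMost_atLeast0 take_drop add.commute)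
qed

lemma tmult_take:
  assumes "j \<le> length w"
  shows "tmult a b (take j w) = (\<Sum>k=0..j. a (take k w) * b (drop k (take j w)))"
  unfolding tmult_def using assms by (simp add: atMost_atLeast0 min_def)

context rough_setting
begin

text \<open>Chen's relation alone and with its own degree bound \<open>n\<close>: the extension goes
  by induction on this degree, and the estimates enter separately.\<close>

definition multiplicative :: "nat \<Rightarrow> (real \<Rightarrow> real \<Rightarrow> 'v::euclidean_space tensor) \<Rightarrow> bool" where
  "multiplicative n Z \<longleftrightarrow>
     (\<forall>s t. 0 \<le> s \<longrightarrow> s \<le> t \<longrightarrow> t \<le> T \<longrightarrow> Z s t [] = 1) \<and>
     (\<forall>s u t. 0 \<le> s \<longrightarrow> s \<le> u \<longrightarrow> u \<le> t \<longrightarrow> t \<le> T \<longrightarrow>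
        (\<forall>w\<in>words_upto n. Z s t w = tmult (Z s u) (Z u t) w))"

lemma multiplicative_Nil:
  "multiplicative n Z \<Longrightarrow> 0 \<le> s \<Longrightarrow> s \<le> t \<Longrightarrow> t \<le> T \<Longrightarrow> Z s t [] = 1"
  unfolding multiplicative_def by blast

lemma multiplicative_tmult:
  "multiplicative n Z \<Longrightarrow> 0 \<le> s \<Longrightarrow> s \<le> u \<Longrightarrow> u \<le> t \<Longrightarrow> t \<le> T \<Longrightarrow> w \<in> words_upto n
    \<Longrightarrow> Z s t w = tmult (Z s u) (Z u t) w"
  unfolding multiplicative_def by blast

text \<open>Associativity of the truncated product, read off the middle degrees.\<close>

lemma multiplicative_triangle:
  assumes Z: "multiplicative n Z" and w: "w \<in> words_upto (Suc n)" "length w = Suc n"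
    and st: "0 \<le> s" "s \<le> u" "u \<le> t" "t \<le> T"
  shows "(\<Sum>k=1..n. Z 0 s (take k w) * Z s t (drop k w)) - (\<Sum>k=1..n. Z 0 s (take k w) * Z s u (drop k w))
      - (\<Sum>k=1..n. Z 0 u (take k w) * Z u t (drop k w))
    = - (\<Sum>k=1..n. Z s u (take k w) * Z u t (drop k w))"
proof -
  \<comment> \<open>The term of the threefold product of \<open>Z 0 s\<close>, \<open>Z s u\<close>,
    \<open>Z u t\<close> with cuts after \<open>k\<close> and after \<open>j\<close> letters; both
    ways of multiplying out lead to the same double sum.\<close>
  define c where "c k j = Z 0 s (take k w) * Z s u (drop k (take j w)) * Z u t (drop j w)" for k j
  have nil: "Z a b [] = 1" if "0 \<le> a" "a \<le> b" "b \<le> T" for a b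
    using multiplicative_Nil[OF Z] that by blast
  have mid: "take k w \<in> words_upto n" "drop k w \<in> words_upto n" if "k \<in> {1..n}" for k
    using w that by (auto simp: words_upto_iff dest: in_set_takeD in_set_dropD)
  have 1: "Z 0 s (take k w) * Z s t (drop k w) - Z 0 s (take k w) * Z s u (drop k w) = (\<Sum>j=k..n. c k j)"
    if "k \<in> {1..n}" for k
  proof -
    have "Z s t (drop k w) = (\<Sum>j=k..Suc n. Z s u (drop k (take j w)) * Z u t (drop j w))"
      using multiplicative_tmult[OF Z st mid(2)[OF that]] tmult_drop[of k w "Z s u" "Z u t"] w that by simp
    also have "\<dots> = (\<Sum>j=k..n. Z s u (drop k (take j w)) * Z u t (drop j w)) + Z s u (drop k w)"
      using that w nil st by simp
    finally show ?thesis
      unfolding c_def by (simp add: algebra_simps sum_distrib_left)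
  qed
  have 2: "Z 0 u (take j w) * Z u t (drop j w) = (\<Sum>k=1..j. c k j) + Z s u (take j w) * Z u t (drop j w)"
    if "j \<in> {1..n}" for j
  proof -
    have "Z 0 u (take j w) = (\<Sum>k=0..j. Z 0 s (take k w) * Z s u (drop k (take j w)))"
      using multiplicative_tmult[OF Z _ _ _ _ mid(1)[OF that], of 0 s u] tmult_take[of j w "Z 0 s" "Z s u"]
        w st that by simp
    also have "\<dots> = Z s u (take j w) + (\<Sum>k=1..j. Z 0 s (take k w) * Z s u (drop k (take j w)))"
      using nil st by (simp add: sum.atLeast_Suc_atMost)
    finally show ?thesis
      unfolding c_def by (simp add: algebra_simps sum_distrib_left)
  qed
  have "(\<Sum>k=1..n. \<Sum>j=k..n. c k j) = (\<Sum>k=1..n. \<Sum>j=1..n. if k \<le> j then c k j else 0)"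
    by (intro sum.cong refl sum.mono_neutral_cong_left) auto
  also have "\<dots> = (\<Sum>j=1..n. \<Sum>k=1..n. if k \<le> j then c k j else 0)" by (rule sum.swap)
  also have "\<dots> = (\<Sum>j=1..n. \<Sum>k=1..j. c k j)"
    by (intro sum.cong refl sum.mono_neutral_cong_right) auto
  finally have swap: "(\<Sum>k=1..n. \<Sum>j=k..n. c k j) = (\<Sum>j=1..n. \<Sum>k=1..j. c k j)" .
  have A: "(\<Sum>k=1..n. Z 0 s (take k w) * Z s t (drop k w)) - (\<Sum>k=1..n. Z 0 s (take k w) * Z s u (drop k w))
      = (\<Sum>k=1..n. \<Sum>j=k..n. c k j)"
    unfolding sum_subtractf[symmetric] by (intro sum.cong refl 1)
  have B: "(\<Sum>k=1..n. Z 0 u (take k w) * Z u t (drop k w))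
      = (\<Sum>j=1..n. \<Sum>k=1..j. c k j) + (\<Sum>k=1..n. Z s u (take k w) * Z u t (drop k w))"
    unfolding sum.distrib[symmetric] by (intro sum.cong refl 2)
  show ?thesis unfolding A B swap by simp
qed

text \<open>Lyons' extension in one degree. If \<open>\<phi> w t\<close> stands for
  \<open>Z 0 t w\<close>, Chen's relation at the times \<open>0\<close>, \<open>s\<close>,
  \<open>t\<close> determines \<open>Z s t w\<close> as the increment of \<open>\<phi> w\<close>
  minus products of lower degrees. The path \<open>\<phi> w\<close> is obtained by sewing
  \<open>A\<close> with these products added back.\<close>

lemma multiplicative_extension_step:
  assumes Z: "multiplicative n Z" "\<And>w. w \<in> words_upto n \<Longrightarrow> bigO (Suc N) (\<lambda>s u t. Z s t w - A s t w)"
    and A: "\<And>s t. 0 \<le> s \<Longrightarrow> s \<le> t \<Longrightarrow> t \<le> T \<Longrightarrow> A s t [] = 1"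
      "\<And>w. w \<in> words_upto (Suc n) \<Longrightarrow> bigO 0 (\<lambda>s u t. A s t w)"
      "\<And>w. w \<in> words_upto (Suc n) \<Longrightarrow> bigO (Suc N) (\<lambda>s u t. A s t w - tmult (A s u) (A u t) w)"
  shows "\<exists>Z'. multiplicative (Suc n) Z' \<and>
    (\<forall>w\<in>words_upto (Suc n). bigO (Suc N) (\<lambda>s u t. Z' s t w - A s t w))"
proof -
  define a where "a w s t = A s t w + (\<Sum>k=1..n. Z 0 s (take k w) * Z s t (drop k w))" for w s t
  have mid: "take k w \<in> words_upto n" "drop k w \<in> words_upto n"
    if "k \<in> {1..n}" "w \<in> words_upto (Suc n)" for k w
    using that by (auto simp: words_upto_iff dest: in_set_takeD in_set_dropD)
  have A_n: "bigO 0 (\<lambda>s u t. A s t w)" if "w \<in> words_upto n" for w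
    using A(2)[of w] that by (auto simp: words_upto_iff)
  have "\<exists>\<phi>. bigO (Suc N) (\<lambda>s u t. \<phi> t - \<phi> s - a w s t)"
    if w: "w \<in> words_upto (Suc n)" "length w = Suc n" for w
  proof -
    have "bigO (Suc N) (\<lambda>s u t. (A s t w - tmult (A s u) (A u t) w)
        + ((\<Sum>k=1..n. A s u (take k w) * A u t (drop k w))
          - (\<Sum>k=1..n. Z s u (take k w) * Z u t (drop k w))))"
    proof (intro bigO_add bigO_sum_diff A(3) w bigO_mult_diff)
      fix k assume k: "k \<in> {1..n}"
      note m = mid[OF k w(1)]
      show "bigO (Suc N) (\<lambda>s u t. A s u (take k w) - Z s u (take k w))"
        using bigO_left[OF Z(2)[OF m(1)]] by (rule bigO_swap)
      show "bigO (Suc N) (\<lambda>s u t. A u t (drop k w) - Z u t (drop k w))"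
        using bigO_right[OF Z(2)[OF m(2)]] by (rule bigO_swap)
      show "bigO 0 (\<lambda>s u t. A u t (drop k w))"
        using bigO_right[OF A_n[OF m(2)]] .
      show "bigO 0 (\<lambda>s u t. Z s u (take k w))"
        using bigO_diff_bounded[OF bigO_left[OF Z(2)[OF m(1)]] bigO_left[OF A_n[OF m(1)]]] by simp
    qed
    \<comment> \<open>By \<open>multiplicative_triangle\<close> the added products contribute minus
      the middle terms of Chen's relation for \<open>Z\<close>. So the defect of \<open>a\<close> is
      that of \<open>A\<close> plus the difference of the middle terms of \<open>A\<close> and
      \<open>Z\<close>, both of order \<open>Suc N\<close>.\<close>
    also have "?this \<longleftrightarrow> bigO (Suc N) (\<lambda>s u t. a w s t - a w s u - a w u t)"
    proof (rule bigO_cong)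
      fix s u t :: real assume st: "0 \<le> s" "s \<le> u" "u \<le> t" "t \<le> T"
      show "A s t w - tmult (A s u) (A u t) w + ((\<Sum>k=1..n. A s u (take k w) * A u t (drop k w))
          - (\<Sum>k=1..n. Z s u (take k w) * Z u t (drop k w))) = a w s t - a w s u - a w u t"
        using multiplicative_triangle[OF Z(1) w st] tmult_eq_inner[of "A s u" "A u t" w n] A(1) w st
        unfolding a_def by simp
    qed
    finally show ?thesis by (rule sewing_bigO) (rule exI)
  qed
  then have "\<forall>w. \<exists>\<phi>. w \<in> words_upto (Suc n) \<longrightarrow> length w = Suc n \<longrightarrow>
      bigO (Suc N) (\<lambda>s u t. \<phi> t - \<phi> s - a w s t)"
    by simp
  from choice[OF this] obtain \<phi> where \<phi>: "\<And>w. w \<in> words_upto (Suc n) \<Longrightarrow> length w = Suc n \<Longrightarrow>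
      bigO (Suc N) (\<lambda>s u t. \<phi> w t - \<phi> w s - a w s t)"
    by auto
  define Z' where "Z' s t w = (if length w \<le> n then Z s t w
    else \<phi> w t - \<phi> w s - (\<Sum>k=1..n. Z 0 s (take k w) * Z s t (drop k w)))" for s t w
  have "Z' s t w = tmult (Z' s u) (Z' u t) w"
    if st: "0 \<le> s" "s \<le> u" "u \<le> t" "t \<le> T" and w: "w \<in> words_upto (Suc n)" for s u t w
  proof (cases "length w \<le> n")
    case True
    then have "w \<in> words_upto n" using w by (simp add: words_upto_iff)
    from multiplicative_tmult[OF Z(1) st this] have "Z' s t w = tmult (Z s u) (Z u t) w"
      unfolding Z'_def using True by simp
    also have "\<dots> = tmult (Z' s u) (Z' u t) w"
      unfolding tmult_def using True by (intro sum.cong) (auto simp: Z'_def)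
    finally show ?thesis .
  next
    case False
    then have len: "length w = Suc n" using w by (simp add: words_upto_iff)
    have nil: "Z' a b [] = 1" if "0 \<le> a" "a \<le> b" "b \<le> T" for a b
      unfolding Z'_def using multiplicative_Nil[OF Z(1)] that by simp
    have "tmult (Z' s u) (Z' u t) w = Z' s u w + Z' u t w + (\<Sum>k=1..n. Z' s u (take k w) * Z' u t (drop k w))"
      using nil st len by (intro tmult_eq_inner) auto
    also have "(\<Sum>k=1..n. Z' s u (take k w) * Z' u t (drop k w)) = (\<Sum>k=1..n. Z s u (take k w) * Z u t (drop k w))"
      using len by (intro sum.cong) (auto simp: Z'_def)
    finally show ?thesis
      using multiplicative_triangle[OF Z(1) w len st] len unfolding Z'_def by simp
  qed
  then have "multiplicative (Suc n) Z'"
    unfolding multiplicative_def using multiplicative_Nil[OF Z(1)] by (simp add: Z'_def)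
  moreover have "bigO (Suc N) (\<lambda>s u t. Z' s t w - A s t w)" if w: "w \<in> words_upto (Suc n)" for w
  proof (cases "length w \<le> n")
    case True
    then show ?thesis using Z(2)[of w] w by (simp add: words_upto_iff Z'_def)
  next
    case False
    then have "length w = Suc n" using w by (simp add: words_upto_iff)
    then show ?thesis using \<phi>[OF w] by (simp add: Z'_def a_def algebra_simps)
  qed
  ultimately show ?thesis by blast
qed

lemma multiplicative_extension:
  assumes A: "\<And>s t. 0 \<le> s \<Longrightarrow> s \<le> t \<Longrightarrow> t \<le> T \<Longrightarrow> A s t [] = 1"
      "\<And>w. w \<in> words_upto n \<Longrightarrow> bigO 0 (\<lambda>s u t. A s t w)"
      "\<And>w. w \<in> words_upto n \<Longrightarrow> bigO (Suc N) (\<lambda>s u t. A s t w - tmult (A s u) (A u t) w)"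
  obtains Z where "multiplicative n Z"
    "\<forall>w\<in>words_upto n. bigO (Suc N) (\<lambda>s u t. Z s t w - A s t w)"
proof -
  have "m \<le> n \<Longrightarrow> \<exists>Z. multiplicative m Z \<and> (\<forall>w\<in>words_upto m. bigO (Suc N) (\<lambda>s u t. Z s t w - A s t w))" for m
  proof (induction m)
    case 0
    have "multiplicative 0 (\<lambda>s t w. 1)"
      unfolding multiplicative_def by (auto simp: words_upto_iff tmult_def)
    moreover have "bigO (Suc N) (\<lambda>s u t. 1 - A s t [])"
      using bigO_cong[of "\<lambda>s u t. 1 - A s t []" "\<lambda>s u t. 0"] A(1) bigO_zero by simp
    ultimately show ?case by (auto simp: words_upto_iff intro!: exI[of _ "\<lambda>s t w. 1"])
  next
    case (Suc m)
    then obtain Z where "multiplicative m Z" "\<forall>w\<in>words_upto m. bigO (Suc N) (\<lambda>s u t. Z s t w - A s t w)"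
      by auto
    then show ?case
      using Suc.prems A by (intro multiplicative_extension_step[where Z = Z]) (auto simp: words_upto_iff)
  qed
  from this[of n] show thesis using that by blast
qed

text \<open>Induction on the length: once the shorter words agree, the difference at
  \<open>w\<close> is additive, and being of order \<open>Suc N\<close> it vanishes.\<close>

lemma multiplicative_unique:
  assumes Z: "multiplicative n Z" "multiplicative n Z'"
    and close: "\<And>w. w \<in> words_upto n \<Longrightarrow> bigO (Suc N) (\<lambda>s u t. Z s t w - Z' s t w)"
  shows "w \<in> words_upto n \<Longrightarrow> 0 \<le> s \<Longrightarrow> s \<le> t \<Longrightarrow> t \<le> T \<Longrightarrow> Z s t w = Z' s t w"
proof (induction "length w" arbitrary: w s t rule: less_induct)
  case less
  show ?case
  proof (cases "length w")
    case 0
    then show ?thesis using multiplicative_Nil[OF Z(1)] multiplicative_Nil[OF Z(2)] less.prems by simp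
  next
    case (Suc m)
    have "Z s t w - Z' s t w = (Z s u w - Z' s u w) + (Z u t w - Z' u t w)"
      if st: "0 \<le> s" "s \<le> u" "u \<le> t" "t \<le> T" for s u t
    proof -
      have "tmult (Z s u) (Z u t) w = Z s u w + Z u t w + (\<Sum>k=1..m. Z s u (take k w) * Z u t (drop k w))"
        using multiplicative_Nil[OF Z(1)] st Suc by (intro tmult_eq_inner) auto
      moreover have "tmult (Z' s u) (Z' u t) w = Z' s u w + Z' u t w + (\<Sum>k=1..m. Z' s u (take k w) * Z' u t (drop k w))"
        using multiplicative_Nil[OF Z(2)] st Suc by (intro tmult_eq_inner) auto
      moreover have "(\<Sum>k=1..m. Z s u (take k w) * Z u t (drop k w)) = (\<Sum>k=1..m. Z' s u (take k w) * Z' u t (drop k w))"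
        using less.prems(1) Suc st
        by (intro sum.cong refl arg_cong2[of _ _ _ _ "(*)"] less.hyps words_upto_take words_upto_drop) auto
      ultimately show ?thesis
        using multiplicative_tmult[OF Z(1) st less.prems(1)] multiplicative_tmult[OF Z(2) st less.prems(1)] by simp
    qed
    from additive_bigO_eq_0[OF close[OF less.prems(1)] this less.prems(2-4)] show ?thesis by simp
  qed
qed

text \<open>Chen's relation at the times \<open>0\<close>, \<open>s\<close>, \<open>t\<close>
  expresses \<open>Z s t w\<close> by the one-parameter paths \<open>Z 0 t v\<close> and by shorter
  words of \<open>Z s t\<close>. The paths are continuous because their increments are small; the
  shorter words are covered by induction.\<close>

lemma multiplicative_continuous:
  assumes Z: "multiplicative n Z"
    and small: "\<And>w. w \<in> words_upto n \<Longrightarrow> w \<noteq> [] \<Longrightarrow> bigO 1 (\<lambda>s u t. Z s t w)"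
  shows "w \<in> words_upto n \<Longrightarrow> continuous_on (simplex2 T) (\<lambda>(s, t). Z s t w)"
proof (induction "length w" arbitrary: w rule: less_induct)
  case less
  show ?case
  proof (cases "length w")
    case 0
    have "continuous_on (simplex2 T) (\<lambda>(s, t). Z s t w) \<longleftrightarrow> continuous_on (simplex2 T) (\<lambda>x. 1 :: real)"
      using 0 multiplicative_Nil[OF Z] by (intro continuous_on_cong) (auto simp: simplex2_def)
    then show ?thesis by simp
  next
    case (Suc m)
    have bounded: "bigO 0 (\<lambda>s u t. Z s t v)" if "v \<in> words_upto n" for v
    proof (cases "v = []")
      case True
      then show ?thesis
        using bigO_cong[of "\<lambda>s u t. Z s t v" "\<lambda>s u t. 1"] multiplicative_Nil[OF Z] bigO_const by simp
    next
      case False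
      then show ?thesis using bigO_mono[OF small] that by simp
    qed
    have path: "continuous_on {0..T} (\<lambda>t. Z 0 t v)" if v: "v \<in> words_upto n" for v
    proof (rule continuous_on_if_bigO)
      have "bigO 1 (\<lambda>s u t. \<Sum>k<length v. Z 0 s (take k v) * Z s t (drop k v))"
      proof (intro bigO_sum)
        fix k assume "k \<in> {..<length v}"
        obtain C where C: "C \<ge> 0" "\<And>s u t. 0 \<le> s \<Longrightarrow> s \<le> u \<Longrightarrow> u \<le> t \<Longrightarrow> t \<le> T \<Longrightarrow> \<bar>Z s t (take k v)\<bar> \<le> C * weight 0 s t"
          by (rule bigOE[OF bounded[OF words_upto_take[OF v]]]) blast
        from C(2)[of 0 0] have "bigO 0 (\<lambda>s u t. Z 0 s (take k v))"
          by (intro bigOI[where C = C]) (auto simp: weight_def)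
        moreover have "bigO 1 (\<lambda>s u t. Z s t (drop k v))"
          using \<open>k \<in> {..<length v}\<close> by (intro small words_upto_drop v) auto
        ultimately show "bigO 1 (\<lambda>s u t. Z 0 s (take k v) * Z s t (drop k v))"
          using bigO_mult by fastforce
      qed
      also have "?this \<longleftrightarrow> bigO 1 (\<lambda>s u t. Z 0 t v - Z 0 s v)"
      proof (rule bigO_cong)
        fix s u t :: real assume st: "0 \<le> s" "s \<le> u" "u \<le> t" "t \<le> T"
        have "Z 0 t v = tmult (Z 0 s) (Z s t) v"
          using multiplicative_tmult[OF Z _ _ _ _ v, of 0 s t] st by simp
        also have "\<dots> = (\<Sum>k<length v. Z 0 s (take k v) * Z s t (drop k v)) + Z 0 s v"
          unfolding tmult_def lessThan_Suc_atMost[symmetric] using multiplicative_Nil[OF Z] st by simp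
        finally show "(\<Sum>k<length v. Z 0 s (take k v) * Z s t (drop k v)) = Z 0 t v - Z 0 s v" by simp
      qed
      finally show "bigO 1 (\<lambda>s u t. Z 0 t v - Z 0 s v)" .
    qed
    have s_cont: "continuous_on (simplex2 T) (\<lambda>x. Z 0 (fst x) v)"
      and t_cont: "continuous_on (simplex2 T) (\<lambda>x. Z 0 (snd x) v)" if "v \<in> words_upto n" for v
      by (rule continuous_on_compose2[OF path[OF that]],
          auto simp: simplex2_def intro!: continuous_on_fst continuous_on_snd continuous_on_id)+
    have eq: "Z s t w = Z 0 t w - Z 0 s w - (\<Sum>k=1..m. Z 0 s (take k w) * Z s t (drop k w))"
      if "(s, t) \<in> simplex2 T" for s t
      using multiplicative_tmult[OF Z _ _ _ _ less.prems, of 0 s t] tmult_eq_inner[of "Z 0 s" "Z s t" w m]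
        multiplicative_Nil[OF Z] that Suc by (simp add: simplex2_def)
    have "continuous_on (simplex2 T) (\<lambda>x. Z 0 (snd x) w - Z 0 (fst x) w
        - (\<Sum>k=1..m. Z 0 (fst x) (take k w) * (case x of (s, t) \<Rightarrow> Z s t (drop k w))))"
      using Suc less.prems
      by (intro continuous_intros s_cont t_cont words_upto_take less.hyps words_upto_drop) auto
    also have "?this \<longleftrightarrow> continuous_on (simplex2 T) (\<lambda>(s, t). Z s t w)"
      using eq by (intro continuous_on_cong) auto
    finally show ?thesis .
  qed
qed

end

section \<open>Words over the basis\<close>

lemma in_words_iff: "w \<in> words n \<longleftrightarrow> set w \<subseteq> Basis \<and> length w = n"
  unfolding words_def by simp

lemma finite_words [simp]: "finite (words n)"
proof -
  have "words n = {w. set w \<subseteq> (Basis :: 'a set) \<and> length w = n}" unfolding words_def ..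
  then show ?thesis using finite_lists_length_eq[of "Basis :: 'a set" n] by simp
qed

lemma words_Suc: "words (Suc n) = (\<lambda>(a, w). a # w) ` (Basis \<times> words n)"
  by (auto simp: in_words_iff length_Suc_conv image_iff)

lemma sum_words_Suc: "(\<Sum>w\<in>words (Suc n). f w) = (\<Sum>a\<in>Basis. \<Sum>w\<in>words n. f (a # w))"
  unfolding words_Suc sum.cartesian_product
  by (subst sum.reindex) (auto simp: inj_on_def case_prod_unfold)

lemma words_0: "words 0 = {[]}"
  by (auto simp: in_words_iff)

lemma finite_words_upto [simp]: "finite (words_upto n)"
  unfolding words_upto_def by simp

section \<open>Shuffles as lists of positions\<close>

text \<open>A shuffle with block sizes \<open>ns\<close> is encoded by its list of blocks, each an increasing list of
  positions.\<close>

definition block_lists :: "nat \<Rightarrow> nat \<Rightarrow> nat list list set" where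
  "block_lists n m = {Ls. length Ls = m \<and> (\<forall>L\<in>set Ls. sorted_wrt (<) L) \<and> mset (concat Ls) = mset [0..<n]}"

definition ordered_block_lists :: "nat \<Rightarrow> nat \<Rightarrow> nat list list set" where
  "ordered_block_lists n m = {Ls \<in> block_lists n m. [] \<notin> set Ls \<and> sorted_wrt (<) (map last Ls)}"

lemma length_blocks [simp]: "length (blocks ns xs) = length ns"
  by (induction ns arbitrary: xs) auto

lemma map_length_blocks: "length xs = sum_list ns \<Longrightarrow> map length (blocks ns xs) = ns"
  by (induction ns arbitrary: xs) auto

lemma concat_blocks: "length xs = sum_list ns \<Longrightarrow> concat (blocks ns xs) = xs"
  by (induction ns arbitrary: xs) auto

lemma blocks_concat: "blocks (map length Ls) (concat Ls) = Ls"
  by (induction Ls) auto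

lemma blocks_map: "blocks ns (map f xs) = map (map f) (blocks ns xs)"
  by (induction ns arbitrary: xs) (auto simp: take_map drop_map)

lemma blocks_nth: "i < length ns \<Longrightarrow> blocks ns xs ! i = take (ns ! i) (drop (sum_list (take i ns)) xs)"
proof (induction ns arbitrary: xs i)
  case (Cons n ns)
  then show ?case by (cases i) (auto simp: add.commute)
qed simp

lemma sum_list_take_Suc: "i < length ns \<Longrightarrow> sum_list (take (Suc i) ns) = sum_list (take i ns) + (ns ! i :: nat)"
  by (simp add: take_Suc_conv_app_nth)

lemma sum_list_take_le: "sum_list (take i ns) \<le> sum_list (ns :: nat list)"
  by (metis append_take_drop_id le_add1 sum_list_append)

lemma blocks_upt_nth:
  assumes "i < length ns"
  shows "blocks ns (map \<sigma> [0..<sum_list ns]) ! i = map \<sigma> [sum_list (take i ns)..<sum_list (take (Suc i) ns)]"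
proof -
  have "sum_list (take (Suc i) ns) \<le> sum_list ns" by (rule sum_list_take_le)
  then show ?thesis
    using assms by (simp add: blocks_nth drop_map take_map sum_list_take_Suc take_upt)
qed

lemma strict_mono_on_upt_iff:
  fixes \<sigma> :: "nat \<Rightarrow> nat"
  shows "strict_mono_on {a..<b} \<sigma> \<longleftrightarrow> sorted_wrt (<) (map \<sigma> [a..<b])"
proof -
  have "sorted_wrt (\<lambda>x y. \<sigma> x < \<sigma> y) [a..<b] \<longleftrightarrow> (\<forall>i j. a \<le> i \<and> i < j \<and> j < b \<longrightarrow> \<sigma> i < \<sigma> j)"
  proof
    assume *: "sorted_wrt (\<lambda>x y. \<sigma> x < \<sigma> y) [a..<b]"
    show "\<forall>i j. a \<le> i \<and> i < j \<and> j < b \<longrightarrow> \<sigma> i < \<sigma> j"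
    proof (intro allI impI)
      fix i j assume "a \<le> i \<and> i < j \<and> j < b"
      then have "i - a < j - a" "j - a < b - a" "[a..<b] ! (i - a) = i" "[a..<b] ! (j - a) = j" by auto
      then show "\<sigma> i < \<sigma> j" using sorted_wrt_nth_less[OF *, of "i - a" "j - a"] by simp
    qed
  qed (auto simp: sorted_wrt_iff_nth_less)
  then show ?thesis by (auto simp: strict_mono_on_def sorted_wrt_map)
qed

text \<open>The blocks cut the list of values of \<open>\<sigma>\<close>: that
  \<open>\<sigma>\<close> is a permutation means that the values rearrange
  \<open>[0..<sum_list ns]\<close>, and monotonicity on a block means that the block is sorted. The
  inverse extends by the identity, as \<open>permutes\<close> demands.\<close>

lemma bij_betw_Sh:
  "bij_betw (\<lambda>\<sigma>. blocks ns (map \<sigma> [0..<sum_list ns])) (Sh ns)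
    {Ls \<in> block_lists (sum_list ns) (length ns). map length Ls = ns}"
  (is "bij_betw ?B _ ?S")
proof (rule bij_betw_imageI)
  let ?n = "sum_list ns"
  show "inj_on ?B (Sh ns)"
  proof (rule inj_onI)
    fix \<sigma> \<tau> assume s: "\<sigma> \<in> Sh ns" and t: "\<tau> \<in> Sh ns" and eq: "?B \<sigma> = ?B \<tau>"
    have "map \<sigma> [0..<?n] = map \<tau> [0..<?n]"
      using arg_cong[OF eq, of concat] by (simp add: concat_blocks)
    then have 1: "\<And>i. i < ?n \<Longrightarrow> \<sigma> i = \<tau> i" by (auto simp: list_eq_iff_nth_eq)
    have "\<sigma> permutes {..<?n}" "\<tau> permutes {..<?n}" using s t by (auto simp: Sh_def)
    then have "\<And>i. \<not> i < ?n \<Longrightarrow> \<sigma> i = \<tau> i" by (simp add: permutes_def)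
    with 1 show "\<sigma> = \<tau>" by blast
  qed
  show "?B ` Sh ns = ?S"
  proof (intro equalityI subsetI)
    fix Ls assume "Ls \<in> ?B ` Sh ns"
    then obtain \<sigma> where s: "\<sigma> permutes {..<?n}"
      "\<And>i. i < length ns \<Longrightarrow> strict_mono_on {sum_list (take i ns)..<sum_list (take (Suc i) ns)} \<sigma>"
      and Ls: "Ls = ?B \<sigma>" by (auto simp: Sh_def)
    have "mset (concat Ls) = image_mset \<sigma> (mset_set {..<?n})"
      unfolding Ls by (simp add: concat_blocks mset_upt atLeast0LessThan)
    also have "\<dots> = mset [0..<?n]" using permutes_image_mset[OF s(1)] by (simp add: mset_upt atLeast0LessThan)
    finally have 1: "mset (concat Ls) = mset [0..<?n]" .
    have "sorted_wrt (<) (Ls ! i)" if "i < length ns" for i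
      unfolding Ls blocks_upt_nth[OF that] using s(2)[OF that] strict_mono_on_upt_iff by blast
    moreover have len: "length Ls = length ns" using Ls by simp
    ultimately have "\<forall>L\<in>set Ls. sorted_wrt (<) L" by (auto simp: in_set_conv_nth)
    moreover have "map length Ls = ns" unfolding Ls by (simp add: map_length_blocks)
    ultimately show "Ls \<in> ?S" using 1 len by (simp add: block_lists_def)
  next
    fix Ls assume Ls: "Ls \<in> ?S"
    define xs where "xs = concat Ls"
    have m: "mset xs = mset [0..<?n]" using Ls by (simp add: block_lists_def xs_def)
    have len: "length xs = ?n" using mset_eq_length[OF m] by simp
    have dist: "distinct xs" using mset_eq_imp_distinct_iff[OF m] by simp
    have set: "set xs = {..<?n}" using mset_eq_setD[OF m] by (simp add: atLeast0LessThan)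
    define \<sigma> where "\<sigma> i = (if i < ?n then xs ! i else i)" for i
    have "bij_betw (\<lambda>i. xs ! i) {..<?n} {..<?n}" by (rule bij_betw_nth[OF dist]) (simp_all add: len set)
    then have "bij_betw \<sigma> {..<?n} {..<?n}" by (rule bij_betw_cong[THEN iffD1, rotated]) (simp add: \<sigma>_def)
    then have perm: "\<sigma> permutes {..<?n}" by (rule bij_imp_permutes) (simp add: \<sigma>_def)
    have "map \<sigma> [0..<?n] = xs" using len by (auto simp: list_eq_iff_nth_eq \<sigma>_def)
    then have B: "?B \<sigma> = Ls" using Ls blocks_concat[of Ls] by (simp add: xs_def)
    have "strict_mono_on {sum_list (take i ns)..<sum_list (take (Suc i) ns)} \<sigma>" if "i < length ns" for i
    proof -
      have "sorted_wrt (<) (Ls ! i)" using Ls that by (auto simp: block_lists_def)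
      then show ?thesis unfolding strict_mono_on_upt_iff using blocks_upt_nth[OF that, of \<sigma>] B by simp
    qed
    then have "\<sigma> \<in> Sh ns" using perm by (simp add: Sh_def)
    then show "Ls \<in> ?B ` Sh ns" using B by blast
  qed
qed

text \<open>Positive sizes make \<open>sum_list (take (Suc i) ns) - 1\<close> the last position of
  block \<open>i\<close>, so that the last entry of the block is the value of
  \<open>\<sigma>\<close> compared in \<open>ordered_Sh\<close>; for an empty block this position
  would not belong to it.\<close>

lemma bij_betw_ordered_Sh:
  assumes pos: "\<forall>n\<in>set ns. 1 \<le> n"
  shows "bij_betw (\<lambda>\<sigma>. blocks ns (map \<sigma> [0..<sum_list ns])) (ordered_Sh ns)
    {Ls \<in> ordered_block_lists (sum_list ns) (length ns). map length Ls = ns}"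
  (is "bij_betw ?B _ ?S")
proof -
  have iff: "\<sigma> \<in> ordered_Sh ns \<longleftrightarrow> ?B \<sigma> \<in> ?S" if s: "\<sigma> \<in> Sh ns" for \<sigma>
  proof -
    have B: "?B \<sigma> \<in> block_lists (sum_list ns) (length ns)" "map length (?B \<sigma>) = ns"
      using bij_betw_apply[OF bij_betw_Sh s] by auto
    have ne: "[] \<notin> set (?B \<sigma>)"
    proof
      assume "[] \<in> set (?B \<sigma>)"
      then have "0 \<in> set (map length (?B \<sigma>))" by force
      then show False using pos B(2) by force
    qed
    have "last (?B \<sigma> ! i) = \<sigma> (sum_list (take (Suc i) ns) - 1)" if "i < length ns" for i
    proof -
      have "ns ! i \<ge> 1" using pos that by simp
      then show ?thesis unfolding blocks_upt_nth[OF that]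
        using sum_list_take_Suc[OF that] by (simp add: last_map)
    qed
    then have "sorted_wrt (<) (map last (?B \<sigma>)) \<longleftrightarrow> (\<forall>i j. i < j \<and> j < length ns \<longrightarrow>
        \<sigma> (sum_list (take (Suc i) ns) - 1) < \<sigma> (sum_list (take (Suc j) ns) - 1))"
      by (auto simp: sorted_wrt_iff_nth_less)
    then show ?thesis using s B ne by (auto simp: ordered_Sh_def ordered_block_lists_def)
  qed
  have "ordered_Sh ns \<subseteq> Sh ns" unfolding ordered_Sh_def by auto
  then have "bij_betw ?B (ordered_Sh ns) (?B ` ordered_Sh ns)"
    using bij_betw_Sh[of ns] by (meson bij_betw_imp_inj_on bij_betw_imageI inj_on_subset)
  moreover have "?B ` ordered_Sh ns = ?S"
  proof (intro equalityI subsetI)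
    fix Ls assume Ls: "Ls \<in> ?S"
    then have "Ls \<in> ?B ` Sh ns"
      using bij_betw_imp_surj_on[OF bij_betw_Sh[of ns]] by (auto simp: ordered_block_lists_def)
    then show "Ls \<in> ?B ` ordered_Sh ns" using iff Ls by blast
  qed (use iff \<open>ordered_Sh ns \<subseteq> Sh ns\<close> in blast)
  ultimately show ?thesis by simp
qed

text \<open>The effect of one more letter in front of the word: old positions move up by one and the
  new position 0 heads block \<open>j\<close>. Prepending keeps the block sorted because 0 is the
  smallest position.\<close>

definition insert_0 :: "nat \<Rightarrow> nat list list \<Rightarrow> nat list list" where
  "insert_0 j Ls = (map (map Suc) Ls)[j := 0 # map Suc (Ls ! j)]"

lemma length_insert_0 [simp]: "length (insert_0 j Ls) = length Ls"
  by (simp add: insert_0_def)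

lemma nth_insert_0:
  "i < length Ls \<Longrightarrow> insert_0 j Ls ! i = (if i = j then 0 # map Suc (Ls ! i) else map Suc (Ls ! i))"
  by (simp add: insert_0_def)

lemma mset_concat_update:
  assumes "j < length Ls" "Ls ! j = x # K"
  shows "mset (concat Ls) = add_mset x (mset (concat (Ls[j := K])))"
proof -
  have "Ls = take j Ls @ (x # K) # drop (Suc j) Ls" using id_take_nth_drop[OF assms(1)] assms(2) by simp
  then have "mset (concat Ls) = mset (concat (take j Ls @ (x # K) # drop (Suc j) Ls))" by simp
  moreover have "Ls[j := K] = take j Ls @ K # drop (Suc j) Ls" using upd_conv_take_nth_drop[OF assms(1)] .
  ultimately show ?thesis by simp
qed

lemma mset_upt_Suc: "mset [0..<Suc n] = add_mset 0 (image_mset Suc (mset [0..<n]))"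
  by (simp only: upt_conv_Cons[OF zero_less_Suc] mset.simps map_Suc_upt[symmetric] mset_map)

lemma insert_0_in_block_lists:
  assumes "Ls \<in> block_lists n m" "j < m"
  shows "insert_0 j Ls \<in> block_lists (Suc n) m"
proof -
  have len: "length Ls = m" and sorted: "\<And>i. i < m \<Longrightarrow> sorted_wrt (<) (Ls ! i)"
    and ms: "mset (concat Ls) = mset [0..<n]" using assms by (auto simp: block_lists_def)
  have "(insert_0 j Ls)[j := map Suc (Ls ! j)] = map (map Suc) Ls"
    unfolding insert_0_def using len assms by (simp add: list_update_same_conv)
  then have "mset (concat (insert_0 j Ls)) = add_mset 0 (mset (concat (map (map Suc) Ls)))"
    using mset_concat_update[of j "insert_0 j Ls" 0 "map Suc (Ls ! j)"] len assms by (simp add: nth_insert_0)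
  also have "\<dots> = mset [0..<Suc n]"
    unfolding mset_upt_Suc ms[symmetric] by (simp add: map_concat[symmetric])
  finally have 1: "mset (concat (insert_0 j Ls)) = mset [0..<Suc n]" .
  have "sorted_wrt (<) (insert_0 j Ls ! i)" if "i < m" for i
    using sorted[OF that] that len by (auto simp: nth_insert_0 sorted_wrt_map)
  then have "\<forall>L\<in>set (insert_0 j Ls). sorted_wrt (<) L" using len by (metis in_set_conv_nth length_insert_0)
  then show ?thesis using 1 len by (simp add: block_lists_def)
qed

text \<open>In a sorted block the position 0 can only come first. Deleting it and lowering all other
  positions inverts \<open>insert_0\<close>.\<close>

lemma block_lists_Suc: "block_lists (Suc n) m = (\<lambda>(j, Ls). insert_0 j Ls) ` ({..<m} \<times> block_lists n m)"
proof (intro equalityI subsetI)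
  fix Ls assume Ls: "Ls \<in> block_lists (Suc n) m"
  then have len: "length Ls = m" and sorted: "\<And>i. i < m \<Longrightarrow> sorted_wrt (<) (Ls ! i)"
    and ms: "mset (concat Ls) = mset [0..<Suc n]" by (auto simp: block_lists_def)
  have "0 \<in> set (concat Ls)" unfolding mset_eq_setD[OF ms] by auto
  then obtain L where "L \<in> set Ls" "0 \<in> set L" by auto
  then obtain j where j: "j < m" "0 \<in> set (Ls ! j)" using len by (metis in_set_conv_nth)
  then obtain K where K: "Ls ! j = 0 # K" using sorted[OF j(1)] by (cases "Ls ! j") auto
  define Ms where "Ms = Ls[j := K]"
  have "add_mset 0 (mset (concat Ms)) = add_mset 0 (image_mset Suc (mset [0..<n]))"
    using mset_concat_update[of j Ls 0 K] j K len ms unfolding Ms_def mset_upt_Suc by simp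
  then have ms': "mset (concat Ms) = image_mset Suc (mset [0..<n])" by simp
  have pos: "x > 0" if "M \<in> set Ms" "x \<in> set M" for M x
  proof -
    have "x \<in># mset (concat Ms)" using that by auto
    then show ?thesis unfolding ms' by auto
  qed
  define Ls' where "Ls' = map (map (\<lambda>x. x - 1)) Ms"
  have Ms: "map (map Suc) Ls' = Ms"
    unfolding Ls'_def map_map o_def using pos by (intro map_idI) auto
  have "image_mset Suc (mset (concat Ls')) = image_mset Suc (mset [0..<n])"
    using ms' unfolding Ms[symmetric] by (simp add: map_concat[symmetric])
  then have "mset (concat Ls') = mset [0..<n]" by (rule injD[OF multiset.inj_map[OF inj_Suc]])
  moreover have "sorted_wrt (<) (Ls' ! i)" if "i < m" for i
  proof -
    have "sorted_wrt (<) (Ms ! i)" using sorted[OF that] sorted[OF j(1)] K that len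
      by (cases "i = j") (auto simp: Ms_def)
    then have "sorted_wrt (<) (map Suc (Ls' ! i))" using Ms that len by (metis Ls'_def Ms_def length_list_update length_map nth_map)
    then show ?thesis by (simp add: sorted_wrt_map)
  qed
  ultimately have "Ls' \<in> block_lists n m"
    using len by (auto simp: block_lists_def Ls'_def Ms_def in_set_conv_nth)
  moreover have "insert_0 j Ls' = Ls"
  proof -
    have "map Suc (Ls' ! j) = K" using Ms j len by (metis Ls'_def Ms_def length_list_update length_map nth_list_update_eq nth_map)
    then show ?thesis unfolding insert_0_def Ms unfolding Ms_def using K by (metis list_update_id list_update_overwrite)
  qed
  ultimately show "Ls \<in> (\<lambda>(j, Ls). insert_0 j Ls) ` ({..<m} \<times> block_lists n m)"
    using j(1) by (force simp: image_iff)
qed (auto intro: insert_0_in_block_lists)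

text \<open>The index \<open>j\<close> is recovered as that of the only block beginning with 0, all
  other entries being successors.\<close>

lemma inj_on_insert_0: "inj_on (\<lambda>(j, Ls). insert_0 j Ls) ({..<m} \<times> {Ls. length Ls = m})"
proof (rule inj_onI, clarify)
  fix j i Ls Ks assume ij: "i < length Ls" "j < length Ls" and len: "length (Ks :: nat list list) = length Ls"
    and eq: "insert_0 j Ls = insert_0 i Ks"
  have nth: "insert_0 j Ls ! k = insert_0 i Ks ! k" for k using eq by simp
  have "j = i" using nth[of j] ij len by (auto simp: nth_insert_0 split: if_splits)
  have "Ls ! k = Ks ! k" if "k < length Ls" for k
  proof -
    have "map Suc (Ls ! k) = map Suc (Ks ! k)"
      using nth[of k] that len \<open>j = i\<close> by (cases "k = i") (simp_all add: nth_insert_0)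
    then show ?thesis by (simp add: inj_map_eq_map)
  qed
  then show "j = i \<and> Ls = Ks" using len \<open>j = i\<close> by (auto simp: list_eq_iff_nth_eq)
qed

lemma block_lists_0: "block_lists 0 m = {replicate m []}"
proof -
  have "Ls = replicate m []" if "length Ls = m" "\<forall>L\<in>set Ls. L = []" for Ls :: "nat list list"
    using that by (simp add: replicate_eqI)
  then show ?thesis by (auto simp: block_lists_def)
qed

lemma finite_block_lists [simp]: "finite (block_lists n m)"
  by (induction n) (auto simp: block_lists_0 block_lists_Suc)

lemma finite_ordered_block_lists [simp]: "finite (ordered_block_lists n m)"
  unfolding ordered_block_lists_def by simp

lemma block_lists_length: "Ls \<in> block_lists n m \<Longrightarrow> length Ls = m"
  by (simp add: block_lists_def)

lemma ordered_block_lists_iff: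
  "Ls \<in> ordered_block_lists n m \<longleftrightarrow> Ls \<in> block_lists n m \<and>
    (\<forall>i<m. Ls ! i \<noteq> []) \<and> (\<forall>i k. i < k \<and> k < m \<longrightarrow> last (Ls ! i) < last (Ls ! k))"
proof -
  have "[] \<in> set Ls \<longleftrightarrow> (\<exists>i<length Ls. Ls ! i = [])" by (simp add: in_set_conv_nth)
  then show ?thesis
    unfolding ordered_block_lists_def by (auto simp: sorted_wrt_iff_nth_less block_lists_length)
qed

lemma sum_block_lists_Suc:
  "(\<Sum>Ls\<in>block_lists (Suc n) m. f Ls) = (\<Sum>Ls\<in>block_lists n m. \<Sum>j<m. f (insert_0 j Ls))"
proof -
  have "inj_on (\<lambda>(j, Ls). insert_0 j Ls) ({..<m} \<times> block_lists n m)"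
    by (rule inj_on_subset[OF inj_on_insert_0]) (auto simp: block_lists_length)
  then have "(\<Sum>Ls\<in>block_lists (Suc n) m. f Ls) = (\<Sum>j<m. \<Sum>Ls\<in>block_lists n m. f (insert_0 j Ls))"
    unfolding block_lists_Suc by (simp add: sum.reindex sum.cartesian_product case_prod_unfold o_def)
  then show ?thesis by (simp add: sum.swap[of _ "{..<m}"])
qed

text \<open>In front of a nonempty block the new 0 changes no comparison of last entries. In an
  empty block it becomes the last entry, smaller than all others, so that this block has to be the
  first one and the others an ordered list by themselves.\<close>

lemma insert_0_ordered_iff:
  assumes Ls: "Ls \<in> block_lists n m" and j: "j < m"
  shows "insert_0 j Ls \<in> ordered_block_lists (Suc n) m \<longleftrightarrow>
    Ls \<in> ordered_block_lists n m \<or> j = 0 \<and> (\<exists>Ks \<in> ordered_block_lists n (m - 1). Ls = [] # Ks)"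
proof -
  have len: "length Ls = m" using Ls by (rule block_lists_length)
  have ord: "insert_0 j Ls \<in> ordered_block_lists (Suc n) m \<longleftrightarrow>
      (\<forall>i<m. insert_0 j Ls ! i \<noteq> []) \<and> (\<forall>i k. i < k \<and> k < m \<longrightarrow> last (insert_0 j Ls ! i) < last (insert_0 j Ls ! k))"
    using insert_0_in_block_lists[OF Ls j] ordered_block_lists_iff len by simp
  have ord': "Ls \<in> ordered_block_lists n m \<longleftrightarrow>
      (\<forall>i<m. Ls ! i \<noteq> []) \<and> (\<forall>i k. i < k \<and> k < m \<longrightarrow> last (Ls ! i) < last (Ls ! k))"
    using Ls ordered_block_lists_iff len by simp
  have last: "last (insert_0 j Ls ! i) = (if Ls ! i = [] then 0 else Suc (last (Ls ! i)))"
    if "i < m" "Ls ! i \<noteq> [] \<or> i = j" for i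
    using that len nth_insert_0[of i Ls j] by (cases "Ls ! i = []") (auto simp: last_map)
  show ?thesis
  proof (cases "Ls ! j = []")
    case False
    have "insert_0 j Ls \<in> ordered_block_lists (Suc n) m \<longleftrightarrow> Ls \<in> ordered_block_lists n m"
    proof (cases "\<forall>i<m. Ls ! i \<noteq> []")
      case True
      then show ?thesis unfolding ord ord' using last len by (auto simp: nth_insert_0)
    next
      case nonempty: False
      then obtain i where "i < m" "Ls ! i = []" by blast
      then show ?thesis unfolding ord ord' using False len by (auto simp: nth_insert_0)
    qed
    moreover have "Ls \<noteq> [] # Ks" if "j = 0" for Ks using False that by auto
    ultimately show ?thesis by blast
  next
    case True
    have not: "Ls \<notin> ordered_block_lists n m" unfolding ord' using True j by blast
    have "insert_0 j Ls \<in> ordered_block_lists (Suc n) m \<longleftrightarrow>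
        j = 0 \<and> (\<exists>Ks \<in> ordered_block_lists n (m - 1). Ls = [] # Ks)"
    proof
      assume "insert_0 j Ls \<in> ordered_block_lists (Suc n) m"
      then have ne: "\<And>i. i < m \<Longrightarrow> insert_0 j Ls ! i \<noteq> []"
        and srt: "\<And>i k. i < k \<Longrightarrow> k < m \<Longrightarrow> last (insert_0 j Ls ! i) < last (insert_0 j Ls ! k)"
        using ord by auto
      have "j = 0"
      proof (rule ccontr)
        assume "j \<noteq> 0"
        then show False using srt[of 0 j] last[OF j] True j by simp
      qed
      obtain Ks where Ks: "Ls = [] # Ks" using True \<open>j = 0\<close> j len by (cases Ls) auto
      have Ks_bl: "Ks \<in> block_lists n (m - 1)" using Ls Ks by (auto simp: block_lists_def)
      have lenK: "length Ks = m - 1" using Ks len by simp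
      have neK: "Ks ! i \<noteq> []" if "i < m - 1" for i
        using ne[of "Suc i"] that len Ks \<open>j = 0\<close> by (auto simp: nth_insert_0)
      have "last (Ks ! i) < last (Ks ! k)" if "i < k" "k < m - 1" for i k
        using srt[of "Suc i" "Suc k"] that last[of "Suc i"] last[of "Suc k"] neK Ks by auto
      then have "Ks \<in> ordered_block_lists n (m - 1)"
        using Ks_bl neK by (simp add: ordered_block_lists_iff)
      then show "j = 0 \<and> (\<exists>Ks \<in> ordered_block_lists n (m - 1). Ls = [] # Ks)"
        using \<open>j = 0\<close> Ks by blast
    next
      assume "j = 0 \<and> (\<exists>Ks \<in> ordered_block_lists n (m - 1). Ls = [] # Ks)"
      then obtain Ks where "j = 0" and Ks: "Ks \<in> ordered_block_lists n (m - 1)" "Ls = [] # Ks" by blast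
      have lenK: "length Ks = m - 1" using Ks len by simp
      have neK: "Ks ! i \<noteq> []" if "i < m - 1" for i
        using Ks(1) that lenK by (auto simp: ordered_block_lists_def in_set_conv_nth)
      have srtK: "last (Ks ! i) < last (Ks ! k)" if "i < k" "k < m - 1" for i k
        using Ks(1) that lenK by (auto simp: ordered_block_lists_def sorted_wrt_iff_nth_less)
      show "insert_0 j Ls \<in> ordered_block_lists (Suc n) m"
        unfolding ord
      proof (intro conjI allI impI)
        fix i assume "i < m"
        then show "insert_0 j Ls ! i \<noteq> []"
          using \<open>j = 0\<close> Ks(2) len neK by (cases i) (auto simp: nth_insert_0)
      next
        fix i k assume ik: "i < k \<and> k < m"
        then obtain k' where k': "k = Suc k'" by (cases k) auto
        show "last (insert_0 j Ls ! i) < last (insert_0 j Ls ! k)"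
          using ik k' last[of i] last[of k] neK[of k'] srtK[of _ k'] neK[of "i - 1"] Ks(2) \<open>j = 0\<close>
          by (cases i) auto
      qed
    qed
    then show ?thesis using not by blast
  qed
qed

text \<open>The combinatorial form of Leibniz' rule: the first letter either joins an existing
  block, which is then differentiated once more, or forms a new first block of its own.\<close>

lemma sum_ordered_block_lists_Suc:
  "(\<Sum>Ls\<in>ordered_block_lists (Suc n) m. f Ls) = (\<Sum>Ls\<in>ordered_block_lists n m. \<Sum>j<m. f (insert_0 j Ls))
    + (if m = 0 then 0 else \<Sum>Ks\<in>ordered_block_lists n (m - 1). f ([0] # map (map Suc) Ks))"
proof -
  define A where "A = {..<m} \<times> ordered_block_lists n m"
  \<comment> \<open>For \<open>m = 0\<close> no block can be opened, while \<open>m - 1\<close>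
    would be truncated to 0 and give a spurious term.\<close>
  define B where "B = (if m = 0 then {} else (\<lambda>Ks. (0 :: nat, [] # Ks)) ` ordered_block_lists n (m - 1))"
  have sub: "A \<union> B \<subseteq> {..<m} \<times> block_lists n m"
    unfolding A_def B_def by (auto simp: ordered_block_lists_def block_lists_def)
  have eq: "ordered_block_lists (Suc n) m = (\<lambda>(j, Ls). insert_0 j Ls) ` (A \<union> B)"
  proof (intro equalityI subsetI)
    fix Ms assume Ms: "Ms \<in> ordered_block_lists (Suc n) m"
    then obtain j Ls where jL: "j < m" "Ls \<in> block_lists n m" "Ms = insert_0 j Ls"
      unfolding ordered_block_lists_def block_lists_Suc by auto
    then have "(j, Ls) \<in> A \<union> B"
      using insert_0_ordered_iff[OF jL(2,1)] Ms unfolding A_def B_def by auto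
    then show "Ms \<in> (\<lambda>(j, Ls). insert_0 j Ls) ` (A \<union> B)" using jL(3) by force
  next
    fix Ms assume "Ms \<in> (\<lambda>(j, Ls). insert_0 j Ls) ` (A \<union> B)"
    then obtain j Ls where jL: "(j, Ls) \<in> A \<union> B" "Ms = insert_0 j Ls" by auto
    then have "j < m" "Ls \<in> block_lists n m" using sub by auto
    then show "Ms \<in> ordered_block_lists (Suc n) m"
      using insert_0_ordered_iff[of Ls n m j] jL unfolding A_def B_def by (auto split: if_splits)
  qed
  have inj: "inj_on (\<lambda>(j, Ls). insert_0 j Ls) (A \<union> B)"
    by (rule inj_on_subset[OF inj_on_insert_0]) (use sub in \<open>auto simp: block_lists_def\<close>)
  have disj: "A \<inter> B = {}" unfolding A_def B_def by (auto simp: ordered_block_lists_def)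
  have fin: "finite A" "finite B" unfolding A_def B_def by auto
  have "(\<Sum>Ls\<in>ordered_block_lists (Suc n) m. f Ls)
      = (\<Sum>(j, Ls)\<in>A. f (insert_0 j Ls)) + (\<Sum>(j, Ls)\<in>B. f (insert_0 j Ls))"
    unfolding eq using inj disj fin by (simp add: sum.reindex sum.union_disjoint case_prod_unfold o_def)
  also have "(\<Sum>(j, Ls)\<in>A. f (insert_0 j Ls)) = (\<Sum>Ls\<in>ordered_block_lists n m. \<Sum>j<m. f (insert_0 j Ls))"
    unfolding A_def sum.cartesian_product[symmetric] by (rule sum.swap)
  also have "(\<Sum>(j, Ls)\<in>B. f (insert_0 j Ls))
      = (if m = 0 then 0 else \<Sum>Ks\<in>ordered_block_lists n (m - 1). f ([0] # map (map Suc) Ks))"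
    unfolding B_def by (auto simp: sum.reindex inj_on_def insert_0_def)
  finally show ?thesis .
qed

section \<open>Coproducts as sums over lists of blocks\<close>

lemma permute_list_eq_map: "permute_list \<sigma> v = map ((!) v) (map \<sigma> [0..<length v])"
  by (simp add: permute_list_def)

lemma sum_Sh_eq:
  assumes "length v = sum_list ns"
  shows "(\<Sum>\<sigma>\<in>Sh ns. f (blocks ns (permute_list \<sigma> v)))
    = (\<Sum>Ls | Ls \<in> block_lists (length v) (length ns) \<and> map length Ls = ns. f (map (map ((!) v)) Ls))"
  unfolding permute_list_eq_map blocks_map[of _ "(!) v"] assms
  by (rule sum.reindex_bij_betw[OF bij_betw_Sh])

lemma sum_ordered_Sh_eq:
  assumes "length v = sum_list ns" "\<forall>n\<in>set ns. 1 \<le> n"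
  shows "(\<Sum>\<sigma>\<in>ordered_Sh ns. f (blocks ns (permute_list \<sigma> v)))
    = (\<Sum>Ls | Ls \<in> ordered_block_lists (length v) (length ns) \<and> map length Ls = ns. f (map (map ((!) v)) Ls))"
  unfolding permute_list_eq_map blocks_map[of _ "(!) v"] assms(1)
  by (rule sum.reindex_bij_betw[OF bij_betw_ordered_Sh[OF assms(2)]])

lemma finite_degree_lists: "finite (degree_lists m n)"
proof (rule finite_subset)
  show "degree_lists m n \<subseteq> {ns. set ns \<subseteq> {..n} \<and> length ns = m}"
    unfolding degree_lists_def using member_le_sum_list order_trans by fastforce
qed (simp add: finite_lists_length_eq)

lemma finite_listset: "(\<forall>A\<in>set As. finite A) \<Longrightarrow> finite (listset As)"
proof (induction As)
  case (Cons A As)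
  have "set_Cons A (listset As) = (\<lambda>(x, xs). x # xs) ` (A \<times> listset As)" by (auto simp: set_Cons_def)
  then show ?case using Cons by simp
qed simp

lemma blocks_in_listset: "xs \<in> words (sum_list ns) \<Longrightarrow> blocks ns xs \<in> listset (map words ns)"
proof (induction ns arbitrary: xs)
  case (Cons n ns)
  then have "take n xs \<in> words n" "drop n xs \<in> words (sum_list ns)"
    by (auto simp: in_words_iff dest: in_set_takeD in_set_dropD)
  then show ?case using Cons.IH by (auto simp: set_Cons_def)
qed simp

lemma box_pairing_Delta_osh:
  fixes x :: "'v::euclidean_space tensor"
  assumes "\<forall>n\<in>set ns. 1 \<le> n"
  shows "box_pairing ns h (Delta_osh ns x) u = (\<Sum>v\<in>words (sum_list ns). x v *
    (\<Sum>Ls | Ls \<in> ordered_block_lists (length v) (length ns) \<and> map length Ls = ns.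
      \<Prod>i<length ns. h (map ((!) v) (Ls ! i)) \<bullet> u ! i))"
proof -
  define P where "P ws = (\<Prod>i<length ns. h (ws ! i) \<bullet> u ! i)" for ws
  have fin: "finite (listset (map words ns :: 'v list set list))" by (intro finite_listset) auto
  have "box_pairing ns h (Delta_osh ns x) u = (\<Sum>ws\<in>listset (map words ns). \<Sum>v\<in>words (sum_list ns).
      x v * (\<Sum>\<sigma>\<in>ordered_Sh ns. (if blocks ns (permute_list \<sigma> v) = ws then 1 else 0) * P ws))"
    unfolding box_pairing_def Delta_osh_def coproduct_def P_def
    by (simp add: sum_distrib_right sum_distrib_left mult.assoc)
  also have "\<dots> = (\<Sum>v\<in>words (sum_list ns). x v * (\<Sum>\<sigma>\<in>ordered_Sh ns. \<Sum>ws\<in>listset (map words ns).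
      (if blocks ns (permute_list \<sigma> v) = ws then 1 else 0) * P ws))"
    by (subst sum.swap, subst sum.swap[of _ _ "ordered_Sh ns"]) (simp add: sum_distrib_left)
  also have "\<dots> = (\<Sum>v\<in>words (sum_list ns). x v * (\<Sum>\<sigma>\<in>ordered_Sh ns. P (blocks ns (permute_list \<sigma> v))))"
  proof (intro sum.cong refl arg_cong2[of _ _ _ _ "(*)"])
    fix v :: "'v list" and \<sigma> assume v: "v \<in> words (sum_list ns)" and s: "\<sigma> \<in> ordered_Sh ns"
    then have "\<sigma> permutes {..<length v}" by (simp add: ordered_Sh_def Sh_def in_words_iff)
    then have "permute_list \<sigma> v \<in> words (sum_list ns)" using v by (simp add: in_words_iff)
    from blocks_in_listset[OF this]
    have mem: "blocks ns (permute_list \<sigma> v) \<in> listset (map words ns)" .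
    have "(\<Sum>ws\<in>listset (map words ns). (if blocks ns (permute_list \<sigma> v) = ws then 1 else 0) * P ws)
        = (\<Sum>ws\<in>listset (map words ns). if ws = blocks ns (permute_list \<sigma> v) then P ws else 0)"
      by (intro sum.cong) auto
    then show "(\<Sum>ws\<in>listset (map words ns). (if blocks ns (permute_list \<sigma> v) = ws then 1 else 0) * P ws)
        = P (blocks ns (permute_list \<sigma> v))" using mem fin by simp
  qed
  also have "\<dots> = (\<Sum>v\<in>words (sum_list ns). x v *
    (\<Sum>Ls | Ls \<in> ordered_block_lists (length v) (length ns) \<and> map length Ls = ns. P (map (map ((!) v)) Ls)))"
    by (intro sum.cong refl arg_cong2[of _ _ _ _ "(*)"] sum_ordered_Sh_eq assms) (auto simp: in_words_iff)
  also have "\<dots> = (\<Sum>v\<in>words (sum_list ns). x v *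
    (\<Sum>Ls | Ls \<in> ordered_block_lists (length v) (length ns) \<and> map length Ls = ns.
      \<Prod>i<length ns. h (map ((!) v) (Ls ! i)) \<bullet> u ! i))"
    unfolding P_def
    by (intro sum.cong refl arg_cong2[of _ _ _ _ "(*)"] prod.cong) (auto simp: ordered_block_lists_def block_lists_def)
  finally show ?thesis .
qed

text \<open>Summing over all size vectors \<open>ns\<close> removes the constraint on the block
  sizes: every ordered list of blocks of positions of \<open>v\<close> has exactly one size vector,
  admissible because the blocks are nonempty and their sizes add up to the length of
  \<open>v\<close>.\<close>

lemma sum_box_pairing_Delta_osh:
  fixes x :: "'v::euclidean_space tensor"
  shows "(\<Sum>ns\<in>degree_lists m n. box_pairing ns h (Delta_osh ns x) u) = (\<Sum>v\<in>words_upto n. x v *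
    (\<Sum>Ls\<in>ordered_block_lists (length v) m. \<Prod>i<m. h (map ((!) v) (Ls ! i)) \<bullet> u ! i))"
proof -
  define P where "P v Ls = (\<Prod>i<m. h (map ((!) v) (Ls ! i)) \<bullet> u ! i)" for v Ls
  define Q where "Q ns v = {Ls. Ls \<in> ordered_block_lists (length v) m \<and> map length Ls = ns}"
    for ns and v :: "'v list"
  have sum_len: "sum_list (map length Ls) = length v" if "Ls \<in> ordered_block_lists (length v) m"
    for Ls and v :: "'v list"
  proof -
    have "length (concat Ls) = length [0..<length v]"
      using that by (intro mset_eq_length) (auto simp: ordered_block_lists_def block_lists_def)
    then show ?thesis by (simp add: length_concat)
  qed
  have "(\<Sum>ns\<in>degree_lists m n. box_pairing ns h (Delta_osh ns x) u)
      = (\<Sum>ns\<in>degree_lists m n. \<Sum>v\<in>words (sum_list ns). x v * sum (P v) (Q ns v))"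
    unfolding P_def Q_def by (intro sum.cong refl) (auto simp: box_pairing_Delta_osh degree_lists_def)
  also have "\<dots> = (\<Sum>ns\<in>degree_lists m n. \<Sum>v\<in>words_upto n. x v * sum (P v) (Q ns v))"
  proof (rule sum.cong[OF refl], rule sum.mono_neutral_left)
    fix ns assume "ns \<in> degree_lists m n"
    then show "words (sum_list ns) \<subseteq> words_upto n" by (auto simp: degree_lists_def words_upto_def)
    show "\<forall>v\<in>words_upto n - words (sum_list ns). x v * sum (P v) (Q ns v) = 0"
    proof
      fix v :: "'v list" assume "v \<in> words_upto n - words (sum_list ns)"
      then have "length v \<noteq> sum_list ns" by (auto simp: words_upto_def in_words_iff)
      then have "Q ns v = {}" unfolding Q_def using sum_len by force
      then show "x v * sum (P v) (Q ns v) = 0" by simp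
    qed
  qed simp
  also have "\<dots> = (\<Sum>v\<in>words_upto n. x v * (\<Sum>ns\<in>degree_lists m n. sum (P v) (Q ns v)))"
    by (subst sum.swap) (simp add: sum_distrib_left)
  also have "\<dots> = (\<Sum>v\<in>words_upto n. x v * sum (P v) (ordered_block_lists (length v) m))"
  proof (intro sum.cong refl arg_cong2[of _ _ _ _ "(*)"])
    fix v :: "'v list" assume v: "v \<in> words_upto n"
    have "sum (P v) (ordered_block_lists (length v) m)
        = (\<Sum>ns\<in>degree_lists m n. sum (P v) {Ls \<in> ordered_block_lists (length v) m. map length Ls = ns})"
    proof (rule sum.group[symmetric])
      show "map length ` ordered_block_lists (length v) m \<subseteq> degree_lists m n"
      proof (rule image_subsetI)
        fix Ls assume Ls: "Ls \<in> ordered_block_lists (length v) m"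
        have "1 \<le> length L" if "L \<in> set Ls" for L
          using Ls that by (cases L) (auto simp: ordered_block_lists_def)
        then show "map length Ls \<in> degree_lists m n"
          using Ls sum_len[OF Ls] v
          by (auto simp: degree_lists_def ordered_block_lists_def block_lists_def words_upto_def in_words_iff)
      qed
    qed (auto simp: finite_degree_lists)
    then show "(\<Sum>ns\<in>degree_lists m n. sum (P v) (Q ns v)) = sum (P v) (ordered_block_lists (length v) m)"
      unfolding Q_def by simp
  qed
  finally show ?thesis unfolding P_def .
qed

section \<open>Sums over shuffles\<close>

text \<open>The unshuffle coproduct of the word \<open>z\<close> paired with \<open>\<phi>\<close>
  and \<open>\<psi>\<close>: a sum over all splittings of \<open>z\<close> into a subword and its
  complement, organised by the side to which the first letter goes.\<close>

primrec unshuffle_sum :: "'a list \<Rightarrow> ('a list \<Rightarrow> real) \<Rightarrow> ('a list \<Rightarrow> real) \<Rightarrow> real" where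
  "unshuffle_sum [] \<phi> \<psi> = \<phi> [] * \<psi> []"
| "unshuffle_sum (a # z) \<phi> \<psi> = unshuffle_sum z (\<lambda>v. \<phi> (a # v)) \<psi> + unshuffle_sum z \<phi> (\<lambda>w. \<psi> (a # w))"

text \<open>The functional \<open>x\<close> evaluated at the shuffle product of \<open>v\<close> and
  \<open>w\<close>, organised by the word that supplies the first letter.\<close>

fun shuffle_sum :: "('a list \<Rightarrow> real) \<Rightarrow> 'a list \<Rightarrow> 'a list \<Rightarrow> real" where
  "shuffle_sum x [] w = x w"
| "shuffle_sum x (a # v) [] = x (a # v)"
| "shuffle_sum x (a # v) (b # w) = shuffle_sum (\<lambda>z. x (a # z)) v (b # w) + shuffle_sum (\<lambda>z. x (b # z)) (a # v) w"

lemma unshuffle_sum_eq_block_lists: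
  "unshuffle_sum z \<phi> \<psi> = (\<Sum>Ls\<in>block_lists (length z) 2. \<phi> (map ((!) z) (Ls ! 0)) * \<psi> (map ((!) z) (Ls ! 1)))"
proof (induction z arbitrary: \<phi> \<psi>)
  case Nil
  then show ?case by (simp add: block_lists_0 numeral_2_eq_2)
next
  case (Cons a z)
  have "map ((!) (a # z)) (map Suc L) = map ((!) z) L" for L by simp
  then show ?case
    unfolding unshuffle_sum.simps Cons.IH
    by (simp add: sum_block_lists_Suc sum.distrib[symmetric] numeral_2_eq_2 nth_insert_0 block_lists_length o_def)
qed

lemma unshuffle_sum_cong:
  assumes "\<And>v. set v \<subseteq> set z \<Longrightarrow> length v \<le> length z \<Longrightarrow> \<phi> v = \<phi>' v"
    and "\<And>v. set v \<subseteq> set z \<Longrightarrow> length v \<le> length z \<Longrightarrow> \<psi> v = \<psi>' v"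
  shows "unshuffle_sum z \<phi> \<psi> = unshuffle_sum z \<phi>' \<psi>'"
  using assms
proof (induction z arbitrary: \<phi> \<psi> \<phi>' \<psi>')
  case (Cons a z)
  have "unshuffle_sum z (\<lambda>v. \<phi> (a # v)) \<psi> = unshuffle_sum z (\<lambda>v. \<phi>' (a # v)) \<psi>'"
    by (rule Cons.IH) (auto intro!: Cons.prems)
  moreover have "unshuffle_sum z \<phi> (\<lambda>v. \<psi> (a # v)) = unshuffle_sum z \<phi>' (\<lambda>v. \<psi>' (a # v))"
    by (rule Cons.IH) (auto intro!: Cons.prems)
  ultimately show ?case by simp
qed simp

lemma unshuffle_sum_0: "unshuffle_sum z (\<lambda>v. 0) \<psi> = 0" "unshuffle_sum z \<phi> (\<lambda>v. 0) = 0"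
  by (induction z arbitrary: \<phi> \<psi>) auto

lemma unshuffle_sum_add:
  "unshuffle_sum z (\<lambda>v. \<phi> v + \<phi>' v) \<psi> = unshuffle_sum z \<phi> \<psi> + unshuffle_sum z \<phi>' \<psi>"
  "unshuffle_sum z \<phi> (\<lambda>v. \<psi> v + \<psi>' v) = unshuffle_sum z \<phi> \<psi> + unshuffle_sum z \<phi> \<psi>'"
  by (induction z arbitrary: \<phi> \<phi>' \<psi> \<psi>') (auto simp: algebra_simps)

lemma unshuffle_sum_scale:
  "unshuffle_sum z (\<lambda>v. c * \<phi> v) \<psi> = c * unshuffle_sum z \<phi> \<psi>"
  "unshuffle_sum z \<phi> (\<lambda>v. c * \<psi> v) = c * unshuffle_sum z \<phi> \<psi>"
  by (induction z arbitrary: \<phi> \<psi>) (auto simp: algebra_simps)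

lemma unshuffle_sum_sum:
  "unshuffle_sum z (\<lambda>v. \<Sum>i\<in>I. \<phi> i v) \<psi> = (\<Sum>i\<in>I. unshuffle_sum z (\<phi> i) \<psi>)"
  "unshuffle_sum z \<psi> (\<lambda>v. \<Sum>i\<in>I. \<phi> i v) = (\<Sum>i\<in>I. unshuffle_sum z \<psi> (\<phi> i))"
  by (induction I rule: infinite_finite_induct) (auto simp: unshuffle_sum_0 unshuffle_sum_add)

abbreviation (input) is_word :: "'a list \<Rightarrow> 'a list \<Rightarrow> real" where
  "is_word v \<equiv> (\<lambda>w. if w = v then 1 else 0)"

lemma unshuffle_sum_Nil: "unshuffle_sum z (is_word []) \<psi> = \<psi> z" "unshuffle_sum z \<phi> (is_word []) = \<phi> z"
  by (induction z arbitrary: \<phi> \<psi>) (auto simp: unshuffle_sum_0)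

lemma unshuffle_sum_Cons_is_word:
  "unshuffle_sum (c # z) (is_word (a # v)) (is_word (b # w)) =
    (if c = a then unshuffle_sum z (is_word v) (is_word (b # w)) else 0)
    + (if c = b then unshuffle_sum z (is_word (a # v)) (is_word w) else 0)"
  by (auto simp: unshuffle_sum_0)

text \<open>Duality of shuffle product and unshuffle coproduct: the multiplicity of \<open>z\<close>
  in the shuffle of \<open>v\<close> and \<open>w\<close> is the number of ways to split
  \<open>z\<close> into them. Both sides obey the same first-letter recursion.\<close>

lemma shuffle_sum_eq_sum_words:
  assumes "set v \<subseteq> Basis" "set w \<subseteq> Basis"
  shows "shuffle_sum x v w = (\<Sum>z\<in>words (length v + length w). x z * unshuffle_sum z (is_word v) (is_word w))"
  using assms
proof (induction x v w rule: shuffle_sum.induct)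
  case (1 x w)
  have "(\<Sum>z\<in>words (length w). x z * (if z = w then 1 else 0)) = (\<Sum>z\<in>words (length w). if z = w then x z else 0)"
    by (intro sum.cong) auto
  then show ?case using 1 by (simp add: unshuffle_sum_Nil in_words_iff)
next
  case (2 x a v)
  have "(\<Sum>z\<in>words (length (a # v)). x z * (if z = a # v then 1 else 0))
      = (\<Sum>z\<in>words (length (a # v)). if z = a # v then x z else 0)"
    by (intro sum.cong) auto
  then show ?case using 2 by (simp add: unshuffle_sum_Nil in_words_iff)
next
  case (3 x a v b w)
  have pick: "(\<Sum>c\<in>Basis. \<Sum>z\<in>S. x (c # z) * (if c = e then f z else 0)) = (\<Sum>z\<in>S. x (e # z) * f z)"
    if "e \<in> Basis" for e S f
  proof -
    have "(\<Sum>c\<in>Basis. \<Sum>z\<in>S. x (c # z) * (if c = e then f z else 0))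
        = (\<Sum>c\<in>Basis. if c = e then \<Sum>z\<in>S. x (c # z) * f z else 0)"
      by (intro sum.cong refl) auto
    then show ?thesis using that by simp
  qed
  have "(\<Sum>z\<in>words (length (a # v) + length (b # w)). x z * unshuffle_sum z (is_word (a # v)) (is_word (b # w)))
    = (\<Sum>c\<in>Basis. \<Sum>z\<in>words (length v + length (b # w)).
        x (c # z) * (if c = a then unshuffle_sum z (is_word v) (is_word (b # w)) else 0))
      + (\<Sum>c\<in>Basis. \<Sum>z\<in>words (length v + length (b # w)).
        x (c # z) * (if c = b then unshuffle_sum z (is_word (a # v)) (is_word w) else 0))"
  proof -
    have len: "length (a # v) + length (b # w) = Suc (length v + length (b # w))" by simp
    show ?thesis
      unfolding len sum_words_Suc unshuffle_sum_Cons_is_word distrib_left sum.distrib ..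
  qed
  also have "\<dots> = shuffle_sum x (a # v) (b # w)"
    unfolding shuffle_sum.simps using 3 by (simp add: pick)
  finally show ?case ..
qed

lemma unshuffle_sum_eq_0_if_length:
  assumes "length v + length w \<noteq> length z"
  shows "unshuffle_sum z (is_word v) (is_word w) = 0"
  using assms
proof (induction z arbitrary: v w)
  case (Cons c z)
  have "unshuffle_sum z (\<lambda>r. if c # r = v then 1 else 0) (is_word w) = 0"
  proof (cases "v = [] \<or> hd v \<noteq> c")
    case True
    then have "(\<lambda>r. if c # r = v then 1 else 0 :: real) = (\<lambda>r. 0)" by (cases v) auto
    then show ?thesis by (simp only: unshuffle_sum_0)
  next
    case False
    then obtain v' where v': "v = c # v'" by (cases v) auto
    then show ?thesis using Cons.IH[of v' w] Cons.prems by simp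
  qed
  moreover have "unshuffle_sum z (is_word v) (\<lambda>r. if c # r = w then 1 else 0) = 0"
  proof (cases "w = [] \<or> hd w \<noteq> c")
    case True
    then have "(\<lambda>r. if c # r = w then 1 else 0 :: real) = (\<lambda>r. 0)" by (cases w) auto
    then show ?thesis by (simp only: unshuffle_sum_0)
  next
    case False
    then obtain w' where w': "w = c # w'" by (cases w) auto
    then show ?thesis using Cons.IH[of v w'] Cons.prems by simp
  qed
  ultimately show ?case by simp
qed auto

text \<open>That the blocks spell \<open>v\<close> and \<open>w\<close> already forces their sizes,
  so that the size constraint of \<open>Sh [m, n]\<close> drops out and the sum runs over all lists
  of two blocks.\<close>

lemma Delta_sh_eq_shuffle_sum:
  assumes v: "v \<in> words m" and w: "w \<in> words n"
  shows "Delta_sh m n x [v, w] = shuffle_sum x v w"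
proof -
  have "(\<Sum>\<sigma>\<in>Sh [m, n]. if blocks [m, n] (permute_list \<sigma> z) = [v, w] then 1 else 0)
      = unshuffle_sum z (is_word v) (is_word w)" if "z \<in> words (m + n)" for z
  proof -
    have "(\<Sum>\<sigma>\<in>Sh [m, n]. if blocks [m, n] (permute_list \<sigma> z) = [v, w] then 1 else 0 :: real)
        = (\<Sum>Ls | Ls \<in> block_lists (length z) 2 \<and> map length Ls = [m, n].
            if map (map ((!) z)) Ls = [v, w] then 1 else 0)"
      using sum_Sh_eq[of z "[m, n]" "\<lambda>ws. if ws = [v, w] then 1 else 0 :: real"] that
      by (simp add: in_words_iff numeral_2_eq_2)
    also have "\<dots> = (\<Sum>Ls\<in>block_lists (length z) 2. if map (map ((!) z)) Ls = [v, w] then 1 else 0)"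
    proof (rule sum.mono_neutral_left)
      show "\<forall>Ls\<in>block_lists (length z) 2 - {Ls \<in> block_lists (length z) 2. map length Ls = [m, n]}.
          (if map (map ((!) z)) Ls = [v, w] then 1 else 0 :: real) = 0"
      proof
        fix Ls assume Ls: "Ls \<in> block_lists (length z) 2 - {Ls \<in> block_lists (length z) 2. map length Ls = [m, n]}"
        have "map length Ls = [m, n]" if "map (map ((!) z)) Ls = [v, w]"
          using arg_cong[OF that, of "map length"] v w by (simp add: o_def in_words_iff)
        then show "(if map (map ((!) z)) Ls = [v, w] then 1 else 0 :: real) = 0" using Ls by auto
      qed
    qed auto
    also have "\<dots> = unshuffle_sum z (is_word v) (is_word w)"
      unfolding unshuffle_sum_eq_block_lists
    proof (rule sum.cong[OF refl])
      fix Ls assume "Ls \<in> block_lists (length z) 2"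
      then have "length Ls = Suc (Suc 0)" by (simp add: block_lists_def)
      then obtain A B where "Ls = [A, B]" unfolding length_Suc_conv by blast
      then show "(if map (map ((!) z)) Ls = [v, w] then 1 else 0)
          = is_word v (map ((!) z) (Ls ! 0)) * is_word w (map ((!) z) (Ls ! 1))" by simp
    qed
    finally show ?thesis .
  qed
  then show ?thesis
    using v w by (simp add: Delta_sh_def coproduct_def shuffle_sum_eq_sum_words in_words_iff)
qed

text \<open>Bilinear expansion over indicators of words; splitting \<open>z\<close> only produces
  words in \<open>words_upto n\<close>, so a finite family is enough.\<close>

lemma unshuffle_sum_expand:
  assumes "z \<in> words_upto n"
  shows "unshuffle_sum z \<phi> \<psi> = (\<Sum>v\<in>words_upto n. \<Sum>w\<in>words_upto n.
    \<phi> v * \<psi> w * unshuffle_sum z (is_word v) (is_word w))"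
proof -
  have e: "f v = (\<Sum>v'\<in>words_upto n. f v' * is_word v' v)"
    if "set v \<subseteq> set z" "length v \<le> length z" for v :: "'a list" and f :: "'a list \<Rightarrow> real"
  proof -
    have "v \<in> words_upto n" using that assms by (auto simp: words_upto_def in_words_iff)
    moreover have "(\<Sum>v'\<in>words_upto n. f v' * is_word v' v) = (\<Sum>v'\<in>words_upto n. if v' = v then f v' else 0)"
      by (intro sum.cong) auto
    ultimately show ?thesis by simp
  qed
  have "unshuffle_sum z \<phi> \<psi> = unshuffle_sum z (\<lambda>v. \<Sum>v'\<in>words_upto n. \<phi> v' * is_word v' v)
      (\<lambda>w. \<Sum>w'\<in>words_upto n. \<psi> w' * is_word w' w)"
    by (rule unshuffle_sum_cong) (rule e; assumption)+
  then show ?thesis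
    by (simp add: unshuffle_sum_sum unshuffle_sum_scale sum_distrib_left mult.assoc)
qed

text \<open>Truncated duality: pairs of total length above \<open>n\<close> are left out on one side
  by definition, on the other because no word of length at most \<open>n\<close> splits into
  them.\<close>

lemma sum_shuffle_sum:
  "(\<Sum>v\<in>words_upto n. \<Sum>w\<in>words_upto n. if length v + length w \<le> n then shuffle_sum x v w * \<phi> v * \<psi> w else 0)
    = (\<Sum>z\<in>words_upto n. x z * unshuffle_sum z \<phi> \<psi>)"
proof -
  have inner: "(if length v + length w \<le> n then shuffle_sum x v w * \<phi> v * \<psi> w else 0)
      = (\<Sum>z\<in>words_upto n. x z * (\<phi> v * \<psi> w * unshuffle_sum z (is_word v) (is_word w)))"
    if "v \<in> words_upto n" "w \<in> words_upto n" for v w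
  proof (cases "length v + length w \<le> n")
    case True
    have "shuffle_sum x v w = (\<Sum>z\<in>words (length v + length w). x z * unshuffle_sum z (is_word v) (is_word w))"
      using that by (intro shuffle_sum_eq_sum_words) (auto simp: words_upto_def in_words_iff)
    also have "\<dots> = (\<Sum>z\<in>words_upto n. x z * unshuffle_sum z (is_word v) (is_word w))"
      using True unshuffle_sum_eq_0_if_length[of v w]
      by (intro sum.mono_neutral_left) (force simp: words_upto_def in_words_iff)+
    finally show ?thesis using True by (simp add: sum_distrib_left sum_distrib_right mult_ac)
  next
    case False
    then have "unshuffle_sum z (is_word v) (is_word w) = 0" if "z \<in> words_upto n" for z
      using that by (intro unshuffle_sum_eq_0_if_length) (auto simp: words_upto_def in_words_iff)
    then show ?thesis using False by simp
  qed
  have "(\<Sum>v\<in>words_upto n. \<Sum>w\<in>words_upto n. if length v + length w \<le> n then shuffle_sum x v w * \<phi> v * \<psi> w else 0)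
    = (\<Sum>v\<in>words_upto n. \<Sum>w\<in>words_upto n. \<Sum>z\<in>words_upto n.
        x z * (\<phi> v * \<psi> w * unshuffle_sum z (is_word v) (is_word w)))"
    using inner by (intro sum.cong refl) auto
  also have "\<dots> = (\<Sum>v\<in>words_upto n. \<Sum>z\<in>words_upto n. \<Sum>w\<in>words_upto n.
        x z * (\<phi> v * \<psi> w * unshuffle_sum z (is_word v) (is_word w)))"
    by (intro sum.cong refl sum.swap)
  also have "\<dots> = (\<Sum>z\<in>words_upto n. \<Sum>v\<in>words_upto n. \<Sum>w\<in>words_upto n.
        x z * (\<phi> v * \<psi> w * unshuffle_sum z (is_word v) (is_word w)))"
    by (rule sum.swap)
  also have "\<dots> = (\<Sum>z\<in>words_upto n. x z * unshuffle_sum z \<phi> \<psi>)"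
    by (intro sum.cong refl) (simp add: unshuffle_sum_expand[of _ n \<phi> \<psi>] sum_distrib_left)
  finally show ?thesis .
qed

lemma shuffle_sum_add:
  "shuffle_sum (\<lambda>z. x z + y z) v w = shuffle_sum x v w + shuffle_sum y v w"
proof (induction x v w arbitrary: y rule: shuffle_sum.induct)
  case (3 x a v b w)
  then show ?case by (simp add: 3(1)[of "\<lambda>z. y (a # z)"] 3(2)[of "\<lambda>z. y (b # z)"])
qed auto

lemma shuffle_sum_scale: "shuffle_sum (\<lambda>z. c * x z) v w = c * shuffle_sum x v w"
  by (induction x v w rule: shuffle_sum.induct) (auto simp: algebra_simps)

lemma shuffle_sum_0: "shuffle_sum (\<lambda>z. 0) v w = 0"
  using shuffle_sum_scale[of 0 "\<lambda>z. 0"] by simp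

lemma shuffle_sum_sum:
  "shuffle_sum (\<lambda>z. \<Sum>i\<in>I. x i z) v w = (\<Sum>i\<in>I. shuffle_sum (x i) v w)"
  by (induction I rule: infinite_finite_induct) (auto simp: shuffle_sum_0 shuffle_sum_add)

lemma shuffle_sum_Nil_right [simp]: "shuffle_sum x v [] = x v"
  by (cases v) auto

lemma shuffle_sum_cong:
  assumes "\<And>z. set z = set v \<union> set w \<Longrightarrow> length z = length v + length w \<Longrightarrow> x z = y z"
  shows "shuffle_sum x v w = shuffle_sum y v w"
  using assms
proof (induction x v w arbitrary: y rule: shuffle_sum.induct)
  case (3 x a v b w)
  have "shuffle_sum (\<lambda>z. x (a # z)) v (b # w) = shuffle_sum (\<lambda>z. y (a # z)) v (b # w)"
    by (intro 3(1) 3(3)) auto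
  moreover have "shuffle_sum (\<lambda>z. x (b # z)) (a # v) w = shuffle_sum (\<lambda>z. y (b # z)) (a # v) w"
    by (intro 3(2) 3(3)) auto
  ultimately show ?case by simp
qed auto

lemma tmult_Cons: "tmult x y (a # w) = x [] * y (a # w) + tmult (\<lambda>z. x (a # z)) y w"
  unfolding tmult_def by (simp only: list.size(4) add_Suc_right add_0_right sum.atMost_Suc_shift) simp

text \<open>Deconcatenation is multiplicative for the shuffle product: an initial segment of a
  shuffle of \<open>v\<close> and \<open>w\<close> is a shuffle of initial segments of both, and the
  rest shuffles what remains. This lets shuffle relations propagate along Chen's relation.\<close>

lemma shuffle_sum_tmult:
  "shuffle_sum (tmult x y) v w = (\<Sum>i\<le>length v. \<Sum>j\<le>length w.
    shuffle_sum x (take i v) (take j w) * shuffle_sum y (drop i v) (drop j w))"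
proof (induction "length v + length w" arbitrary: v w x rule: less_induct)
  case less
  consider "v = []" | "w = []" | a v' b w' where "v = a # v'" "w = b # w'"
    by (meson list.exhaust)
  then show ?case
  proof cases
    case (3 a v' b w')
    \<comment> \<open>Either the cut precedes the first letter \<open>c\<close>, or \<open>c\<close>
      belongs to the left factor.\<close>
    have split: "shuffle_sum (\<lambda>z. tmult x y (c # z)) r q
        = x [] * shuffle_sum (\<lambda>z. y (c # z)) r q + shuffle_sum (tmult (\<lambda>z. x (c # z)) y) r q" for c r q
      unfolding tmult_Cons by (simp add: shuffle_sum_add shuffle_sum_scale)
    have IH1: "shuffle_sum (tmult (\<lambda>z. x (a # z)) y) v' (b # w') = (\<Sum>i\<le>length v'. \<Sum>j\<le>length (b # w').
        shuffle_sum (\<lambda>z. x (a # z)) (take i v') (take j (b # w')) * shuffle_sum y (drop i v') (drop j (b # w')))"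
      using 3 by (intro less) auto
    have IH2: "shuffle_sum (tmult (\<lambda>z. x (b # z)) y) (a # v') w' = (\<Sum>i\<le>length (a # v'). \<Sum>j\<le>length w'.
        shuffle_sum (\<lambda>z. x (b # z)) (take i (a # v')) (take j w') * shuffle_sum y (drop i (a # v')) (drop j w'))"
      using 3 by (intro less) auto
    show ?thesis
      unfolding 3 shuffle_sum.simps(3) split IH1 IH2
      by (simp only: list.size(4) add_Suc_right add_0_right sum.atMost_Suc_shift)
        (simp add: sum.distrib distrib_right distrib_left)
  qed (simp_all add: tmult_def)
qed

section \<open>Smooth functions\<close>

lemma frechet_derivative_eq: "(f has_derivative f') (at x) \<Longrightarrow> frechet_derivative f (at x) = f'"
  using frechet_derivative_at by metis

lemma Ck_SucI:
  assumes "\<And>x. (f has_derivative f' x) (at x)" "\<And>v. Ck k (\<lambda>x. f' x v)"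
  shows "Ck (Suc k) f"
proof -
  have "f differentiable (at x)" for x using assms(1) unfolding differentiable_def by blast
  moreover have "(\<lambda>x. frechet_derivative f (at x) v) = (\<lambda>x. f' x v)" for v
    using frechet_derivative_eq[OF assms(1)] by simp
  ultimately show ?thesis using assms(2) by simp
qed

lemma Ck_Suc_has_derivative: "Ck (Suc k) f \<Longrightarrow> (f has_derivative frechet_derivative f (at x)) (at x)"
  by (simp add: frechet_derivative_works)

lemma Ck_continuous: "Ck k f \<Longrightarrow> continuous_on UNIV f"
  by (cases k) (auto intro!: differentiable_imp_continuous_on simp: differentiable_on_def
      intro: differentiable_at_withinI)

lemma Ck_Suc_imp_Ck: "Ck (Suc k) f \<Longrightarrow> Ck k f"
proof (induction k arbitrary: f)
  case 0
  then show ?case using Ck_continuous[of "Suc 0" f] by simp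
next
  case (Suc k)
  then show ?case by (metis Ck.simps(2))
qed

lemma Ck_const: "Ck k (\<lambda>x. c)"
proof (induction k arbitrary: c)
  case (Suc k)
  show ?case by (rule Ck_SucI[where f' = "\<lambda>x v. 0"]) (auto intro: Suc)
qed simp

lemma Ck_add: "Ck k f \<Longrightarrow> Ck k g \<Longrightarrow> Ck k (\<lambda>x. f x + g x)"
proof (induction k arbitrary: f g)
  case (Suc k)
  show ?case
    by (rule Ck_SucI[OF has_derivative_add[OF Ck_Suc_has_derivative[OF Suc.prems(1)]
          Ck_Suc_has_derivative[OF Suc.prems(2)]]]) (use Suc in auto)
qed (auto intro: continuous_intros)

lemma Ck_sum: "(\<And>i. i \<in> I \<Longrightarrow> Ck k (f i)) \<Longrightarrow> Ck k (\<lambda>x. \<Sum>i\<in>I. f i x)"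
  by (induction I rule: infinite_finite_induct) (auto intro: Ck_const Ck_add)

lemma Ck_linear:
  assumes "bounded_linear L"
  shows "Ck k f \<Longrightarrow> Ck k (\<lambda>x. L (f x))"
proof (induction k arbitrary: f)
  case 0
  then show ?case using bounded_linear.continuous_on[OF assms] by simp
next
  case (Suc k)
  show ?case
    by (rule Ck_SucI[OF bounded_linear.has_derivative[OF assms Ck_Suc_has_derivative[OF Suc.prems]]])
      (use Suc in auto)
qed

lemma Ck_bilinear:
  assumes "bounded_bilinear B"
  shows "Ck k f \<Longrightarrow> Ck k g \<Longrightarrow> Ck k (\<lambda>x. B (f x) (g x))"
proof (induction k arbitrary: f g)
  case 0
  then show ?case using bounded_bilinear.continuous_on[OF assms] by simp
next
  case (Suc k)
  have "Ck k f" "Ck k g" using Suc.prems by (auto intro: Ck_Suc_imp_Ck simp del: Ck.simps)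
  moreover have "Ck k (\<lambda>x. frechet_derivative f (at x) v)" "Ck k (\<lambda>x. frechet_derivative g (at x) v)" for v
    using Suc.prems by auto
  ultimately show ?case
    by (intro Ck_SucI[OF bounded_bilinear.FDERIV[OF assms Ck_Suc_has_derivative[OF Suc.prems(1)]
          Ck_Suc_has_derivative[OF Suc.prems(2)]]] Ck_add Suc.IH)
qed

text \<open>Trades a direction that varies with the point, as in the chain rule or along a vector
  field, for fixed directions, the only kind in the definition of \<open>Ck\<close>.\<close>

lemma frechet_derivative_expand:
  fixes f :: "'a::euclidean_space \<Rightarrow> 'b::real_normed_vector"
  assumes "f differentiable (at x)"
  shows "frechet_derivative f (at x) v = (\<Sum>b\<in>Basis. (v \<bullet> b) *\<^sub>R frechet_derivative f (at x) b)"
proof -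
  have "linear (frechet_derivative f (at x))" by (rule linear_frechet_derivative[OF assms])
  then have "frechet_derivative f (at x) (\<Sum>b\<in>Basis. (v \<bullet> b) *\<^sub>R b) = (\<Sum>b\<in>Basis. (v \<bullet> b) *\<^sub>R frechet_derivative f (at x) b)"
    by (simp add: linear_sum linear_scale)
  then show ?thesis by (simp add: euclidean_representation)
qed

lemma Ck_compose:
  fixes h :: "'b::euclidean_space \<Rightarrow> 'c::real_normed_vector" and g :: "'a::euclidean_space \<Rightarrow> 'b"
  shows "Ck k h \<Longrightarrow> Ck k g \<Longrightarrow> Ck k (\<lambda>x. h (g x))"
proof (induction k arbitrary: h g)
  case 0
  then show ?case by (auto intro: continuous_on_compose2)
next
  case (Suc k)
  have diff: "h differentiable (at y)" for y using Suc.prems by simp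
  show ?case
  proof (rule Ck_SucI)
    fix x
    show "((\<lambda>x. h (g x)) has_derivative
        (\<lambda>v. \<Sum>b\<in>Basis. (frechet_derivative g (at x) v \<bullet> b) *\<^sub>R frechet_derivative h (at (g x)) b)) (at x)"
      using diff_chain_at[OF Ck_Suc_has_derivative[OF Suc.prems(2)] Ck_Suc_has_derivative[OF Suc.prems(1)], of x]
      unfolding o_def frechet_derivative_expand[OF diff, symmetric] .
  next
    fix v
    show "Ck k (\<lambda>x. \<Sum>b\<in>Basis. (frechet_derivative g (at x) v \<bullet> b) *\<^sub>R frechet_derivative h (at (g x)) b)"
      using Suc.prems Ck_Suc_imp_Ck[OF Suc.prems(2)]
      by (intro Ck_sum Ck_bilinear[OF bounded_bilinear_scaleR] Ck_linear[OF bounded_linear_inner_left] Suc.IH) auto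
  qed
qed

lemma smooth_has_derivative: "smooth f \<Longrightarrow> (f has_derivative frechet_derivative f (at x)) (at x)"
  unfolding smooth_def by (rule Ck_Suc_has_derivative[of 0]) blast

lemma smooth_differentiable: "smooth f \<Longrightarrow> f differentiable (at x)"
  using smooth_has_derivative differentiable_def by blast

lemma smooth_continuous_on: "smooth f \<Longrightarrow> continuous_on S f"
  unfolding smooth_def using Ck_continuous continuous_on_subset subset_UNIV by blast

lemma smooth_frechet_derivative: "smooth f \<Longrightarrow> smooth (\<lambda>x. frechet_derivative f (at x) v)"
  unfolding smooth_def by (metis Ck.simps(2))

lemma smooth_const: "smooth (\<lambda>x. c)"
  and smooth_add: "smooth f \<Longrightarrow> smooth g \<Longrightarrow> smooth (\<lambda>x. f x + g x)"
  and smooth_sum: "(\<And>i. i \<in> I \<Longrightarrow> smooth (\<phi> i)) \<Longrightarrow> smooth (\<lambda>x. \<Sum>i\<in>I. \<phi> i x)"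
  and smooth_linear: "bounded_linear L \<Longrightarrow> smooth f \<Longrightarrow> smooth (\<lambda>x. L (f x))"
  and smooth_bilinear: "bounded_bilinear B \<Longrightarrow> smooth h \<Longrightarrow> smooth k \<Longrightarrow> smooth (\<lambda>x. B (h x) (k x))"
  and smooth_compose: "smooth u \<Longrightarrow> smooth w \<Longrightarrow> smooth (\<lambda>x. u (w x))"
  unfolding smooth_def
  by (simp_all add: Ck_const Ck_add Ck_sum Ck_linear Ck_bilinear Ck_compose)

lemmas smooth_mult = smooth_bilinear[OF bounded_bilinear_mult]

lemma smooth_bounded_linear: "bounded_linear L \<Longrightarrow> smooth L"
  unfolding smooth_def
proof
  fix k assume L: "bounded_linear L"
  show "Ck k L"
  proof (cases k)
    case 0
    then show ?thesis using bounded_linear.continuous_on[OF L continuous_on_id] by simp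
  next
    case (Suc k')
    then show ?thesis
      using Ck_SucI[OF bounded_linear_imp_has_derivative[OF L] Ck_const] by simp
  qed
qed

lemma smooth_ident: "smooth (\<lambda>x. x)"
  by (rule smooth_bounded_linear) (rule bounded_linear_ident)

lemma smooth_Pair:
  assumes "smooth f" "smooth g"
  shows "smooth (\<lambda>x. (f x, g x))"
proof -
  have "bounded_linear (\<lambda>a. (a, 0 :: 'c))" "bounded_linear (\<lambda>b. (0 :: 'b, b))"
    by (auto intro!: bounded_linear_Pair bounded_linear_ident bounded_linear_zero)
  from smooth_add[OF smooth_linear[OF this(1) assms(1)] smooth_linear[OF this(2) assms(2)]]
  show ?thesis by simp
qed

text \<open>The derivative is a finite sum of rank-one maps built from its directional derivatives,
  so that smoothness in the space of bounded linear maps follows from theirs.\<close>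

lemma smooth_Dblinfun:
  fixes g :: "'a::euclidean_space \<Rightarrow> 'b::real_normed_vector"
  assumes "smooth g"
  shows "smooth (\<lambda>y. Dblinfun g y)"
proof -
  have "Dblinfun g y = (\<Sum>b\<in>Basis. blinfun_scaleR_left (frechet_derivative g (at y) b) o\<^sub>L blinfun_inner_left b)" for y
  proof (rule blinfun_eqI)
    fix v
    have "blinfun_apply (Dblinfun g y) v = frechet_derivative g (at y) v"
      by (simp add: bounded_linear_Blinfun_apply has_derivative_bounded_linear[OF smooth_has_derivative[OF assms]])
    also have "\<dots> = (\<Sum>b\<in>Basis. (v \<bullet> b) *\<^sub>R frechet_derivative g (at y) b)"
      by (rule frechet_derivative_expand[OF smooth_differentiable[OF assms]])
    also have "\<dots> = blinfun_apply (\<Sum>b\<in>Basis. blinfun_scaleR_left (frechet_derivative g (at y) b) o\<^sub>L blinfun_inner_left b) v"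
      by (simp add: blinfun.sum_left)
    finally show "blinfun_apply (Dblinfun g y) v = \<dots>" .
  qed
  moreover have "smooth (\<lambda>y. \<Sum>b\<in>Basis. blinfun_scaleR_left (frechet_derivative g (at y) b) o\<^sub>L blinfun_inner_left b)"
    by (intro smooth_sum smooth_bilinear[OF bounded_bilinear_blinfun_compose]
        smooth_linear[OF bounded_linear_blinfun_scaleR_left] smooth_frechet_derivative assms smooth_const)
  ultimately show ?thesis by (simp only:)
qed

section \<open>Derivatives along vector fields\<close>

abbreviation lie ::
    "('w::euclidean_space \<Rightarrow> 'v::euclidean_space \<Rightarrow>\<^sub>L 'w) \<Rightarrow> 'v \<Rightarrow> ('w \<Rightarrow> 'e::real_normed_vector) \<Rightarrow> 'w \<Rightarrow> 'e" where
  "lie F a h \<equiv> (\<lambda>y. frechet_derivative h (at y) (blinfun_apply (F y) a))"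

lemma smooth_lie:
  assumes "smooth F" "smooth h"
  shows "smooth (lie F a h)"
proof -
  have "lie F a h = (\<lambda>y. \<Sum>b\<in>Basis. (blinfun_apply (F y) a \<bullet> b) *\<^sub>R frechet_derivative h (at y) b)"
    using frechet_derivative_expand[OF smooth_differentiable[OF assms(2)]] by blast
  moreover have "smooth (\<lambda>y. blinfun_apply (F y) a)"
    using smooth_linear[OF blinfun.bounded_linear_left assms(1)] .
  ultimately show ?thesis
    by (simp only:) (intro smooth_sum smooth_bilinear[OF bounded_bilinear_scaleR]
        smooth_linear[OF bounded_linear_inner_left] smooth_frechet_derivative assms)
qed

lemma lie_const: "lie F a (\<lambda>y. c) y = 0"
  using frechet_derivative_eq[OF has_derivative_const] by (metis)

lemma lie_add:
  assumes "smooth f" "smooth g"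
  shows "lie F a (\<lambda>y. f y + g y) y = lie F a f y + lie F a g y"
  using frechet_derivative_eq[OF has_derivative_add[OF smooth_has_derivative[OF assms(1)]
        smooth_has_derivative[OF assms(2)]]] by simp

lemma lie_sum:
  assumes "\<And>i. i \<in> I \<Longrightarrow> smooth (f i)"
  shows "lie F a (\<lambda>y. \<Sum>i\<in>I. f i y) y = (\<Sum>i\<in>I. lie F a (f i) y)"
  using frechet_derivative_eq[OF has_derivative_sum[OF smooth_has_derivative[OF assms]], of I "\<lambda>i. i"] by simp

lemma lie_mult:
  fixes f g :: "'w::euclidean_space \<Rightarrow> real"
  assumes "smooth f" "smooth g"
  shows "lie F a (\<lambda>y. f y * g y) y = lie F a f y * g y + f y * lie F a g y"
  using frechet_derivative_eq[OF has_derivative_mult[OF smooth_has_derivative[OF assms(1)]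
        smooth_has_derivative[OF assms(2)]]] by simp

lemma lie_linear:
  assumes "bounded_linear L" "smooth f"
  shows "lie F a (\<lambda>y. L (f y)) y = L (lie F a f y)"
  using frechet_derivative_eq[OF bounded_linear.has_derivative[OF assms(1) smooth_has_derivative[OF assms(2)]]] by simp

lemma lie_inner:
  assumes "smooth f"
  shows "lie F a (\<lambda>y. f y \<bullet> b) y = lie F a f y \<bullet> b"
  by (rule lie_linear[OF bounded_linear_inner_left assms])

lemma lie_prod:
  fixes f :: "nat \<Rightarrow> 'w::euclidean_space \<Rightarrow> real"
  assumes "\<And>i. i < m \<Longrightarrow> smooth (f i)"
  shows "lie F a (\<lambda>y. \<Prod>i<m. f i y) y = (\<Sum>j<m. \<Prod>i<m. if i = j then lie F a (f j) y else f i y)"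
    and "smooth (\<lambda>y. \<Prod>i<m. f i y)"
proof -
  have "lie F a (\<lambda>y. \<Prod>i<m. f i y) y = (\<Sum>j<m. \<Prod>i<m. if i = j then lie F a (f j) y else f i y)
      \<and> smooth (\<lambda>y. \<Prod>i<m. f i y)"
    using assms
  proof (induction m)
    case 0
    then show ?case by (simp add: smooth_const lie_const)
  next
    case (Suc m)
    then have IH: "lie F a (\<lambda>y. \<Prod>i<m. f i y) y = (\<Sum>j<m. \<Prod>i<m. if i = j then lie F a (f j) y else f i y)"
      "smooth (\<lambda>y. \<Prod>i<m. f i y)" by auto
    have "(\<Prod>i<m. if i = m then lie F a (f m) y else f i y) = (\<Prod>i<m. f i y)" by (intro prod.cong) auto
    then show ?case using lie_mult[OF IH(2) Suc.prems[of m], where F = F and a = a and y = y] IH smooth_mult[OF IH(2) Suc.prems[of m]]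
      by (simp add: sum_distrib_right)
  qed
  then show "lie F a (\<lambda>y. \<Prod>i<m. f i y) y = (\<Sum>j<m. \<Prod>i<m. if i = j then lie F a (f j) y else f i y)"
    and "smooth (\<lambda>y. \<Prod>i<m. f i y)" by auto
qed

section \<open>Iterated derivatives along a coefficient\<close>

lemma smooth_vf_iter: "smooth F \<Longrightarrow> smooth h \<Longrightarrow> smooth (vf_iter F w h)"
  by (induction w) (auto intro: smooth_lie)

lemma vf_iter_append: "vf_iter F (v @ w) h = vf_iter F v (vf_iter F w h)"
  by (induction v) auto

lemma vf_iter_linear:
  assumes "bounded_linear L" "smooth F" "smooth f"
  shows "vf_iter F w (\<lambda>y. L (f y)) = (\<lambda>y. L (vf_iter F w f y))"
proof (induction w)
  case (Cons a w)
  then show ?case by (simp add: lie_linear[OF assms(1) smooth_vf_iter[OF assms(2,3)]])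
qed simp

lemma vf_iter_inner:
  assumes "smooth F" "smooth f"
  shows "vf_iter F w (\<lambda>y. f y \<bullet> b) y = vf_iter F w f y \<bullet> b"
  using vf_iter_linear[OF bounded_linear_inner_left assms] by metis

text \<open>Brings \<open>pushforward\<close> and \<open>rough_solution\<close> to one form: both
  are lifts of iterated derivatives along a field, here the constant identity.\<close>

lemma iter_deriv_eq_vf_iter: "iter_deriv w f = vf_iter (\<lambda>_. id_blinfun) w f"
  by (induction w) auto

lemma vf_iter_compose:
  assumes "smooth G" "smooth h" "smooth \<gamma>"
    and related: "\<And>y v. frechet_derivative \<gamma> (at y) (blinfun_apply (F y) v) = blinfun_apply (G (\<gamma> y)) v"
  shows "vf_iter F w (\<lambda>y. h (\<gamma> y)) = (\<lambda>y. vf_iter G w h (\<gamma> y))"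
proof (induction w)
  case (Cons a w)
  have "((\<lambda>y. vf_iter G w h (\<gamma> y)) has_derivative
      (\<lambda>v. frechet_derivative (vf_iter G w h) (at (\<gamma> y)) (frechet_derivative \<gamma> (at y) v))) (at y)" for y
    using diff_chain_at[OF smooth_has_derivative[OF assms(3)] smooth_has_derivative[OF smooth_vf_iter[OF assms(1,2)]]]
    unfolding o_def .
  from frechet_derivative_eq[OF this] show ?case using Cons related by simp
qed simp

section \<open>Coefficients of the lift\<close>

text \<open>The lift of \<open>f\<close> along \<open>F\<close> expands as \<open>Z s t u \<approx> \<Sum>v. X s t v * lift_coeff F f v u (Y s)\<close>.
  The recursion is Leibniz' rule for the vector fields \<open>F y a\<close> extended to the tensor algebra by
  \<open>dZ = Z \<otimes> df(Y)\<close>.\<close>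

primrec lift_coeff ::
    "('w::euclidean_space \<Rightarrow> 'v::euclidean_space \<Rightarrow>\<^sub>L 'w) \<Rightarrow> ('w \<Rightarrow> 'u::euclidean_space) \<Rightarrow>
     'v list \<Rightarrow> 'u list \<Rightarrow> 'w \<Rightarrow> real" where
  "lift_coeff F f [] u = (\<lambda>y. if u = [] then 1 else 0)"
| "lift_coeff F f (a # v) u = (\<lambda>y. lie F a (lift_coeff F f v u) y +
    (case u of [] \<Rightarrow> 0 | b # u' \<Rightarrow> (lie F a f y \<bullet> b) * lift_coeff F f v u' y))"

lemma smooth_lift_coeff:
  assumes "smooth F" "smooth f"
  shows "smooth (lift_coeff F f v u)"
proof (induction v arbitrary: u)
  case (Cons a v)
  show ?case
  proof (cases u)
    case Nil
    then show ?thesis using smooth_lie[OF assms(1) Cons[of "[]"]] by simp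
  next
    case (Cons b u')
    have "smooth (\<lambda>y. lie F a f y \<bullet> b)"
      by (rule smooth_linear[OF bounded_linear_inner_left smooth_lie[OF assms]])
    then show ?thesis
      using smooth_add[OF smooth_lie[OF assms(1) Cons.IH[of u]] smooth_mult[OF _ Cons.IH[of u']]] Cons by simp
  qed
qed (simp add: smooth_const)

text \<open>Every letter of \<open>v\<close> contributes at most one letter of \<open>u\<close>. The
  expansion in degree \<open>length u\<close> therefore starts with words of that length, which
  gives its order.\<close>

lemma lift_coeff_eq_0: "length v < length u \<Longrightarrow> lift_coeff F f v u = (\<lambda>y. 0)"
proof (induction v arbitrary: u)
  case (Cons a v)
  then obtain b u' where u: "u = b # u'" by (cases u) auto
  have "lift_coeff F f v u = (\<lambda>y. 0)" "lift_coeff F f v u' = (\<lambda>y. 0)" using Cons u by auto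
  then show ?case using u by (simp add: lie_const)
qed simp

lemma lift_coeff_Nil: "lift_coeff F f v [] = (\<lambda>y. if v = [] then 1 else 0)"
proof (induction v)
  case (Cons a v)
  then show ?case by (cases "v = []") (simp_all add: lie_const)
qed simp

text \<open>The last letter of \<open>v\<close> produces \<open>b\<close>, all earlier ones
  differentiate the result. The empty word is excluded because its coefficient is 0 and not the
  value of \<open>f\<close>.\<close>

lemma lift_coeff_single:
  assumes "smooth F" "smooth f" "v \<noteq> []"
  shows "lift_coeff F f v [b] = (\<lambda>y. vf_iter F v f y \<bullet> b)"
  using assms(3)
proof (induction v)
  case (Cons a v)
  then show ?case
    by (cases "v = []") (simp_all add: lift_coeff_Nil lie_const lie_inner smooth_vf_iter assms)
qed simp

lemma ordered_block_lists_0: "ordered_block_lists 0 m = (if m = 0 then {[]} else {})"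
  by (auto simp: ordered_block_lists_def block_lists_0)

text \<open>Connects the recursion with the ordered shuffles. By the product rule the derivative
  along \<open>a\<close> of a product over blocks puts \<open>a\<close> in front of one block, and
  the second summand of the recursion adds a first block consisting of \<open>a\<close>; these are
  the two sums of \<open>sum_ordered_block_lists_Suc\<close>.\<close>

lemma lift_coeff_eq_sum_blocks:
  assumes "smooth F" "smooth f"
  shows "lift_coeff F f v u y = (\<Sum>Ls\<in>ordered_block_lists (length v) (length u).
    \<Prod>i<length u. vf_iter F (map ((!) v) (Ls ! i)) f y \<bullet> u ! i)"
proof (induction v arbitrary: u y)
  case Nil
  then show ?case by (simp add: ordered_block_lists_0)
next
  case (Cons a v)
  define P where "P v u Ls y = (\<Prod>i<length u. vf_iter F (map ((!) v) (Ls ! i)) f y \<bullet> u ! i)"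
    for v and u :: "'c list" and Ls y
  have shift: "map ((!) (a # v)) (map Suc L) = map ((!) v) L" for L by simp
  have smooth_P: "smooth (\<lambda>y. P v u Ls y)" for u Ls
    unfolding P_def by (intro lie_prod(2) smooth_linear[OF bounded_linear_inner_left] smooth_vf_iter assms)
  have ins: "P (a # v) u (insert_0 j Ls) y = (\<Prod>i<length u. if i = j
      then lie F a (\<lambda>y. vf_iter F (map ((!) v) (Ls ! j)) f y \<bullet> u ! j) y
      else vf_iter F (map ((!) v) (Ls ! i)) f y \<bullet> u ! i)"
    if "Ls \<in> ordered_block_lists (length v) (length u)" for j Ls
    unfolding P_def
  proof (rule prod.cong[OF refl])
    fix i assume i: "i \<in> {..<length u}"
    have "length Ls = length u" using that by (simp add: ordered_block_lists_def block_lists_def)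
    then show "vf_iter F (map ((!) (a # v)) (insert_0 j Ls ! i)) f y \<bullet> u ! i = (if i = j
      then lie F a (\<lambda>y. vf_iter F (map ((!) v) (Ls ! j)) f y \<bullet> u ! j) y
      else vf_iter F (map ((!) v) (Ls ! i)) f y \<bullet> u ! i)"
      using i by (simp add: nth_insert_0 shift lie_inner smooth_vf_iter assms del: map_map)
  qed
  have "lie F a (lift_coeff F f v u) y = lie F a (\<lambda>y. \<Sum>Ls\<in>ordered_block_lists (length v) (length u). P v u Ls y) y"
    unfolding P_def Cons.IH[symmetric] ..
  also have "\<dots> = (\<Sum>Ls\<in>ordered_block_lists (length v) (length u). lie F a (\<lambda>y. P v u Ls y) y)"
    by (rule lie_sum[OF smooth_P])
  also have "\<dots> = (\<Sum>Ls\<in>ordered_block_lists (length v) (length u). \<Sum>j<length u. P (a # v) u (insert_0 j Ls) y)"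
  proof (intro sum.cong refl)
    fix Ls assume Ls: "Ls \<in> ordered_block_lists (length v) (length u)"
    have "lie F a (\<lambda>y. P v u Ls y) y = (\<Sum>j<length u. \<Prod>i<length u. if i = j
      then lie F a (\<lambda>y. vf_iter F (map ((!) v) (Ls ! j)) f y \<bullet> u ! j) y
      else vf_iter F (map ((!) v) (Ls ! i)) f y \<bullet> u ! i)"
      unfolding P_def
      by (intro lie_prod(1) smooth_linear[OF bounded_linear_inner_left] smooth_vf_iter assms)
    then show "lie F a (\<lambda>y. P v u Ls y) y = (\<Sum>j<length u. P (a # v) u (insert_0 j Ls) y)"
      using ins[OF Ls] by simp
  qed
  finally have 1: "lie F a (lift_coeff F f v u) y
      = (\<Sum>Ls\<in>ordered_block_lists (length v) (length u). \<Sum>j<length u. P (a # v) u (insert_0 j Ls) y)" .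
  have 2: "(case u of [] \<Rightarrow> 0 | b # u' \<Rightarrow> (lie F a f y \<bullet> b) * lift_coeff F f v u' y)
    = (if length u = 0 then 0 else \<Sum>Ks\<in>ordered_block_lists (length v) (length u - 1).
        P (a # v) u ([0] # map (map Suc) Ks) y)"
  proof (cases u)
    case (Cons b u')
    have "P (a # v) u ([0] # map (map Suc) Ks) y = (lie F a f y \<bullet> b) * P v u' Ks y"
      if "Ks \<in> ordered_block_lists (length v) (length u')" for Ks
    proof -
      have "length Ks = length u'" using that by (simp add: ordered_block_lists_def block_lists_def)
      then show ?thesis unfolding P_def Cons
        by (simp add: prod.lessThan_Suc_shift shift del: map_map prod.lessThan_Suc)
    qed
    then show ?thesis using Cons by (simp add: Cons.IH sum_distrib_left flip: P_def)
  qed simp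
  show ?case
    using 1 2 unfolding P_def[symmetric] by (simp add: sum_ordered_block_lists_Suc)
qed

lemma sum_box_pairing_eq_lift_coeff:
  assumes "smooth F" "smooth f" "length u = m"
  shows "(\<Sum>ns\<in>degree_lists m n. box_pairing ns (\<lambda>w. vf_iter F w f y) (Delta_osh ns x) u)
    = (\<Sum>v\<in>words_upto n. x v * lift_coeff F f v u y)"
  unfolding sum_box_pairing_Delta_osh lift_coeff_eq_sum_blocks[OF assms(1,2)] using assms(3) by simp

section \<open>Compatibility of the coefficients with shuffles and concatenation\<close>

lemma lie_unshuffle_sum:
  assumes "\<And>v. smooth (\<phi> v)" "\<And>v. smooth (\<psi> v)"
  shows "smooth (\<lambda>y. unshuffle_sum z (\<lambda>v. \<phi> v y) (\<lambda>w. \<psi> w y))"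
    and "lie F a (\<lambda>y. unshuffle_sum z (\<lambda>v. \<phi> v y) (\<lambda>w. \<psi> w y)) y
      = unshuffle_sum z (\<lambda>v. lie F a (\<phi> v) y) (\<lambda>w. \<psi> w y) + unshuffle_sum z (\<lambda>v. \<phi> v y) (\<lambda>w. lie F a (\<psi> w) y)"
proof -
  have "smooth (\<lambda>y. unshuffle_sum z (\<lambda>v. \<phi> v y) (\<lambda>w. \<psi> w y)) \<and>
      lie F a (\<lambda>y. unshuffle_sum z (\<lambda>v. \<phi> v y) (\<lambda>w. \<psi> w y)) y
      = unshuffle_sum z (\<lambda>v. lie F a (\<phi> v) y) (\<lambda>w. \<psi> w y) + unshuffle_sum z (\<lambda>v. \<phi> v y) (\<lambda>w. lie F a (\<psi> w) y)"
    using assms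
  proof (induction z arbitrary: \<phi> \<psi>)
    case Nil
    then show ?case by (simp add: smooth_mult lie_mult)
  next
    case (Cons c z)
    note 1 = Cons.IH[of "\<lambda>v. \<phi> (c # v)" \<psi>, OF Cons.prems] and 2 = Cons.IH[of \<phi> "\<lambda>v. \<psi> (c # v)", OF Cons.prems]
    show ?case
      using 1 2 smooth_add[OF conjunct1[OF 1] conjunct1[OF 2]] lie_add[OF conjunct1[OF 1] conjunct1[OF 2], where F = F and a = a and y = y]
      by simp
  qed
  then show "smooth (\<lambda>y. unshuffle_sum z (\<lambda>v. \<phi> v y) (\<lambda>w. \<psi> w y))"
    and "lie F a (\<lambda>y. unshuffle_sum z (\<lambda>v. \<phi> v y) (\<lambda>w. \<psi> w y)) y
      = unshuffle_sum z (\<lambda>v. lie F a (\<phi> v) y) (\<lambda>w. \<psi> w y) + unshuffle_sum z (\<lambda>v. \<phi> v y) (\<lambda>w. lie F a (\<psi> w) y)"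
    by auto
qed

lemma lie_shuffle_sum:
  assumes "\<And>z. smooth (x z)"
  shows "lie F a (\<lambda>y. shuffle_sum (\<lambda>z. x z y) v w) y = shuffle_sum (\<lambda>z. lie F a (x z) y) v w"
proof -
  have "smooth (\<lambda>y. shuffle_sum (\<lambda>z. x z y) v w) \<and>
      lie F a (\<lambda>y. shuffle_sum (\<lambda>z. x z y) v w) y = shuffle_sum (\<lambda>z. lie F a (x z) y) v w"
    using assms
  proof (induction "length v + length w" arbitrary: v w x rule: less_induct)
    case less
    consider "v = []" | "w = []" | c v' b w' where "v = c # v'" "w = b # w'"
      by (meson list.exhaust)
    then show ?case
    proof cases
      case (3 c v' b w')
      have 1: "smooth (\<lambda>y. shuffle_sum (\<lambda>z. x (c # z) y) v' w) \<and>
        lie F a (\<lambda>y. shuffle_sum (\<lambda>z. x (c # z) y) v' w) y = shuffle_sum (\<lambda>z. lie F a (x (c # z)) y) v' w"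
        using 3 less.prems by (intro less.hyps) auto
      have 2: "smooth (\<lambda>y. shuffle_sum (\<lambda>z. x (b # z) y) v w') \<and>
        lie F a (\<lambda>y. shuffle_sum (\<lambda>z. x (b # z) y) v w') y = shuffle_sum (\<lambda>z. lie F a (x (b # z)) y) v w'"
        using 3 less.prems by (intro less.hyps) auto
      show ?thesis
        using 1 2 smooth_add[OF conjunct1[OF 1] conjunct1[OF 2]] lie_add[OF conjunct1[OF 1] conjunct1[OF 2], where F = F and a = a and y = y] 3
        by simp
    qed (use less.prems in simp_all)
  qed
  then show ?thesis by blast
qed

lemma shuffle_sum_counit: "shuffle_sum (\<lambda>z. if z = [] then 1 else 0) v w = (if v = [] \<and> w = [] then 1 else 0)"
  by (cases "(v, w)" rule: prod.exhaust, cases v; cases w) (auto simp: shuffle_sum_0)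

text \<open>The algebraic source of the shuffle relation of the lift. Both sides split into a
  derivation part, which passes through the sums over shuffles, and a part that consumes the first
  letter of \<open>u\<close> or of \<open>w\<close>, which is the recursion of
  \<open>shuffle_sum\<close>.\<close>

lemma shuffle_sum_lift_coeff:
  assumes "smooth F" "smooth f"
  shows "unshuffle_sum v (\<lambda>v'. lift_coeff F f v' u y) (\<lambda>v'. lift_coeff F f v' w y)
    = shuffle_sum (\<lambda>z. lift_coeff F f v z y) u w"
proof (induction v arbitrary: u w y)
  case Nil
  then show ?case by (simp add: shuffle_sum_counit)
next
  case (Cons a v)
  note sm = smooth_lift_coeff[OF assms]
  \<comment> \<open>The part of the recursion that consumes the first letter of
    \<open>u\<close>.\<close>
  define c where "c u v' = (case u of [] \<Rightarrow> 0 | b # u' \<Rightarrow> (lie F a f y \<bullet> b) * lift_coeff F f v' u' y)" for u v'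
  have step: "lift_coeff F f (a # v') u y = lie F a (lift_coeff F f v' u) y + c u v'" for v' u
    unfolding c_def by simp
  have "unshuffle_sum (a # v) (\<lambda>v'. lift_coeff F f v' u y) (\<lambda>v'. lift_coeff F f v' w y)
    = lie F a (\<lambda>y. unshuffle_sum v (\<lambda>v'. lift_coeff F f v' u y) (\<lambda>v'. lift_coeff F f v' w y)) y
      + unshuffle_sum v (c u) (\<lambda>v'. lift_coeff F f v' w y) + unshuffle_sum v (\<lambda>v'. lift_coeff F f v' u y) (c w)"
  proof -
    have "lie F a (\<lambda>y. unshuffle_sum v (\<lambda>v'. lift_coeff F f v' u y) (\<lambda>v'. lift_coeff F f v' w y)) y
      = unshuffle_sum v (\<lambda>v'. lie F a (lift_coeff F f v' u) y) (\<lambda>v'. lift_coeff F f v' w y)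
        + unshuffle_sum v (\<lambda>v'. lift_coeff F f v' u y) (\<lambda>v'. lie F a (lift_coeff F f v' w) y)"
      by (intro lie_unshuffle_sum(2) sm)
    then show ?thesis unfolding unshuffle_sum.simps step unshuffle_sum_add by simp
  qed
  also have "lie F a (\<lambda>y. unshuffle_sum v (\<lambda>v'. lift_coeff F f v' u y) (\<lambda>v'. lift_coeff F f v' w y)) y
      = shuffle_sum (\<lambda>z. lie F a (lift_coeff F f v z) y) u w"
    unfolding Cons.IH by (rule lie_shuffle_sum[OF sm])
  also have "shuffle_sum (\<lambda>z. lie F a (lift_coeff F f v z) y) u w + unshuffle_sum v (c u) (\<lambda>v'. lift_coeff F f v' w y)
      + unshuffle_sum v (\<lambda>v'. lift_coeff F f v' u y) (c w)
      = shuffle_sum (\<lambda>z. lie F a (lift_coeff F f v z) y) u w + shuffle_sum (\<lambda>z. c z v) u w"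
  proof -
    have c: "c [] = (\<lambda>_. 0)" "c (b # r) = (\<lambda>w. (lie F a f y \<bullet> b) * lift_coeff F f w r y)" for b r
      by (simp_all add: c_def fun_eq_iff)
    have left: "unshuffle_sum v (c u) (\<lambda>v'. lift_coeff F f v' w y)
        = (case u of [] \<Rightarrow> 0 | b # u' \<Rightarrow> (lie F a f y \<bullet> b) * shuffle_sum (\<lambda>z. lift_coeff F f v z y) u' w)"
      by (cases u) (simp_all add: c unshuffle_sum_0 unshuffle_sum_scale Cons.IH)
    have right: "unshuffle_sum v (\<lambda>v'. lift_coeff F f v' u y) (c w)
        = (case w of [] \<Rightarrow> 0 | b # w' \<Rightarrow> (lie F a f y \<bullet> b) * shuffle_sum (\<lambda>z. lift_coeff F f v z y) u w')"
      by (cases w) (simp_all add: c unshuffle_sum_0 unshuffle_sum_scale Cons.IH)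
    show ?thesis unfolding left right
      by (cases u; cases w) (simp_all add: c_def shuffle_sum_scale)
  qed
  also have "\<dots> = shuffle_sum (\<lambda>z. lift_coeff F f (a # v) z y) u w"
    unfolding step shuffle_sum_add ..
  finally show ?case .
qed

text \<open>A letter of \<open>v\<close> either takes part in producing \<open>take k u\<close> or
  differentiates the coefficient of \<open>v'\<close>, as in a Taylor expansion of that coefficient
  from an earlier point. The choices are the unshuffles of \<open>v\<close>, and \<open>k\<close> is
  the cut of \<open>u\<close> in Chen's relation.\<close>

lemma lift_coeff_append:
  assumes "smooth F" "smooth f"
  shows "lift_coeff F f (v @ v') u y = (\<Sum>k\<le>length u.
    unshuffle_sum v (\<lambda>w. lift_coeff F f w (take k u) y) (\<lambda>w. vf_iter F w (lift_coeff F f v' (drop k u)) y))"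
proof (induction v arbitrary: u y)
  case Nil
  have "(\<Sum>k\<le>length u. (if take k u = [] then 1 else 0) * lift_coeff F f v' (drop k u) y)
      = (\<Sum>k\<in>{0}. (if take k u = [] then 1 else 0) * lift_coeff F f v' (drop k u) y)"
    by (rule sum.mono_neutral_right) auto
  then show ?case by simp
next
  case (Cons a v)
  note sm = smooth_lift_coeff[OF assms]
  define \<phi> where "\<phi> u = (\<lambda>w. lift_coeff F f w u y)" for u
  define \<psi> where "\<psi> u = (\<lambda>w. vf_iter F w (lift_coeff F f v' u) y)" for u
  define c where "c u v' = (case u of [] \<Rightarrow> 0 | b # u' \<Rightarrow> (lie F a f y \<bullet> b) * lift_coeff F f v' u' y)" for u v'
  have step: "lift_coeff F f (a # v') u y = lie F a (lift_coeff F f v' u) y + c u v'" for v' u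
    unfolding c_def by simp
  have "lie F a (lift_coeff F f (v @ v') u) y = (\<Sum>k\<le>length u.
      unshuffle_sum v (\<lambda>w. lie F a (lift_coeff F f w (take k u)) y) (\<psi> (drop k u))
      + unshuffle_sum v (\<phi> (take k u)) (\<lambda>w. \<psi> (drop k u) (a # w)))"
  proof -
    have "lie F a (lift_coeff F f (v @ v') u) y = lie F a (\<lambda>y. \<Sum>k\<le>length u.
        unshuffle_sum v (\<lambda>w. lift_coeff F f w (take k u) y)
          (\<lambda>w. vf_iter F w (lift_coeff F f v' (drop k u)) y)) y"
      unfolding Cons.IH[symmetric] ..
    also have "\<dots> = (\<Sum>k\<le>length u. lie F a (\<lambda>y. unshuffle_sum v (\<lambda>w. lift_coeff F f w (take k u) y)
          (\<lambda>w. vf_iter F w (lift_coeff F f v' (drop k u)) y)) y)"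
      by (rule lie_sum) (intro lie_unshuffle_sum(1) sm smooth_vf_iter assms)
    also have "\<dots> = (\<Sum>k\<le>length u.
        unshuffle_sum v (\<lambda>w. lie F a (lift_coeff F f w (take k u)) y) (\<psi> (drop k u))
        + unshuffle_sum v (\<phi> (take k u)) (\<lambda>w. \<psi> (drop k u) (a # w)))"
      unfolding \<phi>_def \<psi>_def vf_iter.simps
      by (intro sum.cong refl lie_unshuffle_sum(2) sm smooth_vf_iter assms)
    finally show ?thesis .
  qed
  moreover have "c u (v @ v') = (\<Sum>k\<le>length u. unshuffle_sum v (c (take k u)) (\<psi> (drop k u)))"
  proof (cases u)
    case Nil
    have "c [] = (\<lambda>_. 0)" by (simp add: c_def fun_eq_iff)
    then show ?thesis using Nil by (simp add: unshuffle_sum_0)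
  next
    case (Cons b u')
    have "(\<Sum>k\<le>length u. unshuffle_sum v (c (take k u)) (\<psi> (drop k u)))
      = unshuffle_sum v (c []) (\<psi> u) + (\<Sum>k\<le>length u'. unshuffle_sum v (c (b # take k u')) (\<psi> (drop k u')))"
      unfolding Cons by (simp only: list.size(4) add_Suc_right add_0_right sum.atMost_Suc_shift) simp
    moreover have "c [] = (\<lambda>_. 0)" "c (b # r) = (\<lambda>w. (lie F a f y \<bullet> b) * lift_coeff F f w r y)" for r
      by (simp_all add: c_def fun_eq_iff)
    ultimately show ?thesis
      by (simp add: Cons unshuffle_sum_0 unshuffle_sum_scale Cons.IH \<psi>_def sum_distrib_left
          del: take_Suc_Cons drop_Suc_Cons)
  qed
  ultimately show ?case
    unfolding append_Cons step unshuffle_sum.simps unshuffle_sum_add sum.distrib \<phi>_def \<psi>_def by simp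
qed

section \<open>The chain rule for the coefficients\<close>

lemma sum_words_upto_Suc:
  fixes f :: "'a::euclidean_space list \<Rightarrow> 'b::comm_monoid_add"
  shows "(\<Sum>w\<in>words_upto (Suc n). f w) = f [] + (\<Sum>a\<in>Basis. \<Sum>w\<in>words_upto n. f (a # w))"
proof -
  have "(words_upto (Suc n) :: 'a list set) = insert [] ((\<lambda>(a, w). a # w) ` (Basis \<times> words_upto n))"
  proof (intro equalityI subsetI)
    fix w :: "'a list" assume "w \<in> words_upto (Suc n)"
    then show "w \<in> insert [] ((\<lambda>(a, w). a # w) ` (Basis \<times> words_upto n))"
      by (cases w) (auto simp: words_upto_iff image_iff)
  qed (auto simp: words_upto_iff)
  then have "(\<Sum>w\<in>words_upto (Suc n). f w) = f [] + (\<Sum>w\<in>(\<lambda>(a, w). a # w) ` (Basis \<times> words_upto n). f w)"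
    by (simp add: image_iff)
  also have "(\<Sum>w\<in>(\<lambda>(a, w). a # w) ` (Basis \<times> words_upto n). f w) = (\<Sum>a\<in>Basis. \<Sum>w\<in>words_upto n. f (a # w))"
    unfolding sum.cartesian_product by (subst sum.reindex) (auto simp: inj_on_def case_prod_unfold)
  finally show ?thesis .
qed

abbreviation identity_field :: "'w::euclidean_space \<Rightarrow> 'w \<Rightarrow>\<^sub>L 'w" where
  "identity_field \<equiv> (\<lambda>_. id_blinfun)"

lemma lie_eq_sum_identity_field:
  assumes "smooth (h :: 'w::euclidean_space \<Rightarrow> real)"
  shows "(\<Sum>b\<in>Basis. (blinfun_apply (F y) a \<bullet> b) * lie identity_field b h y) = lie F a h y"
  using frechet_derivative_expand[OF smooth_differentiable[OF assms], of y "blinfun_apply (F y) a"] by simp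

text \<open>A leading letter \<open>a\<close> acts on the first coefficient by its derivative or by
  prepending some \<open>b\<close> to \<open>w\<close>. In the second case the inner recursion
  applies to \<open>b # w\<close>, and summing over \<open>b\<close> turns the derivatives in the
  directions \<open>b\<close> into the one along \<open>F y a\<close>. The product rule then
  reassembles the recursion for \<open>g\<close>.\<close>

lemma lift_coeff_compose:
  assumes "smooth F" "smooth g" "length v \<le> n"
  shows "(\<Sum>w\<in>words_upto n. lift_coeff F (\<lambda>y. y) v w y * lift_coeff identity_field g w u y) = lift_coeff F g v u y"
  using assms(3)
proof (induction v arbitrary: n u y)
  case Nil
  have "(\<Sum>w\<in>words_upto n. (if w = [] then 1 else 0) * lift_coeff identity_field g w u y)
      = (\<Sum>w\<in>{[]}. (if w = [] then 1 else 0) * lift_coeff identity_field g w u y)"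
    by (rule sum.mono_neutral_right) (auto simp: words_upto_iff)
  then show ?case by simp
next
  case (Cons a v)
  then obtain m where n: "n = Suc m" and m: "length v \<le> m" by (cases n) auto
  define e where "e = lift_coeff (identity_field :: 'a \<Rightarrow> 'a \<Rightarrow>\<^sub>L 'a) g"
  define d where "d = lift_coeff F (\<lambda>y. y) v"
  define c where "c h = (case u of [] \<Rightarrow> 0 | b # u' \<Rightarrow> (h \<bullet> b) * (\<Sum>w\<in>words_upto m. d w y * e w u' y))" for h
  have sm_e: "smooth (e w u)" for w u unfolding e_def by (intro smooth_lift_coeff smooth_const assms)
  have sm_d: "smooth (d w)" for w unfolding d_def by (intro smooth_lift_coeff smooth_ident assms)
  have sm_de: "smooth (\<lambda>y. d w y * e w u y)" for w by (intro smooth_mult sm_d sm_e)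
  have lie_id: "lie F a (\<lambda>y. y) y = blinfun_apply (F y) a"
    using frechet_derivative_eq[OF has_derivative_ident] by metis
  have "(\<Sum>w\<in>words_upto n. lift_coeff F (\<lambda>y. y) (a # v) w y * e w u y)
    = (\<Sum>w\<in>words_upto n. lie F a (d w) y * e w u y)
      + (\<Sum>w\<in>words_upto n. (case w of [] \<Rightarrow> 0 | b # w' \<Rightarrow> (blinfun_apply (F y) a \<bullet> b) * d w' y) * e w u y)"
    by (simp add: d_def lie_id distrib_right sum.distrib cong: list.case_cong)
  \<comment> \<open>Words of length \<open>n\<close> exceed \<open>v\<close>, so their coefficients
    vanish and this sum fits the induction hypothesis for \<open>m\<close>. The other sum loses one
    degree with the prepended letter.\<close>
  also have "(\<Sum>w\<in>words_upto n. lie F a (d w) y * e w u y) = (\<Sum>w\<in>words_upto m. lie F a (d w) y * e w u y)"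
  proof (rule sum.mono_neutral_right)
    show "\<forall>w\<in>words_upto n - words_upto m. lie F a (d w) y * e w u y = 0"
    proof
      fix w :: "'a list" assume "w \<in> words_upto n - words_upto m"
      then have "length v < length w" using m by (auto simp: words_upto_iff)
      then show "lie F a (d w) y * e w u y = 0" unfolding d_def by (simp add: lift_coeff_eq_0 lie_const)
    qed
  qed (auto simp: n words_upto_iff)
  also have "(\<Sum>w\<in>words_upto n. (case w of [] \<Rightarrow> 0 | b # w' \<Rightarrow> (blinfun_apply (F y) a \<bullet> b) * d w' y) * e w u y)
    = (\<Sum>w\<in>words_upto m. d w y * (\<Sum>b\<in>Basis. (blinfun_apply (F y) a \<bullet> b) * e (b # w) u y))"
    unfolding n sum_words_upto_Suc by (simp, subst sum.swap) (simp add: sum_distrib_left mult_ac)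
  also have "\<dots> = (\<Sum>w\<in>words_upto m. d w y * lie F a (e w u) y) + c (lie F a g y)"
  proof -
    have "(\<Sum>b\<in>Basis. (blinfun_apply (F y) a \<bullet> b) * e (b # w) u y) = lie F a (e w u) y
        + (case u of [] \<Rightarrow> 0 | b # u' \<Rightarrow> (lie F a g y \<bullet> b) * e w u' y)" for w
    proof (cases u)
      case Nil
      then show ?thesis using lie_eq_sum_identity_field[OF sm_e] unfolding e_def by simp
    next
      case (Cons b u')
      have "(\<Sum>x\<in>Basis. (blinfun_apply (F y) a \<bullet> x) * (lie identity_field x g y \<bullet> b)) = lie F a g y \<bullet> b"
        using lie_eq_sum_identity_field[OF smooth_linear[OF bounded_linear_inner_left assms(2)], of F y a b]
        unfolding frechet_derivative_eq[OF bounded_linear.has_derivative[OF bounded_linear_inner_left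
            smooth_has_derivative[OF assms(2)]]] .
      then show ?thesis using lie_eq_sum_identity_field[OF sm_e, of F y a w u] Cons unfolding e_def
        by (simp add: distrib_left sum.distrib mult.assoc[symmetric] flip: sum_distrib_right)
    qed
    then show ?thesis
      by (cases u) (simp_all add: c_def distrib_left sum.distrib sum_distrib_left mult_ac)
  qed
  also have "(\<Sum>w\<in>words_upto m. lie F a (d w) y * e w u y) + ((\<Sum>w\<in>words_upto m. d w y * lie F a (e w u) y) + c (lie F a g y))
    = lie F a (\<lambda>y. \<Sum>w\<in>words_upto m. d w y * e w u y) y + c (lie F a g y)"
  proof -
    have "lie F a (\<lambda>y. \<Sum>w\<in>words_upto m. d w y * e w u y) y
        = (\<Sum>w\<in>words_upto m. lie F a (\<lambda>y. d w y * e w u y) y)"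
      by (rule lie_sum[OF sm_de])
    also have "\<dots> = (\<Sum>w\<in>words_upto m. lie F a (d w) y * e w u y + d w y * lie F a (e w u) y)"
      by (intro sum.cong refl lie_mult sm_d sm_e)
    finally show ?thesis by (simp add: sum.distrib)
  qed
  also have "\<dots> = lift_coeff F g (a # v) u y"
    unfolding c_def d_def e_def by (simp add: Cons.IH[OF m] cong: list.case_cong)
  finally show ?case unfolding e_def .
qed

text \<open>The chain rule read in degree one of a real-valued \<open>h\<close>, with
  \<open>1\<close> as the basis vector of the reals. The empty \<open>v\<close> is separate because
  its degree-one coefficient is 0.\<close>

lemma vf_iter_eq_sum_lift_coeff:
  fixes h :: "'w::euclidean_space \<Rightarrow> real"
  assumes "smooth F" "smooth h" "length v \<le> n"
  shows "vf_iter F v h y = (\<Sum>w\<in>words_upto n. lift_coeff F (\<lambda>y. y) v w y * vf_iter identity_field w h y)"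
proof (cases "v = []")
  case True
  have "(\<Sum>w\<in>words_upto n. (if w = [] then 1 else 0) * vf_iter identity_field w h y)
      = (\<Sum>w\<in>{[]}. (if w = [] then 1 else 0) * vf_iter identity_field w h y)"
    by (rule sum.mono_neutral_right) (auto simp: words_upto_iff)
  then show ?thesis using True by simp
next
  case False
  have "(\<Sum>w\<in>words_upto n. lift_coeff F (\<lambda>y. y) v w y * lift_coeff identity_field h w [1] y)
      = (\<Sum>w\<in>words_upto n. lift_coeff F (\<lambda>y. y) v w y * vf_iter identity_field w h y)"
  proof (rule sum.cong[OF refl])
    fix w :: "'w list"
    show "lift_coeff F (\<lambda>y. y) v w y * lift_coeff identity_field h w [1] y
        = lift_coeff F (\<lambda>y. y) v w y * vf_iter identity_field w h y"
      using False assms by (cases "w = []") (simp_all add: lift_coeff_Nil lift_coeff_single smooth_const)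
  qed
  then show ?thesis
    using lift_coeff_compose[OF assms, of y "[1]"] False assms by (simp add: lift_coeff_single)
qed

text \<open>\<open>\<iota>\<close> is adjoint to \<open>L\<close>; for a coordinate projection it is
  the inclusion of the factor.\<close>

lemma lift_coeff_map:
  assumes "smooth F" "smooth f" "bounded_linear L" "\<And>x b. x \<bullet> \<iota> b = L x \<bullet> b"
  shows "lift_coeff F f v (map \<iota> u) = lift_coeff F (\<lambda>y. L (f y)) v u"
proof (induction v arbitrary: u)
  case (Cons a v)
  have "lift_coeff F f (a # v) (map \<iota> u) y = lift_coeff F (\<lambda>y. L (f y)) (a # v) u y" for y
  proof (cases u)
    case Nil
    then show ?thesis using Cons[of "[]"] by simp
  next
    case u: (Cons b u')
    show ?thesis
      using Cons[of u] Cons[of u'] by (simp add: u assms(4) lie_linear[OF assms(3,2)])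
  qed
  then show ?case by blast
qed simp

text \<open>A word with a cut is the same as the pair of its two pieces.\<close>

lemma sum_tmult:
  "(\<Sum>v\<in>words_upto n. tmult x y v * (\<phi> v :: real)) = (\<Sum>v\<in>words_upto n. \<Sum>w\<in>words_upto n.
    if length v + length w \<le> n then x v * y w * \<phi> (v @ w) else 0)"
proof -
  have "(\<Sum>v\<in>words_upto n. tmult x y v * \<phi> v)
      = (\<Sum>(v, k)\<in>(SIGMA v:words_upto n. {..length v}). x (take k v) * y (drop k v) * \<phi> v)"
    unfolding tmult_def by (simp add: sum.Sigma[symmetric] sum_distrib_right)
  also have "\<dots> = (\<Sum>(v, w)\<in>{(v, w). v \<in> words_upto n \<and> w \<in> words_upto n \<and> length v + length w \<le> n}.
      x v * y w * \<phi> (v @ w))"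
    by (rule sum.reindex_bij_witness[of _ "\<lambda>(v, w). (v @ w, length v)" "\<lambda>(v, k). (take k v, drop k v)"])
      (auto simp: words_upto_iff min_def, (meson in_set_takeD in_set_dropD subsetD)+)
  also have "\<dots> = (\<Sum>(v, w)\<in>words_upto n \<times> words_upto n. if length v + length w \<le> n then x v * y w * \<phi> (v @ w) else 0)"
    by (rule sum.mono_neutral_cong_left) (auto split: if_splits)
  finally show ?thesis by (simp add: sum.cartesian_product)
qed

section \<open>Expansions along a rough path\<close>

context rough_setting
begin

lemma bigO_abs: "bigO k a \<Longrightarrow> bigO k (\<lambda>s u t. \<bar>a s u t\<bar>)"
  unfolding bigO_def by simp

lemma rough_path_multiplicative:
  assumes "X \<in> rough_paths \<omega> p T"
  shows "multiplicative N X"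
  using assms unfolding rough_paths_def multiplicative_def simplex2_def by auto

lemma rough_path_bigO:
  assumes X: "X \<in> rough_paths \<omega> p T" and v: "v \<in> words_upto N"
  shows "bigO (length v) (\<lambda>s u t. X s t v)"
proof (cases "v = []")
  case True
  have "bigO 0 (\<lambda>s u t. X s t []) \<longleftrightarrow> bigO 0 (\<lambda>s u t. 1)"
    by (rule bigO_cong) (use multiplicative_Nil[OF rough_path_multiplicative[OF X]] in auto)
  then show ?thesis using True bigO_const by simp
next
  case False
  then have n: "length v \<in> {1..N}" "v \<in> words (length v)"
    using v by (simp_all add: words_upto_iff in_words_iff Suc_le_eq)
  have "\<forall>n\<in>{1..N}. \<exists>C. \<forall>(s, t)\<in>simplex2 T. tnorm n (X s t) \<le> C * \<omega> s t powr (real n / p)"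
    using X unfolding rough_paths_def mem_Collect_eq by (elim conjE)
  from bspec[OF this n(1)] obtain C
    where C: "\<forall>(s, t)\<in>simplex2 T. tnorm (length v) (X s t) \<le> C * \<omega> s t powr (real (length v) / p)"
    by (rule exE)
  show ?thesis
  proof (rule bigOI[where C = C])
    fix s u t :: real assume "0 \<le> s" "s \<le> u" "u \<le> t" "t \<le> T"
    then have "tnorm (length v) (X s t) \<le> C * weight (length v) s t"
      using C False by (auto simp: simplex2_def weight_def)
    moreover have "\<bar>X s t v\<bar> \<le> tnorm (length v) (X s t)"
    proof -
      have "(X s t v)\<^sup>2 \<le> (\<Sum>w\<in>words (length v). (X s t w)\<^sup>2)"
        using n(2) by (intro member_le_sum) auto
      then have "sqrt ((X s t v)\<^sup>2) \<le> sqrt (\<Sum>w\<in>words (length v). (X s t w)\<^sup>2)" by (rule real_sqrt_le_mono)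
      then show ?thesis unfolding tnorm_def L2_set_def by simp
    qed
    ultimately show "\<bar>X s t v\<bar> \<le> C * weight (length v) s t" by linarith
  qed
qed

lemma rough_path_shuffle:
  assumes X: "X \<in> rough_paths \<omega> p T" and st: "0 \<le> s" "s \<le> t" "t \<le> T"
    and vw: "v \<in> words_upto N" "w \<in> words_upto N" "length v + length w \<le> N"
  shows "X s t v * X s t w = shuffle_sum (X s t) v w"
proof -
  have vw': "v \<in> words (length v)" "w \<in> words (length w)" using vw by (auto simp: words_upto_iff in_words_iff)
  have "(s, t) \<in> simplex2 T" using st by (simp add: simplex2_def)
  then have "X s t v * X s t w = Delta_sh (length v) (length w) (X s t) [v, w]"
    using X vw(3) vw' unfolding rough_paths_def by blast
  then show ?thesis using Delta_sh_eq_shuffle_sum[OF vw'] by simp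
qed

text \<open>For total length at most \<open>N\<close> the shuffle relation of \<open>X\<close> turns
  the product into the unshuffle sum. For longer pairs \<open>X s t v * X s t w\<close> is of order
  at least \<open>Suc N\<close>.\<close>

lemma expansion_mult:
  assumes X: "X \<in> rough_paths \<omega> p T"
    and bounded: "\<And>v. bigO 0 (\<lambda>s u t. \<phi> v s)" "\<And>v. bigO 0 (\<lambda>s u t. \<psi> v s)"
  shows "bigO (Suc N) (\<lambda>s u t. (\<Sum>v\<in>words_upto N. X s t v * \<phi> v s) * (\<Sum>w\<in>words_upto N. X s t w * \<psi> w s)
    - (\<Sum>z\<in>words_upto N. X s t z * unshuffle_sum z (\<lambda>v. \<phi> v s) (\<lambda>w. \<psi> w s)))"
proof -
  have "bigO (Suc N) (\<lambda>s u t. \<Sum>v\<in>words_upto N. \<Sum>w\<in>words_upto N.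
      if length v + length w \<le> N then 0 else (X s t v * \<phi> v s) * (X s t w * \<psi> w s))"
  proof (intro bigO_sum)
    fix v w :: "'a list" assume vw: "v \<in> words_upto N" "w \<in> words_upto N"
    show "bigO (Suc N) (\<lambda>s u t. if length v + length w \<le> N then 0 else (X s t v * \<phi> v s) * (X s t w * \<psi> w s))"
    proof (cases "length v + length w \<le> N")
      case False
      have "bigO ((length v + 0) + (length w + 0)) (\<lambda>s u t. (X s t v * \<phi> v s) * (X s t w * \<psi> w s))"
        by (intro bigO_mult rough_path_bigO X vw bounded)
      then show ?thesis using False by (auto elim: bigO_mono)
    qed (simp add: bigO_zero)
  qed
  also have "?this \<longleftrightarrow> ?thesis"
  proof (rule bigO_cong)
    fix s u t :: real assume st: "0 \<le> s" "s \<le> u" "u \<le> t" "t \<le> T"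
    have "(\<Sum>v\<in>words_upto N. X s t v * \<phi> v s) * (\<Sum>w\<in>words_upto N. X s t w * \<psi> w s)
        - (\<Sum>z\<in>words_upto N. X s t z * unshuffle_sum z (\<lambda>v. \<phi> v s) (\<lambda>w. \<psi> w s))
      = (\<Sum>v\<in>words_upto N. \<Sum>w\<in>words_upto N. (X s t v * \<phi> v s) * (X s t w * \<psi> w s)
        - (if length v + length w \<le> N then shuffle_sum (X s t) v w * \<phi> v s * \<psi> w s else 0))"
      unfolding sum_product sum_subtractf sum_shuffle_sum ..
    also have "\<dots> = (\<Sum>v\<in>words_upto N. \<Sum>w\<in>words_upto N.
        if length v + length w \<le> N then 0 else (X s t v * \<phi> v s) * (X s t w * \<psi> w s))"
      using rough_path_shuffle[OF X _ _ _, of s t] st by (intro sum.cong refl) auto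
    finally show "(\<Sum>v\<in>words_upto N. \<Sum>w\<in>words_upto N.
        if length v + length w \<le> N then 0 else (X s t v * \<phi> v s) * (X s t w * \<psi> w s))
      = (\<Sum>v\<in>words_upto N. X s t v * \<phi> v s) * (\<Sum>w\<in>words_upto N. X s t w * \<psi> w s)
        - (\<Sum>z\<in>words_upto N. X s t z * unshuffle_sum z (\<lambda>v. \<phi> v s) (\<lambda>w. \<psi> w s))" ..
  qed
  finally show ?thesis .
qed

lemma smooth_along_path:
  fixes h :: "'w::euclidean_space \<Rightarrow> real"
  assumes "continuous_on {0..T} Y" "smooth h"
  shows "bigO 0 (\<lambda>s u t. h (Y s))" "bigO 0 (\<lambda>s u t. h (Y u))" "bigO 0 (\<lambda>s u t. h (Y t))"
proof -
  have "continuous_on {0..T} (\<lambda>t. h (Y t))"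
    by (rule continuous_on_compose2[OF smooth_continuous_on[OF assms(2), of UNIV] assms(1)]) simp
  then show "bigO 0 (\<lambda>s u t. h (Y s))" "bigO 0 (\<lambda>s u t. h (Y u))" "bigO 0 (\<lambda>s u t. h (Y t))"
    by (rule bigO_continuous)+
qed

lemma sum_pairing_eq_sum_words:
  fixes h :: "'v::euclidean_space list \<Rightarrow> real"
  shows "(\<Sum>n=1..m. pairing n h x) = (\<Sum>v\<in>words_upto m. x v * h v) - x [] * h []"
proof -
  have "(\<Sum>v\<in>words_upto m. x v * h v) = (\<Sum>n\<in>{..m}. \<Sum>v\<in>words n. x v * h v)"
    unfolding words_upto_def by (rule sum.UNION_disjoint) (auto simp: in_words_iff)
  also have "\<dots> = (\<Sum>n\<in>{1..m}. \<Sum>v\<in>words n. x v * h v) + x [] * h []"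
    by (simp add: atMost_atLeast0 sum.atLeast_Suc_atMost words_0)
  finally show ?thesis by (simp add: pairing_def)
qed

text \<open>The value \<open>h (Y s)\<close> becomes the term of the empty word, which lets the
  identities for words act on one uniform sum.\<close>

lemma rde_solution_iff:
  assumes X: "X \<in> rough_paths \<omega> p T"
  shows "rde_solution \<omega> p T X F y0 Y \<longleftrightarrow> continuous_on {0..T} Y \<and> Y 0 = y0 \<and>
    (\<forall>h :: 'w::euclidean_space \<Rightarrow> real. smooth h \<longrightarrow>
      bigO (Suc N) (\<lambda>s u t. h (Y t) - (\<Sum>v\<in>words_upto N. X s t v * vf_iter F v h (Y s))))"
proof -
  have "approx \<omega> p T (N + 1) (\<lambda>s t. h (Y t) - h (Y s))
      (\<lambda>s t. \<Sum>n=1..N. pairing n (\<lambda>w. vf_iter F w h (Y s)) (X s t))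
    \<longleftrightarrow> bigO (Suc N) (\<lambda>s u t. h (Y t) - (\<Sum>v\<in>words_upto N. X s t v * vf_iter F v h (Y s)))"
    for h :: "'w \<Rightarrow> real"
  proof -
    have "bigO (Suc N) (\<lambda>s u t. h (Y t) - h (Y s) - (\<Sum>n=1..N. pairing n (\<lambda>w. vf_iter F w h (Y s)) (X s t)))
      \<longleftrightarrow> bigO (Suc N) (\<lambda>s u t. h (Y t) - (\<Sum>v\<in>words_upto N. X s t v * vf_iter F v h (Y s)))"
      unfolding sum_pairing_eq_sum_words
      by (rule bigO_cong) (use multiplicative_Nil[OF rough_path_multiplicative[OF X]] in auto)
    then show ?thesis by (simp add: approx_iff_bigO)
  qed
  then show ?thesis unfolding rde_solution_def by simp
qed

lemma rde_solution_compose: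
  fixes \<gamma> :: "'w::euclidean_space \<Rightarrow> 'z::euclidean_space"
  assumes X: "X \<in> rough_paths \<omega> p T" and Y: "rde_solution \<omega> p T X F y0 Y"
    and G: "smooth G" and \<gamma>: "smooth \<gamma>"
    and related: "\<And>y v. frechet_derivative \<gamma> (at y) (blinfun_apply (F y) v) = blinfun_apply (G (\<gamma> y)) v"
  shows "rde_solution \<omega> p T X G (\<gamma> y0) (\<lambda>t. \<gamma> (Y t))"
  unfolding rde_solution_iff[OF X]
proof (intro conjI allI impI)
  show "continuous_on {0..T} (\<lambda>t. \<gamma> (Y t))"
    using Y unfolding rde_solution_def
    by (intro continuous_on_compose2[OF smooth_continuous_on[OF \<gamma>, of UNIV]]) auto
  show "\<gamma> (Y 0) = \<gamma> y0" using Y unfolding rde_solution_def by simp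
next
  fix h :: "'z \<Rightarrow> real" assume h: "smooth h"
  have "bigO (Suc N) (\<lambda>s u t. h (\<gamma> (Y t)) - (\<Sum>v\<in>words_upto N. X s t v * vf_iter F v (\<lambda>y. h (\<gamma> y)) (Y s)))"
    using Y smooth_compose[OF h \<gamma>] unfolding rde_solution_iff[OF X] by blast
  then show "bigO (Suc N) (\<lambda>s u t. h (\<gamma> (Y t)) - (\<Sum>v\<in>words_upto N. X s t v * vf_iter G v h (\<gamma> (Y s))))"
    unfolding vf_iter_compose[of G h \<gamma> F, OF G h \<gamma> related] .
qed

text \<open>Words longer than \<open>k\<close> are of order \<open>Suc k\<close> already, their
  coefficients being bounded along the continuous path \<open>Y\<close>.\<close>

lemma rde_solution_truncated:
  fixes h :: "'w::euclidean_space \<Rightarrow> real" and X :: "real \<Rightarrow> real \<Rightarrow> 'v::euclidean_space tensor"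
  assumes X: "X \<in> rough_paths \<omega> p T" and Y: "rde_solution \<omega> p T X F y0 Y" and F: "smooth F"
    and h: "smooth h" and k: "k \<le> N"
  shows "bigO (Suc k) (\<lambda>s u t. h (Y t) - (\<Sum>v\<in>words_upto k. X s t v * vf_iter F v h (Y s)))"
proof -
  have cont: "continuous_on {0..T} Y" using Y unfolding rde_solution_def by blast
  have 1: "bigO (Suc k) (\<lambda>s u t. h (Y t) - (\<Sum>v\<in>words_upto N. X s t v * vf_iter F v h (Y s)))"
    using Y h k unfolding rde_solution_iff[OF X] by (auto elim!: bigO_mono)
  have 2: "bigO (Suc k) (\<lambda>s u t. \<Sum>v\<in>words_upto N - words_upto k. X s t v * vf_iter F v h (Y s))"
  proof (intro bigO_sum)
    fix v :: "'v list" assume v: "v \<in> words_upto N - words_upto k"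
    then have "Suc k \<le> length v + 0" by (auto simp: words_upto_iff)
    moreover have "v \<in> words_upto N" using v by simp
    ultimately show "bigO (Suc k) (\<lambda>s u t. X s t v * vf_iter F v h (Y s))"
      by (intro bigO_times[OF rough_path_bigO[OF X] smooth_along_path(1)[OF cont smooth_vf_iter[OF F h]]])
  qed
  have sub: "words_upto k \<subseteq> words_upto N" using k by (auto simp: words_upto_iff)
  have eq: "h (Y t) - (\<Sum>v\<in>words_upto k. X s t v * vf_iter F v h (Y s))
    = (h (Y t) - (\<Sum>v\<in>words_upto N. X s t v * vf_iter F v h (Y s)))
      + (\<Sum>v\<in>words_upto N - words_upto k. X s t v * vf_iter F v h (Y s))" for s t
    by (simp add: sum_diff[OF _ sub])
  show ?thesis unfolding eq by (rule bigO_add[OF 1 2])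
qed

definition lift_expansion ::
    "(real \<Rightarrow> real \<Rightarrow> 'v::euclidean_space tensor) \<Rightarrow> ('w::euclidean_space \<Rightarrow> 'v \<Rightarrow>\<^sub>L 'w) \<Rightarrow>
     ('w \<Rightarrow> 'u::euclidean_space) \<Rightarrow> (real \<Rightarrow> 'w) \<Rightarrow> real \<Rightarrow> real \<Rightarrow> 'u tensor" where
  "lift_expansion X F f Y s t u = (\<Sum>v\<in>words_upto N. X s t v * lift_coeff F f v u (Y s))"

lemma lift_expansion_Nil:
  assumes X: "X \<in> rough_paths \<omega> p T" and st: "0 \<le> s" "s \<le> t" "t \<le> T"
  shows "lift_expansion X F f Y s t [] = 1"
proof -
  have "lift_expansion X F f Y s t [] = (\<Sum>v\<in>words_upto N. if v = [] then X s t v else 0)"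
    unfolding lift_expansion_def lift_coeff_Nil by (intro sum.cong) auto
  also have "\<dots> = 1"
    using multiplicative_Nil[OF rough_path_multiplicative[OF X] st] by (simp add: words_upto_iff)
  finally show ?thesis .
qed

context
  fixes X :: "real \<Rightarrow> real \<Rightarrow> 'v::euclidean_space tensor" and F :: "'w::euclidean_space \<Rightarrow> 'v \<Rightarrow>\<^sub>L 'w"
    and y0 :: 'w and Y :: "real \<Rightarrow> 'w" and f :: "'w \<Rightarrow> 'u::euclidean_space"
  assumes X: "X \<in> rough_paths \<omega> p T" and F: "smooth F" and Y: "rde_solution \<omega> p T X F y0 Y" and f: "smooth f"
begin

lemma solution_continuous: "continuous_on {0..T} Y"
  using Y unfolding rde_solution_def by blast

lemma coeff_bounded: "bigO 0 (\<lambda>s r t. lift_coeff F f v u (Y s))"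
  by (rule smooth_along_path(1)[OF solution_continuous smooth_lift_coeff[OF F f]])

lemma lift_expansion_bigO:
  assumes "length u \<le> N"
  shows "bigO (length u) (\<lambda>s r t. lift_expansion X F f Y s t u)"
  unfolding lift_expansion_def
proof (rule bigO_sum)
  fix v :: "'v list" assume v: "v \<in> words_upto N"
  show "bigO (length u) (\<lambda>s r t. X s t v * lift_coeff F f v u (Y s))"
  proof (cases "length v < length u")
    case True
    then show ?thesis by (simp add: lift_coeff_eq_0 bigO_zero)
  next
    case False
    then show ?thesis by (intro bigO_times[OF rough_path_bigO[OF X v] coeff_bounded]) simp
  qed
qed

lemma lift_expansion_single:
  "bigO (Suc N) (\<lambda>s r t. lift_expansion X F f Y s t [b] - (f (Y t) - f (Y s)) \<bullet> b)"
proof -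
  define h where "h y = f y \<bullet> b" for y
  have "smooth h" unfolding h_def by (rule smooth_linear[OF bounded_linear_inner_left f])
  then have "bigO (Suc N) (\<lambda>s r t. h (Y t) - (\<Sum>v\<in>words_upto N. X s t v * vf_iter F v h (Y s)))"
    using Y unfolding rde_solution_iff[OF X] by blast
  from bigO_uminus[OF this] show ?thesis
  proof (rule bigO_cong[THEN iffD1, rotated])
    fix s r t :: real assume st: "0 \<le> s" "s \<le> r" "r \<le> t" "t \<le> T"
    have "(\<Sum>v\<in>words_upto N. X s t v * vf_iter F v h (Y s)) - lift_expansion X F f Y s t [b]
        = (\<Sum>v\<in>words_upto N. X s t v * (vf_iter F v h (Y s) - lift_coeff F f v [b] (Y s)))"
      unfolding lift_expansion_def by (simp add: sum_subtractf right_diff_distrib)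
    \<comment> \<open>The coefficients agree on nonempty words. On the empty word
      \<open>lift_coeff\<close> gives 0 and not \<open>h (Y s)\<close>, which turns the value of
      \<open>h\<close> into an increment.\<close>
    also have "\<dots> = (\<Sum>v\<in>(words_upto N :: 'v list set). if v = [] then h (Y s) else 0)"
    proof (rule sum.cong[OF refl])
      fix v :: "'v list"
      show "X s t v * (vf_iter F v h (Y s) - lift_coeff F f v [b] (Y s)) = (if v = [] then h (Y s) else 0)"
        using multiplicative_Nil[OF rough_path_multiplicative[OF X]] st
        by (cases "v = []") (simp_all add: lift_coeff_single[OF F f] vf_iter_inner[OF F f] h_def[abs_def])
    qed
    also have "\<dots> = h (Y s)" by (simp add: words_upto_iff)
    finally show "- (h (Y t) - (\<Sum>v\<in>words_upto N. X s t v * vf_iter F v h (Y s)))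
        = lift_expansion X F f Y s t [b] - (f (Y t) - f (Y s)) \<bullet> b"
      unfolding h_def by (simp add: inner_diff_left)
  qed
qed

text \<open>Chen's relation for \<open>X\<close> cuts the words, \<open>lift_coeff_append\<close>
  cuts \<open>u\<close>. Up to order \<open>Suc N\<close> the unshuffle sum over the left pieces
  factors into the expansion at \<open>take k u\<close> over \<open>[s, r]\<close> and the expansion
  of the coefficient of the right piece from \<open>Y s\<close> to \<open>Y r\<close>.\<close>

lemma lift_expansion_chen:
  "bigO (Suc N) (\<lambda>s r t. lift_expansion X F f Y s t u - tmult (lift_expansion X F f Y s r) (lift_expansion X F f Y r t) u)"
proof -
  define \<phi> where "\<phi> k w s = lift_coeff F f w (take k u) (Y s)" for k w s
  define \<psi> where "\<psi> k v w s = vf_iter F w (lift_coeff F f v (drop k u)) (Y s)" for k v w s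
  define U where "U k v' v s = unshuffle_sum v' (\<lambda>w. \<phi> k w s) (\<lambda>w. \<psi> k v w s)" for k v' v s
  have \<phi>: "bigO 0 (\<lambda>s r t. \<phi> k w s)" for k w
    unfolding \<phi>_def by (rule coeff_bounded)
  have \<psi>: "bigO 0 (\<lambda>s r t. \<psi> k v w s)" for k v w
    unfolding \<psi>_def by (rule smooth_along_path(1)[OF solution_continuous smooth_vf_iter[OF F smooth_lift_coeff[OF F f]]])
  have U: "bigO 0 (\<lambda>s r t. U k v' v s)" for k v' v
    unfolding U_def \<phi>_def \<psi>_def
    by (rule smooth_along_path(1)[OF solution_continuous lie_unshuffle_sum(1)])
      (intro smooth_lift_coeff smooth_vf_iter F f)+
  have X_right: "bigO (length v) (\<lambda>s r t. X r t v)" if "v \<in> words_upto N" for v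
    by (rule bigO_right[OF rough_path_bigO[OF X that]])
  have X_left: "bigO (length v) (\<lambda>s r t. X s r v)" if "v \<in> words_upto N" for v
    by (rule bigO_left[OF rough_path_bigO[OF X that]])
  have X_right0: "bigO 0 (\<lambda>s r t. X r t v)" if "v \<in> words_upto N" for v
    by (rule bigO_mono[OF X_right[OF that]]) simp
  have A_left: "bigO 0 (\<lambda>s r t. \<Sum>v\<in>words_upto N. X s r v * \<phi> k v s)" for k
    by (intro bigO_sum bigO_times[OF X_left \<phi>]) auto
  \<comment> \<open>Pairs of total length above \<open>N\<close> are missing from the truncated
    product but are of order \<open>Suc N\<close>. Adding them makes the double sum unrestricted, so
    that it can be factored.\<close>
  have 1: "bigO (Suc N) (\<lambda>s r t. lift_expansion X F f Y s t u
      - (\<Sum>v'\<in>words_upto N. \<Sum>v\<in>words_upto N. X s r v' * X r t v * (\<Sum>k\<le>length u. U k v' v s)))"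
  proof -
    have "bigO (Suc N) (\<lambda>s r t. - (\<Sum>v'\<in>words_upto N. \<Sum>v\<in>words_upto N.
        if length v' + length v \<le> N then 0 else X s r v' * X r t v * (\<Sum>k\<le>length u. U k v' v s)))"
    proof (intro bigO_uminus bigO_sum)
      fix v' v :: "'v list" assume v: "v' \<in> words_upto N" "v \<in> words_upto N"
      show "bigO (Suc N) (\<lambda>s r t. if length v' + length v \<le> N then 0 else X s r v' * X r t v * (\<Sum>k\<le>length u. U k v' v s))"
      proof (cases "length v' + length v \<le> N")
        case False
        have "bigO ((length v' + length v) + 0) (\<lambda>s r t. X s r v' * X r t v * (\<Sum>k\<le>length u. U k v' v s))"
          by (intro bigO_mult X_left X_right v bigO_sum U)
        then show ?thesis using False by (auto elim: bigO_mono)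
      qed (simp add: bigO_zero)
    qed
    then show ?thesis
    proof (rule bigO_cong[THEN iffD1, rotated])
      fix s r t :: real assume st: "0 \<le> s" "s \<le> r" "r \<le> t" "t \<le> T"
      have "lift_expansion X F f Y s t u = (\<Sum>v\<in>words_upto N. tmult (X s r) (X r t) v * lift_coeff F f v u (Y s))"
        unfolding lift_expansion_def
        by (intro sum.cong refl arg_cong2[of _ _ _ _ "(*)"] multiplicative_tmult[OF rough_path_multiplicative[OF X] st])
      also have "\<dots> = (\<Sum>v'\<in>words_upto N. \<Sum>v\<in>words_upto N. if length v' + length v \<le> N
          then X s r v' * X r t v * (\<Sum>k\<le>length u. U k v' v s) else 0)"
        unfolding sum_tmult lift_coeff_append[OF F f] U_def \<phi>_def \<psi>_def ..
      finally show "- (\<Sum>v'\<in>words_upto N. \<Sum>v\<in>words_upto N.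
          if length v' + length v \<le> N then 0 else X s r v' * X r t v * (\<Sum>k\<le>length u. U k v' v s))
        = lift_expansion X F f Y s t u
          - (\<Sum>v'\<in>words_upto N. \<Sum>v\<in>words_upto N. X s r v' * X r t v * (\<Sum>k\<le>length u. U k v' v s))"
        by (simp add: sum_subtractf[symmetric] sum_negf[symmetric] if_distrib cong: if_cong)
          (intro sum.cong refl, simp)
    qed
  qed
  have swap: "(\<Sum>v'\<in>words_upto N. \<Sum>v\<in>words_upto N. X s r v' * X r t v * (\<Sum>k\<le>length u. U k v' v s))
      = (\<Sum>k\<le>length u. \<Sum>v\<in>words_upto N. X r t v * (\<Sum>v'\<in>words_upto N. X s r v' * U k v' v s))" for s r t
  proof -
    have "(\<Sum>v'\<in>words_upto N. \<Sum>v\<in>words_upto N. X s r v' * X r t v * (\<Sum>k\<le>length u. U k v' v s))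
      = (\<Sum>v\<in>words_upto N. \<Sum>v'\<in>words_upto N. \<Sum>k\<le>length u. X r t v * (X s r v' * U k v' v s))"
      by (subst sum.swap) (simp add: sum_distrib_left mult_ac)
    also have "\<dots> = (\<Sum>v\<in>words_upto N. \<Sum>k\<le>length u. \<Sum>v'\<in>words_upto N. X r t v * (X s r v' * U k v' v s))"
      by (intro sum.cong refl sum.swap)
    also have "\<dots> = (\<Sum>k\<le>length u. \<Sum>v\<in>words_upto N. \<Sum>v'\<in>words_upto N. X r t v * (X s r v' * U k v' v s))"
      by (rule sum.swap)
    finally show ?thesis by (simp add: sum_distrib_left)
  qed
  have 2: "bigO (Suc N) (\<lambda>s r t. (\<Sum>k\<le>length u. \<Sum>v\<in>words_upto N. X r t v * (\<Sum>v'\<in>words_upto N. X s r v' * U k v' v s))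
    - (\<Sum>k\<le>length u. \<Sum>v\<in>words_upto N. X r t v * ((\<Sum>w\<in>words_upto N. X s r w * \<phi> k w s) * lift_coeff F f v (drop k u) (Y r))))"
  proof (intro bigO_sum_diff)
    fix k and v :: "'v list" assume v: "v \<in> words_upto N"
    have "bigO (Suc N) (\<lambda>s r t. (\<Sum>v'\<in>words_upto N. X s r v' * U k v' v s)
        - (\<Sum>w\<in>words_upto N. X s r w * \<phi> k w s) * (\<Sum>w\<in>words_upto N. X s r w * \<psi> k v w s))"
      unfolding U_def by (rule bigO_swap[OF bigO_left[OF expansion_mult[OF X \<phi> \<psi>]]])
    moreover have "bigO (Suc N) (\<lambda>s r t. (\<Sum>w\<in>words_upto N. X s r w * \<phi> k w s) * (\<Sum>w\<in>words_upto N. X s r w * \<psi> k v w s)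
        - (\<Sum>w\<in>words_upto N. X s r w * \<phi> k w s) * lift_coeff F f v (drop k u) (Y r))"
    proof -
      \<comment> \<open>The coefficient itself serves as the test function of the equation for
        \<open>Y\<close>, which moves its base point from \<open>Y s\<close> to
        \<open>Y r\<close>.\<close>
      have "bigO (Suc N) (\<lambda>s r t. lift_coeff F f v (drop k u) (Y t)
          - (\<Sum>w\<in>words_upto N. X s t w * vf_iter F w (lift_coeff F f v (drop k u)) (Y s)))"
        using Y smooth_lift_coeff[OF F f] unfolding rde_solution_iff[OF X] by blast
      from bigO_swap[OF bigO_left[OF this]]
      have "bigO (0 + Suc N) (\<lambda>s r t. (\<Sum>w\<in>words_upto N. X s r w * \<phi> k w s) *
        ((\<Sum>w\<in>words_upto N. X s r w * \<psi> k v w s) - lift_coeff F f v (drop k u) (Y r)))"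
        unfolding \<psi>_def by (intro bigO_mult A_left)
      then show ?thesis by (simp add: right_diff_distrib)
    qed
    ultimately have "bigO (Suc N) (\<lambda>s r t. (\<Sum>v'\<in>words_upto N. X s r v' * U k v' v s)
        - (\<Sum>w\<in>words_upto N. X s r w * \<phi> k w s) * lift_coeff F f v (drop k u) (Y r))"
      by (rule bigO_trans)
    from bigO_mult[OF X_right0[OF v] this]
    show "bigO (Suc N) (\<lambda>s r t. X r t v * (\<Sum>v'\<in>words_upto N. X s r v' * U k v' v s)
        - X r t v * ((\<Sum>w\<in>words_upto N. X s r w * \<phi> k w s) * lift_coeff F f v (drop k u) (Y r)))"
      by (simp add: right_diff_distrib)
  qed
  have 3: "(\<Sum>k\<le>length u. \<Sum>v\<in>words_upto N. X r t v * ((\<Sum>w\<in>words_upto N. X s r w * \<phi> k w s) * lift_coeff F f v (drop k u) (Y r)))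
      = tmult (lift_expansion X F f Y s r) (lift_expansion X F f Y r t) u" for s r t
  proof -
    have "X r t v * (a * c) = a * (X r t v * c)" for v a c by simp
    then show ?thesis
      unfolding tmult_def lift_expansion_def \<phi>_def by (simp only: sum_distrib_left[symmetric])
  qed
  show ?thesis using bigO_trans[OF 1[unfolded swap] 2] unfolding 3 .
qed

text \<open>Up to the remainder the product of two expansions is an unshuffle sum in the letters of
  \<open>X\<close>; \<open>shuffle_sum_lift_coeff\<close> turns it into a shuffle in the letters of
  the target.\<close>

lemma lift_expansion_shuffle:
  "bigO (Suc N) (\<lambda>s r t. lift_expansion X F f Y s t u * lift_expansion X F f Y s t w
    - shuffle_sum (lift_expansion X F f Y s t) u w)"
proof -
  have "bigO (Suc N) (\<lambda>s r t. lift_expansion X F f Y s t u * lift_expansion X F f Y s t w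
    - (\<Sum>z\<in>words_upto N. X s t z * unshuffle_sum z (\<lambda>v. lift_coeff F f v u (Y s)) (\<lambda>v. lift_coeff F f v w (Y s))))"
    unfolding lift_expansion_def by (rule expansion_mult[OF X coeff_bounded coeff_bounded])
  moreover have "(\<Sum>z\<in>words_upto N. X s t z * unshuffle_sum z (\<lambda>v. lift_coeff F f v u (Y s)) (\<lambda>v. lift_coeff F f v w (Y s)))
      = shuffle_sum (lift_expansion X F f Y s t) u w" for s t
    unfolding lift_expansion_def[abs_def] shuffle_sum_lift_coeff[OF F f] by (simp add: shuffle_sum_sum shuffle_sum_scale)
  ultimately show ?thesis by simp
qed

end

section \<open>Existence and uniqueness of the lift\<close>

lemma bigO_shuffle_sum:
  fixes v w :: "'v::euclidean_space list"
  assumes "set v \<subseteq> Basis" "set w \<subseteq> Basis"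
    and "\<And>z. z \<in> words (length v + length w) \<Longrightarrow> bigO k (\<lambda>s u t. x s t z)"
  shows "bigO k (\<lambda>s u t. shuffle_sum (x s t) v w)"
  unfolding shuffle_sum_eq_sum_words[OF assms(1,2)]
proof (rule bigO_sum)
  fix z :: "'v list" assume "z \<in> words (length v + length w)"
  from bigO_mult[OF assms(3)[OF this] bigO_const]
  show "bigO k (\<lambda>s u t. x s t z * unshuffle_sum z (is_word v) (is_word w))" by simp
qed

text \<open>The defect of the shuffle relation in lowest degree is additive, hence vanishes.\<close>

lemma multiplicative_shuffle:
  assumes Z: "multiplicative n Z"
    and close: "\<And>v w. v \<in> words_upto n \<Longrightarrow> w \<in> words_upto n \<Longrightarrow> length v + length w \<le> n \<Longrightarrow>
      bigO (Suc N) (\<lambda>s u t. Z s t v * Z s t w - shuffle_sum (Z s t) v w)"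
  shows "set v \<subseteq> Basis \<Longrightarrow> set w \<subseteq> Basis \<Longrightarrow> length v + length w \<le> n \<Longrightarrow> 0 \<le> s \<Longrightarrow> s \<le> t \<Longrightarrow> t \<le> T
    \<Longrightarrow> Z s t v * Z s t w = shuffle_sum (Z s t) v w"
proof (induction "length v + length w" arbitrary: v w s t rule: less_induct)
  case less
  have nil: "Z s t [] = 1" if "0 \<le> s" "s \<le> t" "t \<le> T" for s t
    using multiplicative_Nil[OF Z that] .
  show ?case
  proof (cases "v = [] \<or> w = []")
    case True
    then show ?thesis using nil less.prems by auto
  next
    case False
    define S where "S s t = Z s t v * Z s t w - shuffle_sum (Z s t) v w" for s t
    have add: "S s t = S s u + S u t" if st: "0 \<le> s" "s \<le> u" "u \<le> t" "t \<le> T" for s u t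
    proof -
      define g where "g = (\<lambda>(i, j). (Z s u (take i v) * Z u t (drop i v)) * (Z s u (take j w) * Z u t (drop j w))
        - shuffle_sum (Z s u) (take i v) (take j w) * shuffle_sum (Z u t) (drop i v) (drop j w))"
      have "Z s t v = tmult (Z s u) (Z u t) v" "Z s t w = tmult (Z s u) (Z u t) w"
        using less.prems by (auto intro!: multiplicative_tmult[OF Z st] simp: words_upto_iff)
      moreover have "shuffle_sum (Z s t) v w = shuffle_sum (tmult (Z s u) (Z u t)) v w"
        using less.prems by (intro shuffle_sum_cong multiplicative_tmult[OF Z st]) (auto simp: words_upto_iff)
      ultimately have "S s t = (\<Sum>x\<in>{..length v} \<times> {..length w}. g x)"
        unfolding S_def shuffle_sum_tmult g_def sum.cartesian_product[symmetric]
        by (simp only: tmult_def sum_product sum_subtractf)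
      \<comment> \<open>All other pairs of cuts leave strictly shorter pairs of words on both sides,
        for which the shuffle relation holds by induction, so that their terms cancel.\<close>
      also have "\<dots> = (\<Sum>x\<in>{(0, 0), (length v, length w)}. g x)"
      proof (rule sum.mono_neutral_right)
        have "g (i, j) = 0" if ij: "i \<le> length v" "j \<le> length w"
          and ne: "(i, j) \<noteq> (0, 0)" "(i, j) \<noteq> (length v, length w)" for i j
        proof -
          have 1: "Z s u (take i v) * Z s u (take j w) = shuffle_sum (Z s u) (take i v) (take j w)"
            using less.prems ij st ne by (intro less.hyps) (auto dest: in_set_takeD)
          have 2: "Z u t (drop i v) * Z u t (drop j w) = shuffle_sum (Z u t) (drop i v) (drop j w)"
            using less.prems ij st ne False by (intro less.hyps) (auto dest: in_set_dropD)
          have "(a * b) * (c * d) = (a * c) * (b * d)" for a b c d :: real by simp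
          then show ?thesis unfolding g_def prod.case 1[symmetric] 2[symmetric] by simp
        qed
        then have "i \<le> length v \<and> j \<le> length w \<longrightarrow> (i, j) \<notin> {(0, 0), (length v, length w)} \<longrightarrow> g (i, j) = 0" for i j
          by simp
        then show "\<forall>x\<in>{..length v} \<times> {..length w} - {(0, 0), (length v, length w)}. g x = 0"
          by (simp only: ball_simps Ball_def split_paired_All Diff_iff mem_Sigma_iff atMost_iff) blast
      qed auto
      also have "\<dots> = S s u + S u t"
        using False nil st unfolding g_def S_def by simp
      finally show ?thesis .
    qed
    have "bigO (Suc N) (\<lambda>s u t. S s t)"
      unfolding S_def using less.prems by (intro close) (simp_all add: words_upto_iff)
    from additive_bigO_eq_0[OF this add less.prems(4-6)] have "S s t = 0" .
    then show ?thesis unfolding S_def by simp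
  qed
qed

end

section \<open>Solutions as controlled paths, and the lifts of these\<close>

lemma shuffle_sum_diff: "shuffle_sum (\<lambda>z. x z - y z) v w = shuffle_sum x v w - shuffle_sum y v w"
  using shuffle_sum_add[of x "\<lambda>z. - 1 * y z" v w] shuffle_sum_scale[of "- 1" y v w] by simp

lemma pairing_tmult_tcomp:
  assumes "a \<in> homogeneous n"
  shows "pairing (n + k) h (tmult (tcomp k x) a) = (\<Sum>v\<in>words k. \<Sum>w\<in>words n. (x v * a w) *\<^sub>R h (v @ w))"
proof -
  have "tmult (tcomp k x) a z = x (take k z) * a (drop k z)" if z: "z \<in> words (n + k)" for z
  proof -
    have "tmult (tcomp k x) a z = (\<Sum>j\<in>{k}. tcomp k x (take j z) * a (drop j z))"
      unfolding tmult_def using z by (intro sum.mono_neutral_right) (auto simp: in_words_iff tcomp_def)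
    then show ?thesis using z by (auto simp: tcomp_def in_words_iff dest: in_set_takeD)
  qed
  then have "pairing (n + k) h (tmult (tcomp k x) a)
      = (\<Sum>z\<in>words (n + k). (x (take k z) * a (drop k z)) *\<^sub>R h z)"
    unfolding pairing_def by (intro sum.cong refl) simp
  also have "\<dots> = (\<Sum>(v, w)\<in>words k \<times> words n. (x v * a w) *\<^sub>R h (v @ w))"
    by (rule sum.reindex_bij_witness[of _ "\<lambda>(v, w). v @ w" "\<lambda>z. (take k z, drop k z)"])
      (auto simp: in_words_iff dest: in_set_takeD in_set_dropD)
  finally show ?thesis by (simp add: sum.cartesian_product)
qed

lemma sum_words_upto: "(\<Sum>v\<in>words_upto m. \<phi> v) = (\<Sum>k\<le>m. \<Sum>v\<in>words k. \<phi> v)"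
  unfolding words_upto_def by (rule sum.UNION_disjoint) (auto simp: in_words_iff)

context rough_setting
begin

lemma norm_bigO:
  fixes a :: "real \<Rightarrow> real \<Rightarrow> 'e::euclidean_space"
  assumes "\<And>b. b \<in> Basis \<Longrightarrow> bigO k (\<lambda>s u t. a s t \<bullet> b)" "k > 0"
  shows "\<exists>C. \<forall>(s, t)\<in>simplex2 T. norm (a s t) \<le> C * \<omega> s t powr (real k / p)"
proof -
  have "bigO k (\<lambda>s u t. \<Sum>b\<in>Basis. \<bar>a s t \<bullet> b\<bar>)"
    by (intro bigO_sum bigO_abs assms)
  then obtain C where C: "C \<ge> 0" "\<And>s u t. 0 \<le> s \<Longrightarrow> s \<le> u \<Longrightarrow> u \<le> t \<Longrightarrow> t \<le> T \<Longrightarrow>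
      \<bar>\<Sum>b\<in>Basis. \<bar>a s t \<bullet> b\<bar>\<bar> \<le> C * weight k s t"
    by (rule bigOE) blast
  have "norm (a s t) \<le> C * \<omega> s t powr (real k / p)" if "0 \<le> s" "s \<le> t" "t \<le> T" for s t
    using C(2)[of s s t] that norm_le_l1[of "a s t"] \<open>k > 0\<close> by (simp add: weight_def)
  then show ?thesis by (intro exI[of _ C]) (auto simp: simplex2_def)
qed

lemma approx_if_bigO:
  fixes a c :: "real \<Rightarrow> real \<Rightarrow> 'e::euclidean_space"
  assumes "\<And>b. b \<in> Basis \<Longrightarrow> bigO k (\<lambda>s u t. (a s t - c s t) \<bullet> b)" "k > 0"
  shows "approx \<omega> p T k a c"
  unfolding approx_def by (rule norm_bigO[OF assms])

text \<open>The equation for \<open>Y\<close>, truncated at degree \<open>N - 1 - n\<close> and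
  applied to the coordinates of \<open>F^n f\<close>. A word \<open>v\<close> acting on the
  derivative along \<open>w\<close> gives the derivative along \<open>v @ w\<close>, which matches
  the position of \<open>a\<close> to the right of \<open>X\<close> in the definition.\<close>

lemma controlled_vf_iter:
  fixes X :: "real \<Rightarrow> real \<Rightarrow> 'v::euclidean_space tensor" and f :: "'w::euclidean_space \<Rightarrow> 'u::euclidean_space"
  assumes X: "X \<in> rough_paths \<omega> p T" and F: "smooth F" and Y: "rde_solution \<omega> p T X F y0 Y" and f: "smooth f"
  shows "(\<lambda>t w. vf_iter F w f (Y t)) \<in> controlled_paths \<omega> p T X"
  unfolding controlled_paths_def
proof (intro CollectI conjI allI ballI impI)
  define h where "h w b y = vf_iter F w f y \<bullet> b" for w b y
  have h: "smooth (h w b)" for w b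
    unfolding h_def by (intro smooth_linear[OF bounded_linear_inner_left] smooth_vf_iter F f)
  fix w :: "'v list" assume "w \<in> words_upto (N - 1)"
  have "continuous_on {0..T} Y" using Y unfolding rde_solution_def by blast
  then have "continuous_on {0..T} (\<lambda>t. vf_iter F w f (Y t))"
    by (intro continuous_on_compose2[OF smooth_continuous_on[OF smooth_vf_iter[OF F f], of UNIV]]) auto
  moreover have "\<exists>C. \<forall>(s, t)\<in>simplex2 T. norm (vf_iter F w f (Y t) - vf_iter F w f (Y s)) \<le> C * \<omega> s t powr (real 1 / p)"
  proof (rule norm_bigO)
    fix b :: 'u
    \<comment> \<open>Truncation at degree 0 leaves the bare increment and yields its order 1, the
      regularity demanded by \<open>Cp_paths\<close>.\<close>
    have "bigO (Suc 0) (\<lambda>s u t. h w b (Y t) - (\<Sum>v\<in>words_upto 0. X s t v * vf_iter F v (h w b) (Y s)))"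
      by (rule rde_solution_truncated[OF X Y F h]) simp
    also have "?this \<longleftrightarrow> bigO 1 (\<lambda>s u t. (vf_iter F w f (Y t) - vf_iter F w f (Y s)) \<bullet> b)"
      unfolding One_nat_def
    proof (rule bigO_cong)
      fix s u t :: real assume "0 \<le> s" "s \<le> u" "u \<le> t" "t \<le> T"
      then have "X s t [] = 1" using multiplicative_Nil[OF rough_path_multiplicative[OF X]] by simp
      then show "h w b (Y t) - (\<Sum>v\<in>words_upto 0. X s t v * vf_iter F v (h w b) (Y s))
          = (vf_iter F w f (Y t) - vf_iter F w f (Y s)) \<bullet> b"
        by (simp add: sum_words_upto words_0 h_def inner_diff_left)
    qed
    finally show "bigO 1 (\<lambda>s u t. (vf_iter F w f (Y t) - vf_iter F w f (Y s)) \<bullet> b)" .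
  qed simp
  ultimately show "(\<lambda>t. vf_iter F w f (Y t)) \<in> Cp_paths \<omega> p T" unfolding Cp_paths_def by simp
next
  fix n and a :: "'v tensor" assume n: "n + 2 \<le> N" and a: "a \<in> homogeneous n"
  define h where "h w b y = vf_iter F w f y \<bullet> b" for w b y
  have h: "smooth (h w b)" for w b
    unfolding h_def by (intro smooth_linear[OF bounded_linear_inner_left] smooth_vf_iter F f)
  show "approx \<omega> p T (N - n) (\<lambda>s t. pairing n (\<lambda>w. vf_iter F w f (Y t)) a)
      (\<lambda>s t. \<Sum>k\<le>N - 1 - n. pairing (n + k) (\<lambda>w. vf_iter F w f (Y s)) (tmult (tcomp k (X s t)) a))"
  proof (rule approx_if_bigO)
    fix b :: 'u
    have "bigO (N - n) (\<lambda>s u t. \<Sum>w\<in>words n. a w *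
        (h w b (Y t) - (\<Sum>v\<in>words_upto (N - 1 - n). X s t v * vf_iter F v (h w b) (Y s))))"
    proof (rule bigO_sum)
      fix w :: "'v list"
      have "bigO (Suc (N - 1 - n)) (\<lambda>s u t. h w b (Y t)
          - (\<Sum>v\<in>words_upto (N - 1 - n). X s t v * vf_iter F v (h w b) (Y s)))"
        by (rule rde_solution_truncated[OF X Y F h]) simp
      moreover have "Suc (N - 1 - n) = N - n" using n by simp
      ultimately show "bigO (N - n) (\<lambda>s u t. a w *
          (h w b (Y t) - (\<Sum>v\<in>words_upto (N - 1 - n). X s t v * vf_iter F v (h w b) (Y s))))"
        using bigO_mult[OF bigO_const] by fastforce
    qed
    moreover have "(\<Sum>w\<in>words n. a w *
        (h w b (Y t) - (\<Sum>v\<in>words_upto (N - 1 - n). X s t v * vf_iter F v (h w b) (Y s))))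
      = (pairing n (\<lambda>w. vf_iter F w f (Y t)) a
        - (\<Sum>k\<le>N - 1 - n. pairing (n + k) (\<lambda>w. vf_iter F w f (Y s)) (tmult (tcomp k (X s t)) a))) \<bullet> b"
      for s t
    proof -
      have it: "vf_iter F v (h w b) y = vf_iter F (v @ w) f y \<bullet> b" for v w y
        unfolding vf_iter_append h_def[abs_def] using vf_iter_inner[OF F smooth_vf_iter[OF F f]] .
      have "(\<Sum>k\<le>N - 1 - n. pairing (n + k) (\<lambda>w. vf_iter F w f (Y s)) (tmult (tcomp k (X s t)) a)) \<bullet> b
        = (\<Sum>v\<in>words_upto (N - 1 - n). \<Sum>w\<in>words n. X s t v * a w * (vf_iter F (v @ w) f (Y s) \<bullet> b))"
        unfolding pairing_tmult_tcomp[OF a] sum_words_upto by (simp add: inner_sum_left)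
      also have "\<dots> = (\<Sum>w\<in>words n. a w * (\<Sum>v\<in>words_upto (N - 1 - n). X s t v * vf_iter F v (h w b) (Y s)))"
        unfolding it by (subst sum.swap) (simp add: sum_distrib_left mult_ac)
      finally show ?thesis
        by (simp add: inner_diff_left right_diff_distrib sum_subtractf pairing_def inner_sum_left h_def)
    qed
    ultimately show "bigO (N - n) (\<lambda>s u t. (pairing n (\<lambda>w. vf_iter F w f (Y t)) a
        - (\<Sum>k\<le>N - 1 - n. pairing (n + k) (\<lambda>w. vf_iter F w f (Y s)) (tmult (tcomp k (X s t)) a))) \<bullet> b)"
      by simp
  qed (use n in simp)
qed

context
  fixes X :: "real \<Rightarrow> real \<Rightarrow> 'v::euclidean_space tensor" and F :: "'w::euclidean_space \<Rightarrow> 'v \<Rightarrow>\<^sub>L 'w"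
    and y0 :: 'w and Y :: "real \<Rightarrow> 'w" and f :: "'w \<Rightarrow> 'u::euclidean_space"
  assumes X: "X \<in> rough_paths \<omega> p T" and F: "smooth F" and Y: "rde_solution \<omega> p T X F y0 Y" and f: "smooth f"
begin

text \<open>The expansion satisfies both relations up to order \<open>Suc N\<close>. The extension
  makes Chen's relation exact, after which the shuffle defect, still of that order, vanishes by
  \<open>multiplicative_shuffle\<close>.\<close>

lemma lift_expansion_extension:
  obtains Z where "Z \<in> rough_paths \<omega> p T"
    "\<And>u. u \<in> words_upto N \<Longrightarrow> bigO (Suc N) (\<lambda>s r t. Z s t u - lift_expansion X F f Y s t u)"
proof -
  let ?A = "lift_expansion X F f Y"
  have A0: "bigO 0 (\<lambda>s r t. ?A s t u)" if "u \<in> words_upto N" for u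
    using bigO_mono[OF lift_expansion_bigO[OF X F Y f]] that by (simp add: words_upto_iff)
  obtain Z where Z: "multiplicative N Z"
    and close': "\<forall>u\<in>words_upto N. bigO (Suc N) (\<lambda>s r t. Z s t u - ?A s t u)"
    by (rule multiplicative_extension[of ?A N, OF lift_expansion_Nil[OF X] A0 lift_expansion_chen[OF X F Y f]])
  note close = bspec[OF close']
  have Z_bigO: "bigO (length u) (\<lambda>s r t. Z s t u)" if "u \<in> words_upto N" for u
    using bigO_diff_bounded[OF close[OF that] lift_expansion_bigO[OF X F Y f]] that by (simp add: words_upto_iff)
  have Z0: "bigO 0 (\<lambda>s r t. Z s t u)" if "u \<in> words_upto N" for u
    using bigO_mono[OF Z_bigO[OF that]] by simp
  have shuffle_close: "bigO (Suc N) (\<lambda>s r t. Z s t v * Z s t w - shuffle_sum (Z s t) v w)"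
    if v: "v \<in> words_upto N" and w: "w \<in> words_upto N" and vw: "length v + length w \<le> N" for v w
  proof -
    have 1: "bigO (Suc N) (\<lambda>s r t. Z s t v * Z s t w - ?A s t v * ?A s t w)"
      by (intro bigO_mult_diff close v w A0 Z0)
    have "bigO (Suc N) (\<lambda>s r t. shuffle_sum (\<lambda>z. ?A s t z - Z s t z) v w)"
    proof (rule bigO_shuffle_sum)
      fix z :: "'u list" assume "z \<in> words (length v + length w)"
      then have "z \<in> words_upto N" using vw by (auto simp: in_words_iff words_upto_iff)
      then show "bigO (Suc N) (\<lambda>s r t. ?A s t z - Z s t z)" by (intro bigO_swap[OF close])
    qed (use v w in \<open>auto simp: words_upto_iff\<close>)
    then have 2: "bigO (Suc N) (\<lambda>s r t. shuffle_sum (?A s t) v w - shuffle_sum (Z s t) v w)"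
      unfolding shuffle_sum_diff .
    show ?thesis
      by (rule bigO_trans[OF bigO_trans[OF 1 lift_expansion_shuffle[OF X F Y f]] 2])
  qed
  have Z_shuffle: "Z s t v * Z s t w = shuffle_sum (Z s t) v w"
    if "v \<in> words m" "w \<in> words n" "m + n \<le> N" "0 \<le> s" "s \<le> t" "t \<le> T" for v w m n s t
    using that by (intro multiplicative_shuffle[OF Z shuffle_close]) (auto simp: in_words_iff)
  have Z_cont: "continuous_on (simplex2 T) (\<lambda>(s, t). Z s t w)" if "w \<in> words_upto N" for w
  proof (rule multiplicative_continuous[OF Z _ that])
    fix w :: "'u list" assume "w \<in> words_upto N" "w \<noteq> []"
    then show "bigO 1 (\<lambda>s r t. Z s t w)" using bigO_mono[OF Z_bigO] by (cases w) auto
  qed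
  \<comment> \<open>\<open>rough_paths\<close> prescribes the value 0 off the simplex and off the
    truncated tensors, where the extension is arbitrary.\<close>
  define Z' where "Z' s t w = (if (s, t) \<in> simplex2 T \<and> w \<in> words_upto N then Z s t w else 0)" for s t w
  have eq: "Z' s t w = Z s t w" if "(s, t) \<in> simplex2 T" "w \<in> words_upto N" for s t w
    using that unfolding Z'_def by simp
  have "Z' \<in> rough_paths \<omega> p T"
    unfolding rough_paths_def
  proof (intro CollectI conjI)
    show "\<forall>s t w. (s, t) \<notin> simplex2 T \<or> w \<notin> words_upto N \<longrightarrow> Z' s t w = 0"
      unfolding Z'_def by auto
    show "\<forall>w\<in>words_upto N. continuous_on (simplex2 T) (\<lambda>(s, t). Z' s t w)"
    proof
      fix w :: "'u list" assume w: "w \<in> words_upto N"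
      have "continuous_on (simplex2 T) (\<lambda>(s, t). Z' s t w) \<longleftrightarrow> continuous_on (simplex2 T) (\<lambda>(s, t). Z s t w)"
        using eq w by (intro continuous_on_cong) auto
      then show "continuous_on (simplex2 T) (\<lambda>(s, t). Z' s t w)" using Z_cont[OF w] by simp
    qed
    show "\<forall>(s, t)\<in>simplex2 T. Z' s t [] = 1"
      using eq multiplicative_Nil[OF Z] by (auto simp: simplex2_def words_upto_iff)
    show "\<forall>n\<in>{1..N}. \<exists>C. \<forall>(s, t)\<in>simplex2 T. tnorm n (Z' s t) \<le> C * \<omega> s t powr (real n / p)"
    proof
      fix n assume n: "n \<in> {1..N}"
      have sub: "w \<in> words_upto N" if "w \<in> words n" for w :: "'u list"
        using that n by (auto simp: in_words_iff words_upto_iff)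
      have "bigO n (\<lambda>s r t. \<Sum>w\<in>words n. \<bar>Z s t w\<bar>)"
      proof (intro bigO_sum bigO_abs)
        fix w :: "'u list" assume w: "w \<in> words n"
        then show "bigO n (\<lambda>s r t. Z s t w)" using Z_bigO[OF sub[OF w]] by (simp add: in_words_iff)
      qed
      then obtain C where C: "C \<ge> 0" "\<And>s u t. 0 \<le> s \<Longrightarrow> s \<le> u \<Longrightarrow> u \<le> t \<Longrightarrow> t \<le> T \<Longrightarrow>
          \<bar>\<Sum>w\<in>words n. \<bar>Z s t w\<bar>\<bar> \<le> C * weight n s t"
        by (rule bigOE) blast
      have "tnorm n (Z' s t) \<le> C * \<omega> s t powr (real n / p)" if st: "(s, t) \<in> simplex2 T" for s t
      proof -
        have "tnorm n (Z' s t) \<le> (\<Sum>w\<in>words n. \<bar>Z' s t w\<bar>)" unfolding tnorm_def by (rule L2_set_le_sum_abs)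
        also have "\<dots> = (\<Sum>w\<in>words n. \<bar>Z s t w\<bar>)" using eq[OF st] sub by (intro sum.cong) auto
        also have "\<dots> \<le> C * \<omega> s t powr (real n / p)"
          using C(2)[of s s t] st n by (simp add: simplex2_def weight_def)
        finally show ?thesis .
      qed
      then show "\<exists>C. \<forall>(s, t)\<in>simplex2 T. tnorm n (Z' s t) \<le> C * \<omega> s t powr (real n / p)" by blast
    qed
    show "\<forall>s u t. 0 \<le> s \<and> s \<le> u \<and> u \<le> t \<and> t \<le> T \<longrightarrow>
        (\<forall>w\<in>words_upto N. Z' s t w = tmult (Z' s u) (Z' u t) w)"
    proof (intro allI impI ballI)
      fix s u t :: real and w :: "'u list"
      assume st: "0 \<le> s \<and> s \<le> u \<and> u \<le> t \<and> t \<le> T" and w: "w \<in> words_upto N"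
      then have simp: "(s, t) \<in> simplex2 T" "(s, u) \<in> simplex2 T" "(u, t) \<in> simplex2 T"
        by (auto simp: simplex2_def)
      have "Z' s t w = tmult (Z s u) (Z u t) w"
        using eq[OF simp(1) w] multiplicative_tmult[OF Z _ _ _ _ w] st by simp
      then show "Z' s t w = tmult (Z' s u) (Z' u t) w"
        unfolding tmult_def using eq simp words_upto_take[OF w] words_upto_drop[OF w] by simp
    qed
    show "\<forall>(s, t)\<in>simplex2 T. \<forall>m n. m + n \<le> N \<longrightarrow>
        (\<forall>v\<in>words m. \<forall>w\<in>words n. Z' s t v * Z' s t w = Delta_sh m n (Z' s t) [v, w])"
    proof clarify
      fix s t m n and v w :: "'u list"
      assume st: "(s, t) \<in> simplex2 T" and mn: "m + n \<le> N" and v: "v \<in> words m" and w: "w \<in> words n"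
      have "Z' s t v * Z' s t w = Z s t v * Z s t w"
        using v w mn by (simp add: eq[OF st] in_words_iff words_upto_iff)
      also have "\<dots> = shuffle_sum (Z s t) v w"
        using Z_shuffle[OF v w mn] st by (simp add: simplex2_def)
      also have "\<dots> = shuffle_sum (Z' s t) v w"
        using v w mn by (intro shuffle_sum_cong eq[OF st, symmetric]) (auto simp: in_words_iff words_upto_iff)
      finally show "Z' s t v * Z' s t w = Delta_sh m n (Z' s t) [v, w]"
        unfolding Delta_sh_eq_shuffle_sum[OF v w] .
    qed
  qed
  moreover have "bigO (Suc N) (\<lambda>s r t. Z' s t u - ?A s t u)" if "u \<in> words_upto N" for u
    using close[OF that] by (rule bigO_cong[THEN iffD1, rotated]) (use eq that in \<open>auto simp: simplex2_def\<close>)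
  ultimately show thesis by (rule that)
qed

text \<open>The definition prescribes degree 1 through the trace and higher degrees by
  approximation; here all degrees take one form. In degree 1 the two agree because
  \<open>Z s t [b]\<close> minus the increment of \<open>f (Y t) \<bullet> b\<close> is additive,
  hence 0 once it is of order \<open>Suc N\<close>.\<close>

lemma is_lift_iff:
  "is_lift \<omega> p T X (\<lambda>t w. vf_iter F w f (Y t)) Z \<longleftrightarrow> Z \<in> rough_paths \<omega> p T \<and>
    (\<forall>u\<in>words_upto N. bigO (Suc N) (\<lambda>s r t. Z s t u - lift_expansion X F f Y s t u))"
proof -
  let ?A = "lift_expansion X F f Y"
  have single: "(\<forall>b\<in>Basis. bigO (Suc N) (\<lambda>s r t. Z s t [b] - ?A s t [b])) \<longleftrightarrow>
      (\<forall>t\<in>{0..T}. trace_path (f (Y 0)) Z t = f (Y t))" if Z: "Z \<in> rough_paths \<omega> p T"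
  proof -
    have chen: "Z s t [b] = Z s r [b] + Z r t [b]"
      if "0 \<le> s" "s \<le> r" "r \<le> t" "t \<le> T" "b \<in> Basis" for s r t b
    proof -
      note M = rough_path_multiplicative[OF Z]
      have "[b] \<in> words_upto N" using that N_pos by (simp add: words_upto_iff)
      from multiplicative_tmult[OF M that(1-4) this] show ?thesis
        using multiplicative_Nil[OF M] that by (simp add: tmult_def)
    qed
    have tr: "trace_path (f (Y 0)) Z t = f (Y t) \<longleftrightarrow> (\<forall>b\<in>Basis. Z 0 t [b] = (f (Y t) - f (Y 0)) \<bullet> b)" for t
      unfolding trace_path_def euclidean_eq_iff[of _ "f (Y t)"]
      by (auto simp: inner_add_left inner_diff_left)
    show ?thesis
    proof
      assume *: "\<forall>b\<in>Basis. bigO (Suc N) (\<lambda>s r t. Z s t [b] - ?A s t [b])"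
      have "Z 0 t [b] - (f (Y t) - f (Y 0)) \<bullet> b = 0" if "b \<in> Basis" "0 \<le> t" "t \<le> T" for b t
      proof (rule additive_bigO_eq_0[where \<psi> = "\<lambda>s t. Z s t [b] - (f (Y t) - f (Y s)) \<bullet> b"])
        show "bigO (Suc N) (\<lambda>s r t. Z s t [b] - (f (Y t) - f (Y s)) \<bullet> b)"
          by (rule bigO_trans[OF bspec[OF * \<open>b \<in> Basis\<close>] lift_expansion_single[OF X F Y f]])
        show "Z s t [b] - (f (Y t) - f (Y s)) \<bullet> b
            = Z s r [b] - (f (Y r) - f (Y s)) \<bullet> b + (Z r t [b] - (f (Y t) - f (Y r)) \<bullet> b)"
          if "0 \<le> s" "s \<le> r" "r \<le> t" "t \<le> T" for s r t
          using chen[OF that \<open>b \<in> Basis\<close>] by (simp add: inner_diff_left)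
      qed (use that in auto)
      then show "\<forall>t\<in>{0..T}. trace_path (f (Y 0)) Z t = f (Y t)" unfolding tr by simp
    next
      assume *: "\<forall>t\<in>{0..T}. trace_path (f (Y 0)) Z t = f (Y t)"
      show "\<forall>b\<in>Basis. bigO (Suc N) (\<lambda>s r t. Z s t [b] - ?A s t [b])"
      proof
        fix b :: 'u assume b: "b \<in> Basis"
        from bigO_swap[OF lift_expansion_single[OF X F Y f]]
        show "bigO (Suc N) (\<lambda>s r t. Z s t [b] - ?A s t [b])"
        proof (rule bigO_cong[THEN iffD1, rotated])
          fix s r t :: real assume st: "0 \<le> s" "s \<le> r" "r \<le> t" "t \<le> T"
          have "Z 0 t [b] = Z 0 s [b] + Z s t [b]" using chen[of 0 s t b] st b by simp
          moreover have "Z 0 t [b] = (f (Y t) - f (Y 0)) \<bullet> b" "Z 0 s [b] = (f (Y s) - f (Y 0)) \<bullet> b"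
            using * st b unfolding tr by auto
          ultimately show "(f (Y t) - f (Y s)) \<bullet> b - ?A s t [b] = Z s t [b] - ?A s t [b]"
            by (simp add: inner_diff_left)
        qed
      qed
    qed
  qed
  have nil: "bigO (Suc N) (\<lambda>s r t. Z s t [] - ?A s t [])" if Z: "Z \<in> rough_paths \<omega> p T"
    using bigO_zero
  proof (rule bigO_cong[THEN iffD1, rotated])
    fix s r t :: real assume "0 \<le> s" "s \<le> r" "r \<le> t" "t \<le> T"
    then show "0 = Z s t [] - ?A s t []"
      using multiplicative_Nil[OF rough_path_multiplicative[OF Z], of s t] lift_expansion_Nil[OF X, of s t F f Y]
      by simp
  qed
  have higher: "approx \<omega> p T (N + 1) (\<lambda>s t. Z s t u)
      (\<lambda>s t. \<Sum>ns\<in>degree_lists m N. box_pairing ns (\<lambda>w. vf_iter F w f (Y s)) (Delta_osh ns (X s t)) u)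
    \<longleftrightarrow> bigO (Suc N) (\<lambda>s r t. Z s t u - ?A s t u)" if "u \<in> words m" for m u
    using that unfolding in_words_iff
    by (simp add: sum_box_pairing_eq_lift_coeff[OF F f] approx_iff_bigO lift_expansion_def)
  have split: "(\<forall>u\<in>words_upto N. P u) \<longleftrightarrow> P [] \<and> (\<forall>b\<in>Basis. P [b]) \<and>
      (\<forall>m. 2 \<le> m \<and> m \<le> N \<longrightarrow> (\<forall>u\<in>words m. P u))" for P :: "'u list \<Rightarrow> bool"
  proof (intro iffI conjI)
    assume P: "P [] \<and> (\<forall>b\<in>Basis. P [b]) \<and> (\<forall>m. 2 \<le> m \<and> m \<le> N \<longrightarrow> (\<forall>u\<in>words m. P u))"
    show "\<forall>u\<in>words_upto N. P u"
    proof
      fix u :: "'u list" assume u: "u \<in> words_upto N"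
      consider "u = []" | b where "u = [b]" | "2 \<le> length u"
        by (cases u rule: remdups_adj.cases) auto
      then show "P u" using P u by cases (auto simp: words_upto_iff in_words_iff)
    qed
  qed (use N_pos in \<open>auto simp: words_upto_iff in_words_iff\<close>)
  show ?thesis
    unfolding is_lift_def split vf_iter.simps
    using controlled_vf_iter[OF X F Y f] single nil higher by auto
qed

lemma lift_eqI:
  assumes Z: "Z \<in> rough_paths \<omega> p T"
    and close: "\<And>u. u \<in> words_upto N \<Longrightarrow> bigO (Suc N) (\<lambda>s r t. Z s t u - lift_expansion X F f Y s t u)"
  shows "lift \<omega> p T X (\<lambda>t w. vf_iter F w f (Y t)) = Z"
  unfolding lift_def
proof (rule the_equality)
  show "is_lift \<omega> p T X (\<lambda>t w. vf_iter F w f (Y t)) Z" using assms is_lift_iff by blast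
next
  fix Z' assume "is_lift \<omega> p T X (\<lambda>t w. vf_iter F w f (Y t)) Z'"
  then have Z': "Z' \<in> rough_paths \<omega> p T"
    and close': "\<And>u. u \<in> words_upto N \<Longrightarrow> bigO (Suc N) (\<lambda>s r t. Z' s t u - lift_expansion X F f Y s t u)"
    using is_lift_iff by auto
  have "Z' s t w = Z s t w" for s t w
  proof (cases "(s, t) \<in> simplex2 T \<and> w \<in> words_upto N")
    case True
    show ?thesis
    proof (rule multiplicative_unique[OF rough_path_multiplicative[OF Z'] rough_path_multiplicative[OF Z]])
      fix u :: "'u list" assume u: "u \<in> words_upto N"
      show "bigO (Suc N) (\<lambda>s r t. Z' s t u - Z s t u)"
        by (rule bigO_trans[OF close'[OF u] bigO_swap[OF close[OF u]]])
    qed (use True in \<open>auto simp: simplex2_def\<close>)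
  next
    case False
    then show ?thesis using Z Z' unfolding rough_paths_def by auto
  qed
  then show "Z' = Z" by blast
qed

lemma lift_rough_path:
  "lift \<omega> p T X (\<lambda>t w. vf_iter F w f (Y t)) \<in> rough_paths \<omega> p T"
  "u \<in> words_upto N \<Longrightarrow> bigO (Suc N) (\<lambda>s r t.
    lift \<omega> p T X (\<lambda>t w. vf_iter F w f (Y t)) s t u - lift_expansion X F f Y s t u)"
proof -
  obtain Z where Z: "Z \<in> rough_paths \<omega> p T"
    "\<And>u. u \<in> words_upto N \<Longrightarrow> bigO (Suc N) (\<lambda>s r t. Z s t u - lift_expansion X F f Y s t u)"
    by (rule lift_expansion_extension) blast
  then show "lift \<omega> p T X (\<lambda>t w. vf_iter F w f (Y t)) \<in> rough_paths \<omega> p T"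
    "u \<in> words_upto N \<Longrightarrow> bigO (Suc N) (\<lambda>s r t.
      lift \<omega> p T X (\<lambda>t w. vf_iter F w f (Y t)) s t u - lift_expansion X F f Y s t u)"
    using lift_eqI[OF Z] by auto
qed

lemma lift_trace:
  assumes "0 \<le> t" "t \<le> T"
  shows "trace_path (f (Y 0)) (lift \<omega> p T X (\<lambda>t w. vf_iter F w f (Y t))) t = f (Y t)"
proof -
  have "is_lift \<omega> p T X (\<lambda>t w. vf_iter F w f (Y t)) (lift \<omega> p T X (\<lambda>t w. vf_iter F w f (Y t)))"
    using is_lift_iff lift_rough_path by blast
  then show ?thesis using assms unfolding is_lift_def by simp
qed

end

end

section \<open>Pushforwards of solutions\<close>

lemma rough_paths_eq_0:
  "X \<in> rough_paths \<omega> p T \<Longrightarrow> (s, t) \<notin> simplex2 T \<or> w \<notin> words_upto (level p) \<Longrightarrow> X s t w = 0"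
  by (simp add: rough_paths_def)

text \<open>Since \<open>\<iota>\<close> is adjoint to \<open>L\<close>, the factor
  \<open>L (v ! i) \<bullet> u ! i\<close> is the inner product of the basis vectors
  \<open>v ! i\<close> and \<open>\<iota> (u ! i)\<close>, and orthonormality leaves one
  summand.\<close>

lemma tensor_map_words:
  assumes \<iota>: "\<And>b. b \<in> Basis \<Longrightarrow> \<iota> b \<in> Basis" and L: "\<And>x b. x \<bullet> \<iota> b = L x \<bullet> b" and u: "set u \<subseteq> Basis"
  shows "tensor_map L a u = a (map \<iota> u)"
proof -
  have "(\<Prod>i<length u. L (v ! i) \<bullet> u ! i) = (if v = map \<iota> u then 1 else 0)" if v: "v \<in> words (length u)" for v
  proof (cases "v = map \<iota> u")
    case True
    have "L (v ! i) \<bullet> u ! i = 1" if "i < length u" for i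
    proof -
      have "\<iota> (u ! i) \<in> Basis" using u that by (intro \<iota>) auto
      then show ?thesis using True that by (simp flip: L)
    qed
    then show ?thesis using True by simp
  next
    case False
    then obtain i where i: "i < length u" "v ! i \<noteq> \<iota> (u ! i)"
      using v by (auto simp: list_eq_iff_nth_eq in_words_iff)
    moreover have "v ! i \<in> Basis" "\<iota> (u ! i) \<in> Basis"
      using u v i by (auto simp: in_words_iff intro!: \<iota>)
    ultimately have "L (v ! i) \<bullet> u ! i = 0" by (simp add: inner_Basis flip: L)
    then show ?thesis using False i(1) by auto
  qed
  then have "(\<Sum>v\<in>words (length u). a v * (\<Prod>i<length u. L (v ! i) \<bullet> u ! i))
      = (\<Sum>v\<in>words (length u). if v = map \<iota> u then a v else 0)"
    by (intro sum.cong refl) simp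
  then have "tensor_map L a u = (\<Sum>v\<in>words (length u). if v = map \<iota> u then a v else 0)"
    using u unfolding tensor_map_def by simp
  moreover have "map \<iota> u \<in> words (length u)" using u \<iota> by (auto simp: in_words_iff)
  ultimately show ?thesis by simp
qed

context rough_setting
begin

context
  fixes X :: "real \<Rightarrow> real \<Rightarrow> 'v::euclidean_space tensor" and F :: "'w::euclidean_space \<Rightarrow> 'v \<Rightarrow>\<^sub>L 'w"
    and y0 :: 'w and Y :: "real \<Rightarrow> 'w"
  assumes X: "X \<in> rough_paths \<omega> p T" and F: "smooth F" and Y: "rde_solution \<omega> p T X F y0 Y"
begin

text \<open>Reading words through \<open>\<iota>\<close> keeps Chen's relation and, by
  \<open>lift_coeff_map\<close>, identifies the two expansions; multiplicative functionals that are
  this close agree.\<close>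

lemma map_rough_lift:
  fixes f :: "'w \<Rightarrow> 'a::euclidean_space" and L :: "'a \<Rightarrow> 'b::euclidean_space"
  assumes f: "smooth f" and L: "bounded_linear L"
    and \<iota>: "\<And>b. b \<in> Basis \<Longrightarrow> \<iota> b \<in> Basis" "\<And>x b. x \<bullet> \<iota> b = L x \<bullet> b"
  shows "map_rough L (lift \<omega> p T X (\<lambda>t w. vf_iter F w f (Y t))) = lift \<omega> p T X (\<lambda>t w. vf_iter F w (\<lambda>y. L (f y)) (Y t))"
proof -
  define R where "R = lift \<omega> p T X (\<lambda>t w. vf_iter F w f (Y t))"
  define Z where "Z = lift \<omega> p T X (\<lambda>t w. vf_iter F w (\<lambda>y. L (f y)) (Y t))"
  have Lf: "smooth (\<lambda>y. L (f y))" by (rule smooth_linear[OF L f])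
  have R: "R \<in> rough_paths \<omega> p T" and Z: "Z \<in> rough_paths \<omega> p T"
    unfolding R_def Z_def by (rule lift_rough_path(1)[OF X F Y f] lift_rough_path(1)[OF X F Y Lf])+
  have words_map: "map \<iota> u \<in> words_upto N" if "u \<in> words_upto N" for u
    using that \<iota>(1) by (auto simp: words_upto_iff)
  have "R s t (map \<iota> u) = Z s t u" if su: "u \<in> words_upto N" "0 \<le> s" "s \<le> t" "t \<le> T" for s t u
  proof (rule multiplicative_unique[OF _ rough_path_multiplicative[OF Z] _ su, where Z = "\<lambda>s t u. R s t (map \<iota> u)"])
    show "multiplicative N (\<lambda>s t u. R s t (map \<iota> u))"
      unfolding multiplicative_def
    proof (intro conjI allI impI ballI)
      fix s t :: real assume "0 \<le> s" "s \<le> t" "t \<le> T"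
      then show "R s t (map \<iota> []) = 1" using multiplicative_Nil[OF rough_path_multiplicative[OF R]] by simp
    next
      fix s r t :: real and w :: "'b list"
      assume st: "0 \<le> s" "s \<le> r" "r \<le> t" "t \<le> T" and w: "w \<in> words_upto N"
      show "R s t (map \<iota> w) = tmult (\<lambda>u. R s r (map \<iota> u)) (\<lambda>u. R r t (map \<iota> u)) w"
        using multiplicative_tmult[OF rough_path_multiplicative[OF R] st words_map[OF w]]
        by (simp add: tmult_def take_map drop_map)
    qed
    fix u :: "'b list" assume u: "u \<in> words_upto N"
    have "lift_expansion X F f Y s t (map \<iota> u) = lift_expansion X F (\<lambda>y. L (f y)) Y s t u" for s t
      unfolding lift_expansion_def lift_coeff_map[OF F f L \<iota>(2)] ..
    then have "bigO (Suc N) (\<lambda>s r t. R s t (map \<iota> u) - lift_expansion X F (\<lambda>y. L (f y)) Y s t u)"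
      using lift_rough_path(2)[OF X F Y f words_map[OF u]] unfolding R_def by simp
    from bigO_trans[OF this bigO_swap[OF lift_rough_path(2)[OF X F Y Lf u, folded Z_def]]]
    show "bigO (Suc N) (\<lambda>s r t. R s t (map \<iota> u) - Z s t u)" .
  qed
  moreover have "map_rough L R s t u = 0" "Z s t u = 0" if "\<not> ((s, t) \<in> simplex2 T \<and> u \<in> words_upto N)" for s t u
  proof -
    have R0: "R s t w = 0" if "(s, t) \<notin> simplex2 T \<or> w \<notin> words_upto N" for w
      using R that by (rule rough_paths_eq_0)
    have "(s, t) \<notin> simplex2 T \<or> \<not> set u \<subseteq> Basis \<or> length u > N" using that by (auto simp: words_upto_iff)
    then show "map_rough L R s t u = 0"
    proof (elim disjE)
      assume "length u > N"
      then have "R s t v = 0" if "v \<in> words (length u)" for v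
        using that by (intro R0) (auto simp: in_words_iff words_upto_iff)
      then show ?thesis unfolding map_rough_def tensor_map_def by (auto intro!: sum.neutral)
    qed (use R0 in \<open>auto simp: map_rough_def tensor_map_def\<close>)
    show "Z s t u = 0" using that by (intro rough_paths_eq_0[OF Z]) blast
  qed
  moreover have "map_rough L R s t u = R s t (map \<iota> u)" if "u \<in> words_upto N" for s t u
    unfolding map_rough_def using that by (intro tensor_map_words[OF \<iota>]) (simp_all add: words_upto_iff)
  ultimately have "map_rough L R s t u = Z s t u" for s t u
    by (cases "(s, t) \<in> simplex2 T \<and> u \<in> words_upto N") (auto simp: simplex2_def)
  then show ?thesis unfolding R_def Z_def by blast
qed

abbreviation (input) "solution_lift \<equiv> lift \<omega> p T X (\<lambda>t w. vf_iter F w (\<lambda>y. y) (Y t))"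

lemma solution_start: "Y 0 = y0"
  using Y unfolding rde_solution_def by blast

lemma solution_trace: "0 \<le> t \<Longrightarrow> t \<le> T \<Longrightarrow> trace_path y0 solution_lift t = Y t"
  using lift_trace[OF X F Y smooth_ident] solution_start by simp

text \<open>This is Taylor's formula along the lift, obtained without symmetrising iterated derivatives: the
  expansion of \<open>h (Y t)\<close> along \<open>X\<close> is regrouped by the chain rule into one along the lift.\<close>

lemma rde_solution_solution_lift:
  "rde_solution \<omega> p T solution_lift identity_field y0 (trace_path y0 solution_lift)"
proof -
  define R where "R = solution_lift"
  note R = lift_rough_path(1)[OF X F Y smooth_ident, folded R_def]
  note R_close = lift_rough_path(2)[OF X F Y smooth_ident, folded R_def]
  note tr = solution_trace[folded R_def]
  have cont: "continuous_on {0..T} Y" using Y unfolding rde_solution_def by blast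
  have "rde_solution \<omega> p T R identity_field y0 (trace_path y0 R)"
    unfolding rde_solution_iff[OF R]
  proof (intro conjI allI impI)
    show "continuous_on {0..T} (trace_path y0 R)"
      using cont by (rule continuous_on_cong[THEN iffD1, rotated 2]) (use tr in auto)
    show "trace_path y0 R 0 = y0" using tr[of 0] solution_start T_pos by simp
    fix h :: "'w \<Rightarrow> real" assume h: "smooth h"
    have "bigO (Suc N) (\<lambda>s r t. h (Y t) - (\<Sum>v\<in>words_upto N. X s t v * vf_iter F v h (Y s)))"
      using Y h unfolding rde_solution_iff[OF X] by blast
    moreover have "(\<Sum>v\<in>words_upto N. X s t v * vf_iter F v h (Y s))
        = (\<Sum>w\<in>words_upto N. lift_expansion X F (\<lambda>y. y) Y s t w * vf_iter identity_field w h (Y s))" for s t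
    proof -
      have "(\<Sum>v\<in>words_upto N. X s t v * vf_iter F v h (Y s))
        = (\<Sum>v\<in>words_upto N. \<Sum>w\<in>words_upto N. X s t v * (lift_coeff F (\<lambda>y. y) v w (Y s) * vf_iter identity_field w h (Y s)))"
        by (intro sum.cong refl) (simp add: vf_iter_eq_sum_lift_coeff[OF F h, of _ N] words_upto_iff sum_distrib_left)
      then show ?thesis
        unfolding lift_expansion_def by (simp add: sum_distrib_right mult.assoc) (rule sum.swap)
    qed
    moreover have "bigO (Suc N) (\<lambda>s r t.
        (\<Sum>w\<in>words_upto N. lift_expansion X F (\<lambda>y. y) Y s t w * vf_iter identity_field w h (Y s))
        - (\<Sum>w\<in>words_upto N. R s t w * vf_iter identity_field w h (Y s)))"
    proof (rule bigO_sum_diff)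
      fix w :: "'w list" assume "w \<in> words_upto N"
      from bigO_mult[OF bigO_swap[OF R_close[OF this]]
          smooth_along_path(1)[OF cont smooth_vf_iter[OF smooth_const h, of id_blinfun w]]]
      show "bigO (Suc N) (\<lambda>s r t. lift_expansion X F (\<lambda>y. y) Y s t w * vf_iter identity_field w h (Y s)
          - R s t w * vf_iter identity_field w h (Y s))" by (simp add: left_diff_distrib)
    qed
    ultimately have "bigO (Suc N) (\<lambda>s r t. h (Y t) - (\<Sum>w\<in>words_upto N. R s t w * vf_iter identity_field w h (Y s)))"
      by (auto intro: bigO_trans)
    then show "bigO (Suc N) (\<lambda>s r t. h (trace_path y0 R t)
        - (\<Sum>w\<in>words_upto N. R s t w * vf_iter identity_field w h (trace_path y0 R s)))"
      by (rule bigO_cong[THEN iffD1, rotated]) (use tr in simp)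
  qed
  then show ?thesis unfolding R_def .
qed

text \<open>An expansion in two stages: the pushforward expands along the lift \<open>R\<close> of
  \<open>Y\<close> with coefficients of \<open>identity_field\<close>, and \<open>R\<close> expands
  along \<open>X\<close>. Substituting costs order \<open>Suc N\<close>, and
  \<open>lift_coeff_compose\<close> sums the products of coefficients to those of \<open>g\<close>
  along \<open>F\<close>.\<close>

lemma pushforward_solution_lift:
  fixes g :: "'w \<Rightarrow> 'u::euclidean_space"
  assumes g: "smooth g"
  shows "pushforward \<omega> p T g y0 solution_lift = lift \<omega> p T X (\<lambda>t w. vf_iter F w g (Y t))"
proof -
  define R where "R = solution_lift"
  \<comment> \<open>\<open>pushforward\<close> refers to the trace and not to \<open>Y\<close>; the
    two are known to agree on \<open>[0, T]\<close> only.\<close>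
  define P where "P = trace_path y0 R"
  note R = lift_rough_path(1)[OF X F Y smooth_ident, folded R_def]
  note R_close = lift_rough_path(2)[OF X F Y smooth_ident, folded R_def]
  note P = rde_solution_solution_lift[folded R_def, folded P_def]
  have tr: "P t = Y t" if "0 \<le> t" "t \<le> T" for t using solution_trace[folded R_def] that unfolding P_def by blast
  have id: "smooth (identity_field :: 'w \<Rightarrow> 'w \<Rightarrow>\<^sub>L 'w)" by (rule smooth_const)
  have cont: "continuous_on {0..T} Y" using Y unfolding rde_solution_def by blast
  define Z where "Z = lift \<omega> p T R (\<lambda>t w. vf_iter identity_field w g (P t))"
  have Z: "Z \<in> rough_paths \<omega> p T" unfolding Z_def by (rule lift_rough_path(1)[OF R id P g])
  have "bigO (Suc N) (\<lambda>s r t. Z s t u - lift_expansion X F g Y s t u)" if u: "u \<in> words_upto N" for u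
  proof -
    have 1: "bigO (Suc N) (\<lambda>s r t. Z s t u - lift_expansion R identity_field g P s t u)"
      unfolding Z_def by (rule lift_rough_path(2)[OF R id P g u])
    have "bigO (Suc N) (\<lambda>s r t. (\<Sum>w\<in>words_upto N. R s t w * lift_coeff identity_field g w u (Y s))
        - (\<Sum>w\<in>words_upto N. lift_expansion X F (\<lambda>y. y) Y s t w * lift_coeff identity_field g w u (Y s)))"
    proof (rule bigO_sum_diff)
      fix w :: "'w list" assume "w \<in> words_upto N"
      from bigO_mult[OF R_close[OF this] smooth_along_path(1)[OF cont smooth_lift_coeff[OF id g, of w u]]]
      show "bigO (Suc N) (\<lambda>s r t. R s t w * lift_coeff identity_field g w u (Y s)
          - lift_expansion X F (\<lambda>y. y) Y s t w * lift_coeff identity_field g w u (Y s))"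
        by (simp add: left_diff_distrib)
    qed
    moreover have "(\<Sum>w\<in>words_upto N. lift_expansion X F (\<lambda>y. y) Y s t w * lift_coeff identity_field g w u (Y s))
        = lift_expansion X F g Y s t u" for s t
    proof -
      have "lift_expansion X F g Y s t u = (\<Sum>v\<in>words_upto N. \<Sum>w\<in>words_upto N.
          X s t v * (lift_coeff F (\<lambda>y. y) v w (Y s) * lift_coeff identity_field g w u (Y s)))"
        unfolding lift_expansion_def
        by (intro sum.cong refl) (simp add: lift_coeff_compose[OF F g, of _ N, symmetric] words_upto_iff sum_distrib_left)
      then show ?thesis
        unfolding lift_expansion_def[of X F "\<lambda>y. y"] by (simp add: sum_distrib_right mult.assoc) (rule sum.swap)
    qed
    ultimately have "bigO (Suc N) (\<lambda>s r t. (\<Sum>w\<in>words_upto N. R s t w * lift_coeff identity_field g w u (Y s))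
        - lift_expansion X F g Y s t u)" by simp
    then have 2: "bigO (Suc N) (\<lambda>s r t. lift_expansion R identity_field g P s t u - lift_expansion X F g Y s t u)"
      by (rule bigO_cong[THEN iffD1, rotated]) (simp add: lift_expansion_def[of R] tr)
    show ?thesis by (rule bigO_trans[OF 1 2])
  qed
  from lift_eqI[OF X F Y g Z this]
  show ?thesis unfolding pushforward_def iter_deriv_eq_vf_iter Z_def P_def R_def by simp
qed

end

end

section \<open>The joint and the transported coefficient, and the theorem\<close>

lemma blinfun_apply_Dblinfun:
  "smooth g \<Longrightarrow> blinfun_apply (Dblinfun g y) v = frechet_derivative g (at y) v"
  using bounded_linear_Blinfun_apply has_derivative_bounded_linear smooth_has_derivative by metis

lemma joint_coefficient_apply:
  assumes "smooth g"
  shows "blinfun_apply (joint_coefficient F g (y, z)) v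
    = (blinfun_apply (F y) v, frechet_derivative g (at y) (blinfun_apply (F y) v))"
  unfolding joint_coefficient_def prod.case
  by (subst bounded_linear_Blinfun_apply)
    (simp_all add: blinfun_apply_Dblinfun assms bounded_linear_Pair blinfun.bounded_linear_right
      bounded_linear_compose[OF has_derivative_bounded_linear[OF smooth_has_derivative[OF assms]]])

lemma smooth_joint_coefficient:
  fixes F :: "'w::euclidean_space \<Rightarrow> 'v::euclidean_space \<Rightarrow>\<^sub>L 'w" and g :: "'w \<Rightarrow> 'u::euclidean_space"
  assumes F: "smooth F" and g: "smooth g"
  shows "smooth (joint_coefficient F g)"
proof -
  \<comment> \<open>The inclusions of the factors write the coefficient as a sum of compositions, so
    that its smoothness follows from bilinearity of composition.\<close>
  define J1 :: "'w \<Rightarrow>\<^sub>L ('w \<times> 'u)" where "J1 = Blinfun (\<lambda>a. (a, 0))"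
  define J2 :: "'u \<Rightarrow>\<^sub>L ('w \<times> 'u)" where "J2 = Blinfun (\<lambda>b. (0, b))"
  have J: "blinfun_apply J1 a = (a, 0)" "blinfun_apply J2 b = (0, b)" for a b
    unfolding J1_def J2_def
    by (simp_all add: bounded_linear_Blinfun_apply bounded_linear_Pair bounded_linear_ident bounded_linear_zero)
  have "joint_coefficient F g q = (J1 o\<^sub>L F (fst q)) + (J2 o\<^sub>L (Dblinfun g (fst q) o\<^sub>L F (fst q)))" for q
    by (cases q, rule blinfun_eqI) (simp add: joint_coefficient_apply[OF g] J blinfun.add_left blinfun_apply_Dblinfun[OF g])
  then have "joint_coefficient F g = (\<lambda>q. (J1 o\<^sub>L F (fst q)) + (J2 o\<^sub>L (Dblinfun g (fst q) o\<^sub>L F (fst q))))"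
    by blast
  moreover have "smooth \<dots>"
    by (intro smooth_add smooth_bilinear[OF bounded_bilinear_blinfun_compose] smooth_const
        smooth_compose[OF F] smooth_compose[OF smooth_Dblinfun[OF g]] smooth_bounded_linear[OF bounded_linear_fst])
  ultimately show ?thesis by simp
qed

lemma smooth_transported_coefficient:
  assumes "smooth F" "smooth g" "smooth (inv g)"
  shows "smooth (transported_coefficient F g)"
  unfolding transported_coefficient_def
  by (intro smooth_bilinear[OF bounded_bilinear_blinfun_compose]
      smooth_compose[OF smooth_Dblinfun[OF assms(2)] assms(3)] smooth_compose[OF assms(1,3)])

theorem theorem2p27:
  fixes \<omega> :: "real \<Rightarrow> real \<Rightarrow> real" and p T :: real
    and X :: "real \<Rightarrow> real \<Rightarrow> 'v::euclidean_space tensor"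
    and F :: "'w::euclidean_space \<Rightarrow> 'v \<Rightarrow>\<^sub>L 'w" and y0 :: 'w
    and Y :: "real \<Rightarrow> real \<Rightarrow> 'w tensor"
    and g :: "'w \<Rightarrow> 'u::euclidean_space"
  assumes "T > 0" and "p \<ge> 1" and "control T \<omega>"
    and "X \<in> rough_paths \<omega> p T"
    and "smooth F"
    and "Y \<in> rough_paths \<omega> p T" and "rough_solution \<omega> p T X F y0 Y"
    and "smooth g"
  shows "jointly_solve \<omega> p T X (joint_coefficient F g) (y0, g y0) Y (pushforward \<omega> p T g y0 Y) \<and>
    (bij g \<longrightarrow>
      (smooth (inv g) \<longrightarrow> smooth (transported_coefficient F g)) \<and>
      (smooth (transported_coefficient F g) \<longrightarrow>
         rough_solution \<omega> p T X (transported_coefficient F g) (g y0) (pushforward \<omega> p T g y0 Y)))"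
proof -
  interpret rough_setting T \<omega> p
    by unfold_locales (use assms in auto)
  note X = \<open>X \<in> rough_paths \<omega> p T\<close> and F = \<open>smooth F\<close> and g = \<open>smooth g\<close>
  obtain y where y: "rde_solution \<omega> p T X F y0 y"
    and Y: "Y = lift \<omega> p T X (\<lambda>t w. vf_iter F w (\<lambda>y. y) (y t))"
    using assms unfolding rough_solution_def by blast
  have push: "pushforward \<omega> p T g y0 Y = lift \<omega> p T X (\<lambda>t w. vf_iter F w g (y t))"
    unfolding Y by (rule pushforward_solution_lift[OF X F y g])
  \<comment> \<open>The graph map. Its derivative composed with \<open>F y\<close> is the joint
    coefficient at \<open>\<gamma> y\<close>, so it intertwines the two equations.\<close>
  define \<gamma> where "\<gamma> y = (y, g y)" for y
  have \<gamma>: "smooth \<gamma>" unfolding \<gamma>_def by (intro smooth_Pair smooth_ident g)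
  note G = smooth_joint_coefficient[OF F g]
  have related: "frechet_derivative \<gamma> (at y) (blinfun_apply (F y) v) = blinfun_apply (joint_coefficient F g (\<gamma> y)) v" for y v
  proof -
    have "(\<gamma> has_derivative (\<lambda>v. (v, frechet_derivative g (at y) v))) (at y)"
      unfolding \<gamma>_def by (intro has_derivative_Pair has_derivative_ident smooth_has_derivative g)
    from frechet_derivative_eq[OF this] show ?thesis by (simp add: \<gamma>_def joint_coefficient_apply[OF g])
  qed
  \<comment> \<open>Seen along \<open>F\<close> this is the lift of the graph map, which gives its
    components under the projections; seen along the joint coefficient it is the rough path
    solution.\<close>
  define Q where "Q = lift \<omega> p T X (\<lambda>t w. vf_iter F w \<gamma> (y t))"
  have "jointly_solve \<omega> p T X (joint_coefficient F g) (y0, g y0) Y (pushforward \<omega> p T g y0 Y)"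
    unfolding jointly_solve_def
  proof (intro exI[of _ Q] conjI)
    have "rde_solution \<omega> p T X (joint_coefficient F g) (\<gamma> y0) (\<lambda>t. \<gamma> (y t))"
      by (rule rde_solution_compose[OF X y G \<gamma> related])
    moreover have "Q = lift \<omega> p T X (\<lambda>t w. vf_iter (joint_coefficient F g) w (\<lambda>q. q) (\<gamma> (y t)))"
      unfolding Q_def using fun_cong[OF vf_iter_compose[OF G smooth_ident \<gamma> related]] by simp
    ultimately show "rough_solution \<omega> p T X (joint_coefficient F g) (y0, g y0) Q"
      unfolding rough_solution_def \<gamma>_def[of y0] by (intro exI[of _ "\<lambda>t. \<gamma> (y t)"] conjI)
    have "map_rough fst Q = lift \<omega> p T X (\<lambda>t w. vf_iter F w (\<lambda>y. fst (\<gamma> y)) (y t))"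
      unfolding Q_def
      by (rule map_rough_lift[OF X F y \<gamma> bounded_linear_fst, of "\<lambda>b. (b, 0)"]) (auto simp: Basis_prod_def inner_prod_def)
    then show "map_rough fst Q = Y" unfolding Y by (simp add: \<gamma>_def)
    have "map_rough snd Q = lift \<omega> p T X (\<lambda>t w. vf_iter F w (\<lambda>y. snd (\<gamma> y)) (y t))"
      unfolding Q_def
      by (rule map_rough_lift[OF X F y \<gamma> bounded_linear_snd, of "\<lambda>b. (0, b)"]) (auto simp: Basis_prod_def inner_prod_def)
    then show "map_rough snd Q = pushforward \<omega> p T g y0 Y" unfolding push by (simp add: \<gamma>_def)
  qed
  moreover have "rough_solution \<omega> p T X (transported_coefficient F g) (g y0) (pushforward \<omega> p T g y0 Y)"
    if "bij g" and H: "smooth (transported_coefficient F g)"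
  proof -
    \<comment> \<open>Injectivity gives \<open>inv g (g y) = y\<close>, so that the transported
      coefficient at \<open>g y\<close> is evaluated at \<open>y\<close> itself.\<close>
    have related: "frechet_derivative g (at y) (blinfun_apply (F y) v)
        = blinfun_apply (transported_coefficient F g (g y)) v" for y v
      using \<open>bij g\<close> by (simp add: transported_coefficient_def blinfun_apply_Dblinfun[OF g] bij_is_inj)
    have "lift \<omega> p T X (\<lambda>t w. vf_iter F w g (y t))
        = lift \<omega> p T X (\<lambda>t w. vf_iter (transported_coefficient F g) w (\<lambda>z. z) (g (y t)))"
      using fun_cong[OF vf_iter_compose[OF H smooth_ident g related]] by simp
    with rde_solution_compose[OF X y H g related] show ?thesis
      unfolding rough_solution_def push by (intro exI[of _ "\<lambda>t. g (y t)"] conjI)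
  qed
  ultimately show ?thesis using smooth_transported_coefficient[OF F g] by blast
qed

end
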